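(* Let $K$ be an alternating and positive (or negative) knot of prime determinant. Then the link quandle of a connected sum of $K$ with any link is not bi-orderable. In particular, the knot quandle of $K$ is not bi-orderable.
   Context: Links are oriented tame links in the 3-sphere; a connected sum of a knot with a link is formed along a chosen component of the link. The determinant of a knot is $|\Delta_K(-1)|$, where $\Delta_K$ is its Alexander polynomial. A knot is alternating if it has an alternating diagram; it is positive (negative) if it has a diagram all of whose crossings are positive (negative). A quandle is a non-empty set $Q$ with a binary operation $*$ such that $x*x=x$; for all $x,y$ there is a unique $z$ (denoted $x*^{-1}y$) with $x=z*y$; and $(x*y)*z=(x*z)*(y*z)$. $Q$ is bi-orderable if it has a (strict) linear order $<$ such that $x<y$ implies $x*z<y*z$ and $z*x<z*y$ for all $x,y,z\in Q$. The link quandle of an oriented link (knot quandle for a knot) is the quandle presented by generators the arcs of a diagram and one relation per crossing: if $y$ is the over arc and $x$, $z$ are the incoming and outgoing under arcs, then $z=x*y$ if the crossing is positive and $z=x*^{-1}y$ if it is negative; up to isomorphism it does not depend on the diagram. *)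

theory Defs
  imports
    "Jordan_Normal_Form.Determinant"
    "HOL-Computational_Algebra.Primes"
    "HOL-Combinatorics.Orbits"
    "HOL-Combinatorics.Transposition"
begin

section \<open>Quandles\<close>

record 'a magma =
  qcarrier :: "'a set"
  qop :: "'a \<Rightarrow> 'a \<Rightarrow> 'a"

definition is_quandle :: "('a, 'm) magma_scheme \<Rightarrow> bool" where
  "is_quandle Q \<longleftrightarrow>
     qcarrier Q \<noteq> {} \<and>
     (\<forall>x\<in>qcarrier Q. \<forall>y\<in>qcarrier Q. qop Q x y \<in> qcarrier Q) \<and>
     (\<forall>x\<in>qcarrier Q. qop Q x x = x) \<and>
     (\<forall>x\<in>qcarrier Q. \<forall>y\<in>qcarrier Q. \<exists>!z. z \<in> qcarrier Q \<and> x = qop Q z y) \<and>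
     (\<forall>x\<in>qcarrier Q. \<forall>y\<in>qcarrier Q. \<forall>z\<in>qcarrier Q.
        qop Q (qop Q x y) z = qop Q (qop Q x z) (qop Q y z))"

definition bi_orderable :: "('a, 'm) magma_scheme \<Rightarrow> bool" where
  "bi_orderable Q \<longleftrightarrow> (\<exists>lt :: 'a \<Rightarrow> 'a \<Rightarrow> bool.
     (\<forall>x\<in>qcarrier Q. \<not> lt x x) \<and>
     (\<forall>x\<in>qcarrier Q. \<forall>y\<in>qcarrier Q. \<forall>z\<in>qcarrier Q. lt x y \<longrightarrow> lt y z \<longrightarrow> lt x z) \<and>
     (\<forall>x\<in>qcarrier Q. \<forall>y\<in>qcarrier Q. x \<noteq> y \<longrightarrow> lt x y \<or> lt y x) \<and>
     (\<forall>x\<in>qcarrier Q. \<forall>y\<in>qcarrier Q. \<forall>z\<in>qcarrier Q.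
        lt x y \<longrightarrow> lt (qop Q x z) (qop Q y z) \<and> lt (qop Q z x) (qop Q z y)))"

text \<open>
  The quandle presented by generators \<open>G\<close> and relations \<open>R\<close>: terms over \<open>G\<close> in the two operations
  \<open>x * y\<close> (\<open>Op\<close>) and \<open>x *\<^sup>-\<^sup>1 y\<close> (\<open>InvOp\<close>), modulo the least congruence that contains \<open>R\<close> and the
  quandle axioms.
\<close>

datatype (gens: 'g) qterm = Gen 'g | Op "'g qterm" "'g qterm" | InvOp "'g qterm" "'g qterm"

definition qterms :: "'g set \<Rightarrow> 'g qterm set" where
  "qterms G = {t. gens t \<subseteq> G}"

inductive qcong :: "'g set \<Rightarrow> ('g qterm \<times> 'g qterm) set \<Rightarrow> 'g qterm \<Rightarrow> 'g qterm \<Rightarrow> bool"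
  for G :: "'g set" and R :: "('g qterm \<times> 'g qterm) set" where
  qc_refl: "t \<in> qterms G \<Longrightarrow> qcong G R t t"
| qc_sym: "qcong G R s t \<Longrightarrow> qcong G R t s"
| qc_trans: "qcong G R s t \<Longrightarrow> qcong G R t u \<Longrightarrow> qcong G R s u"
| qc_op: "qcong G R s s' \<Longrightarrow> qcong G R t t' \<Longrightarrow> qcong G R (Op s t) (Op s' t')"
| qc_inv_op: "qcong G R s s' \<Longrightarrow> qcong G R t t' \<Longrightarrow> qcong G R (InvOp s t) (InvOp s' t')"
| qc_rel: "(s, t) \<in> R \<Longrightarrow> s \<in> qterms G \<Longrightarrow> t \<in> qterms G \<Longrightarrow> qcong G R s t"
| qc_idem: "t \<in> qterms G \<Longrightarrow> qcong G R (Op t t) t"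
| qc_right: "s \<in> qterms G \<Longrightarrow> t \<in> qterms G \<Longrightarrow> qcong G R (Op (InvOp s t) t) s"
| qc_left: "s \<in> qterms G \<Longrightarrow> t \<in> qterms G \<Longrightarrow> qcong G R (InvOp (Op s t) t) s"
| qc_dist: "s \<in> qterms G \<Longrightarrow> t \<in> qterms G \<Longrightarrow> u \<in> qterms G \<Longrightarrow>
    qcong G R (Op (Op s t) u) (Op (Op s u) (Op t u))"

definition presented_quandle ::
    "'g set \<Rightarrow> ('g qterm \<times> 'g qterm) set \<Rightarrow> 'g qterm set magma" where
  "presented_quandle G R =
     \<lparr> qcarrier = qterms G // {(s, t). qcong G R s t},
       qop = (\<lambda>X Y. {t. \<exists>x\<in>X. \<exists>y\<in>Y. qcong G R (Op x y) t}) \<rparr>"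

lemma qterms_simps [simp]:
  "Gen g \<in> qterms G \<longleftrightarrow> g \<in> G"
  "Op s t \<in> qterms G \<longleftrightarrow> s \<in> qterms G \<and> t \<in> qterms G"
  "InvOp s t \<in> qterms G \<longleftrightarrow> s \<in> qterms G \<and> t \<in> qterms G"
  by (auto simp: qterms_def)

lemma qcong_in_qterms: "qcong G R s t \<Longrightarrow> s \<in> qterms G \<and> t \<in> qterms G"
  by (induction rule: qcong.induct) auto

lemma equiv_qcong: "equiv (qterms G) {(s, t). qcong G R s t}"
  by (rule equivI) (auto simp: refl_on_def sym_def trans_def
      intro: qc_refl qc_sym qc_trans dest: qcong_in_qterms)

lemma is_quandle_presented_quandle:
  assumes "G \<noteq> {}"
  shows "is_quandle (presented_quandle G R)"
proof -
  define E where "E = {(s, t). qcong G R s t}"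
  define P where "P = presented_quandle G R"
  have eq: "equiv (qterms G) E" unfolding E_def by (rule equiv_qcong)
  have car: "qcarrier P = qterms G // E"
    by (simp add: P_def presented_quandle_def E_def)
  have op: "qop P (E `` {s}) (E `` {t}) = E `` {Op s t}" if "s \<in> qterms G" "t \<in> qterms G" for s t
    using that
    by (auto simp: P_def presented_quandle_def E_def intro: qc_refl)
       (meson qc_op qc_trans)
  have cls: "E `` {s} = E `` {t} \<longleftrightarrow> qcong G R s t" if "s \<in> qterms G" "t \<in> qterms G" for s t
    using eq_equiv_class_iff[OF eq that] by (simp add: E_def)
  have all: "(\<forall>x\<in>qterms G // E. \<phi> x) \<longleftrightarrow> (\<forall>s\<in>qterms G. \<phi> (E `` {s}))" for \<phi>
    by (auto simp: quotient_def)
  have mem: "E `` {s} \<in> qterms G // E" if "s \<in> qterms G" for s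
    using that by (rule quotientI)
  have uniq: "\<exists>!z. z \<in> qterms G // E \<and> E `` {s} = qop P z (E `` {t})"
    if st: "s \<in> qterms G" "t \<in> qterms G" for s t
  proof (rule ex1I[where a = "E `` {InvOp s t}"])
    show "E `` {InvOp s t} \<in> qterms G // E \<and> E `` {s} = qop P (E `` {InvOp s t}) (E `` {t})"
      using st by (auto simp: op mem cls intro: qc_sym qc_right)
  next
    fix z assume z: "z \<in> qterms G // E \<and> E `` {s} = qop P z (E `` {t})"
    then obtain u where u: "u \<in> qterms G" "z = E `` {u}" by (auto elim: quotientE)
    then have "qcong G R s (Op u t)" using z st by (simp add: op cls)
    then have "qcong G R (InvOp s t) (InvOp (Op u t) t)" using st by (auto intro: qc_inv_op qc_refl)
    then have "qcong G R (InvOp s t) u" using st u by (meson qc_left qc_trans)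
    then show "z = E `` {InvOp s t}" using st u by (simp add: cls qc_sym)
  qed
  obtain g where "g \<in> G" using assms by auto
  then have "E `` {Gen g} \<in> qterms G // E" by (intro mem) simp
  then show ?thesis
    unfolding P_def[symmetric] is_quandle_def car all
    using uniq by (auto simp: op mem cls intro: qc_idem qc_dist)
qed


section \<open>Oriented link diagrams\<close>

text \<open>
  An oriented link diagram on the 2-sphere is recorded by its signed Gauss data.  Its points are the
  passages \<open>Over c\<close> and \<open>Under c\<close> through each crossing \<open>c\<close>, and marks \<open>Mark m\<close>, which are
  2-valent vertices without any geometric meaning; they let a component without crossings have a
  point.  \<open>nxt\<close> sends a point to the following one along the orientation, so that its cycles are the
  components of the link, and \<open>csign\<close> gives the signs of the crossings.  A point \<open>v\<close> also stands for
  the edge of the diagram that runs from \<open>v\<close> to \<open>nxt v\<close>.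
\<close>

datatype point = Over nat | Under nat | Mark nat

datatype diagram =
  Diagram (points: "point set") (nxt: "point \<Rightarrow> point") (csign: "nat \<Rightarrow> int")

definition crossings :: "diagram \<Rightarrow> nat set" where
  "crossings D = {c. Over c \<in> points D}"

definition prv :: "diagram \<Rightarrow> point \<Rightarrow> point" where
  "prv D = inv_into (points D) (nxt D)"

definition gauss_data :: "diagram \<Rightarrow> bool" where
  "gauss_data D \<longleftrightarrow> finite (points D) \<and> points D \<noteq> {} \<and>
     bij_betw (nxt D) (points D) (points D) \<and>
     (\<forall>c. Over c \<in> points D \<longleftrightarrow> Under c \<in> points D) \<and>
     (\<forall>c\<in>crossings D. csign D c \<in> {1, -1})"

text \<open>
  Signed Gauss data comes from a diagram on the sphere iff the surface of its combinatorial map has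
  genus zero.  The half-edges are \<open>Out v\<close> and \<open>In v\<close>, leaving and entering the point \<open>v\<close>;
  \<open>rotate\<close> is the counterclockwise successor around a vertex.  At a positive crossing the under
  strand crosses the over strand from right to left, at a negative one from left to right.
\<close>

datatype half_edge = Out point | In point

fun rotate :: "diagram \<Rightarrow> half_edge \<Rightarrow> half_edge" where
  "rotate D (Out (Over c)) = (if csign D c = 1 then Out (Under c) else In (Under c))"
| "rotate D (In (Over c)) = (if csign D c = 1 then In (Under c) else Out (Under c))"
| "rotate D (Out (Under c)) = (if csign D c = 1 then In (Over c) else Out (Over c))"
| "rotate D (In (Under c)) = (if csign D c = 1 then Out (Over c) else In (Over c))"
| "rotate D (Out (Mark m)) = In (Mark m)"
| "rotate D (In (Mark m)) = Out (Mark m)"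

fun other_end :: "diagram \<Rightarrow> half_edge \<Rightarrow> half_edge" where
  "other_end D (Out v) = In (nxt D v)"
| "other_end D (In v) = Out (prv D v)"

definition half_edges :: "diagram \<Rightarrow> half_edge set" where
  "half_edges D = Out ` points D \<union> In ` points D"

definition faces :: "diagram \<Rightarrow> half_edge set set" where
  "faces D = orbit (\<lambda>h. rotate D (other_end D h)) ` half_edges D"

text \<open>The connected components of the underlying graph, as sets of points.\<close>

definition graph_pieces :: "diagram \<Rightarrow> point set set" where
  "graph_pieces D =
     (let A = {(v, nxt D v) |v. v \<in> points D} \<union> {(Over c, Under c) |c. c \<in> crossings D}
      in (\<lambda>v. (A \<union> A\<inverse>)\<^sup>* `` {v}) ` points D)"

text \<open>
  Euler's formula \<open>V - E + F = 2 k\<close>, with \<open>k\<close> the number of connected components: the vertices are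
  the crossings and the marks, so there are \<open>card (points D) - card (crossings D)\<close> of them, and
  the edges correspond to the points.
\<close>

definition planar :: "diagram \<Rightarrow> bool" where
  "planar D \<longleftrightarrow>
     (int (card (points D)) - int (card (crossings D))) - int (card (points D))
       + int (card (faces D)) = 2 * int (card (graph_pieces D))"

definition link_diagram :: "diagram \<Rightarrow> bool" where
  "link_diagram D \<longleftrightarrow> gauss_data D \<and> planar D"

definition components :: "diagram \<Rightarrow> point set set" where
  "components D = orbit (nxt D) ` points D"

definition positive_diagram :: "diagram \<Rightarrow> bool" where
  "positive_diagram D \<longleftrightarrow> (\<forall>c\<in>crossings D. csign D c = 1)"

definition negative_diagram :: "diagram \<Rightarrow> bool" where
  "negative_diagram D \<longleftrightarrow> (\<forall>c\<in>crossings D. csign D c = -1)"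

text \<open>\<open>next_passage D v w\<close>: the first passage through a crossing after \<open>v\<close> is \<open>w\<close>.\<close>

inductive next_passage :: "diagram \<Rightarrow> point \<Rightarrow> point \<Rightarrow> bool" for D where
  "nxt D v = w \<Longrightarrow> (\<forall>m. w \<noteq> Mark m) \<Longrightarrow> next_passage D v w"
| "nxt D v = Mark m \<Longrightarrow> next_passage D (Mark m) w \<Longrightarrow> next_passage D v w"

definition alternating_diagram :: "diagram \<Rightarrow> bool" where
  "alternating_diagram D \<longleftrightarrow>
     (\<forall>c\<in>crossings D. \<forall>w. (next_passage D (Over c) w \<longrightarrow> (\<exists>d. w = Under d)) \<and>
                          (next_passage D (Under c) w \<longrightarrow> (\<exists>d. w = Over d)))"

text \<open>
  An arc is a maximal chain of edges that follow each other over crossings and through marks (or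
  a whole component, if that is never an under strand).
\<close>

definition arc_of :: "diagram \<Rightarrow> point \<Rightarrow> point set" where
  "arc_of D v =
     (let A = {(u, nxt D u) |u. u \<in> points D \<and> (\<forall>c. nxt D u \<noteq> Under c)}
      in (A \<union> A\<inverse>)\<^sup>* `` {v})"

definition arcs :: "diagram \<Rightarrow> point set set" where
  "arcs D = arc_of D ` points D"

definition over_arc :: "diagram \<Rightarrow> nat \<Rightarrow> point set" where
  "over_arc D c = arc_of D (Over c)"

definition incoming_arc :: "diagram \<Rightarrow> nat \<Rightarrow> point set" where
  "incoming_arc D c = arc_of D (prv D (Under c))"

definition outgoing_arc :: "diagram \<Rightarrow> nat \<Rightarrow> point set" where
  "outgoing_arc D c = arc_of D (Under c)"

definition crossing_relation ::
    "diagram \<Rightarrow> nat \<Rightarrow> point set qterm \<times> point set qterm" where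
  "crossing_relation D c =
     (let x = Gen (incoming_arc D c); y = Gen (over_arc D c); z = Gen (outgoing_arc D c)
      in (z, if csign D c = 1 then Op x y else InvOp x y))"

definition link_quandle :: "diagram \<Rightarrow> point set qterm set magma" where
  "link_quandle D = presented_quandle (arcs D) (crossing_relation D ` crossings D)"

lemma is_quandle_link_quandle: "link_diagram D \<Longrightarrow> is_quandle (link_quandle D)"
  unfolding link_quandle_def
  by (rule is_quandle_presented_quandle)
     (auto simp: arcs_def link_diagram_def gauss_data_def)

text \<open>
  The Alexander matrix, with one row per crossing and one column per arc, holds the relations
  \<open>z = t x + (1 - t) y\<close> of the positive and \<open>x = t z + (1 - t) y\<close> of the negative crossings
  (\<open>x, z\<close> the incoming and outgoing under arcs, \<open>y\<close> the over arc); arcs that coincide at a crossing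
  have their contributions added.  For a diagram of a knot, deleting one row and one column leaves
  a square matrix, whose determinant is the Alexander polynomial up to a unit \<open>\<plusminus> t\<^sup>k\<close>.
  Since the crossings and the arcs may be listed in any order, deleting the last row and the last
  column is no restriction.  Without crossings the matrix left is empty and the polynomial is 1.
\<close>

definition alexander_entry :: "diagram \<Rightarrow> nat \<Rightarrow> point set \<Rightarrow> int poly" where
  "alexander_entry D c a =
     (if a = over_arc D c then 1 - monom 1 1 else 0)
     + (if a = incoming_arc D c then (if csign D c = 1 then monom 1 1 else -1) else 0)
     + (if a = outgoing_arc D c then (if csign D c = 1 then -1 else monom 1 1) else 0)"

definition alexander_polynomial :: "diagram \<Rightarrow> int poly \<Rightarrow> bool" where
  "alexander_polynomial D \<Delta> \<longleftrightarrow>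
     (\<exists>cs as. distinct cs \<and> set cs = crossings D \<and> distinct as \<and> set as = arcs D \<and>
        (let n = card (crossings D)
         in \<Delta> = det (mat (n - 1) (n - 1) (\<lambda>(i, j). alexander_entry D (cs ! i) (as ! j)))))"


section \<open>Links\<close>

text \<open>
  Oriented tame links in the 3-sphere up to isotopy are given by their diagrams up to isomorphism and
  the Reidemeister moves.  Each move below is stated in one direction and with all possible orientations.
  The moves are only applied between planar diagrams (see \<open>move\<close> and \<open>isotopic\<close> below): for the
  first move this is automatic, for the second it says that the two edges, when they belong to the
  same piece of the diagram, lie on a common face.
\<close>

definition diagram_iso :: "diagram \<Rightarrow> diagram \<Rightarrow> bool" where
  "diagram_iso D D' \<longleftrightarrow> (\<exists>h g. bij_betw h (points D) (points D') \<and>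
     (\<forall>v\<in>points D. h (nxt D v) = nxt D' (h v)) \<and>
     (\<forall>c\<in>crossings D. h (Over c) = Over (g c) \<and> h (Under c) = Under (g c) \<and>
                       csign D' (g c) = csign D c) \<and>
     (\<forall>m. Mark m \<in> points D \<longrightarrow> (\<exists>m'. h (Mark m) = Mark m')))"

definition add_mark :: "diagram \<Rightarrow> diagram \<Rightarrow> bool" where
  "add_mark D D' \<longleftrightarrow> (\<exists>p m. p \<in> points D \<and> Mark m \<notin> points D \<and>
     D' = Diagram (insert (Mark m) (points D))
            ((nxt D)(p := Mark m, Mark m := nxt D p)) (csign D))"

text \<open>A kink is inserted into the edge \<open>p\<close>.\<close>

definition reidemeister1 :: "diagram \<Rightarrow> diagram \<Rightarrow> bool" where
  "reidemeister1 D D' \<longleftrightarrow> (\<exists>p c u v s. p \<in> points D \<and> c \<notin> crossings D \<and> s \<in> {1, -1} \<and>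
     ((u, v) = (Over c, Under c) \<or> (u, v) = (Under c, Over c)) \<and>
     D' = Diagram (points D \<union> {u, v})
            ((nxt D)(p := u, u := v, v := nxt D p)) ((csign D)(c := s)))"

text \<open>
  The edge \<open>p\<close> is pushed over the edge \<open>q\<close>, which runs in parallel or in opposite direction.  As the
  signs of the new crossings are opposite, the two new edges between them bound a 2-gon.  To push
  an edge over itself, first subdivide it by a mark.
\<close>

definition reidemeister2 :: "diagram \<Rightarrow> diagram \<Rightarrow> bool" where
  "reidemeister2 D D' \<longleftrightarrow> (\<exists>p q c d u v s. p \<in> points D \<and> q \<in> points D \<and> p \<noteq> q \<and>
     c \<notin> crossings D \<and> d \<notin> crossings D \<and> c \<noteq> d \<and> s \<in> {1, -1} \<and>
     ((u, v) = (Under c, Under d) \<or> (u, v) = (Under d, Under c)) \<and>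
     D' = Diagram (points D \<union> {Over c, Over d, Under c, Under d})
            ((nxt D)(p := Over c, Over c := Over d, Over d := nxt D p,
                     q := u, u := v, v := nxt D q))
            ((csign D)(c := s, d := - s)))"

text \<open>
  \<open>consecutive D e u v\<close>: the points \<open>u, v\<close> are joined by an edge, directed from \<open>u\<close> to \<open>v\<close> if
  \<open>e = 1\<close> and from \<open>v\<close> to \<open>u\<close> if \<open>e = -1\<close>.
\<close>

definition consecutive :: "diagram \<Rightarrow> int \<Rightarrow> point \<Rightarrow> point \<Rightarrow> bool" where
  "consecutive D e u v \<longleftrightarrow> (e = 1 \<and> nxt D u = v) \<or> (e = -1 \<and> nxt D v = u)"

text \<open>
  Three strands, top, middle and bottom, cross pairwise: \<open>c\<close> is the crossing of top and middle, \<open>d\<close>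
  of top and bottom, \<open>e\<close> of middle and bottom.  The two equations between signs say that the three
  edges bound a triangle.  Indeed, for straight strands whose directions, suitably scaled, are
  \<open>t, m, b\<close>, the sides of the triangle give \<open>j m = i t + k b\<close> with the \<open>i, j, k\<close> below; take the cross
  product of this with \<open>t\<close> and with \<open>b\<close>, and note that the sign of a crossing is the sign of the
  cross product of the directions of its over and under strands.  The move interchanges the two
  passages on each of the three strands.
\<close>

definition reidemeister3 :: "diagram \<Rightarrow> diagram \<Rightarrow> bool" where
  "reidemeister3 D D' \<longleftrightarrow> (\<exists>c d e i j k.
     c \<in> crossings D \<and> d \<in> crossings D \<and> e \<in> crossings D \<and> c \<noteq> d \<and> d \<noteq> e \<and> c \<noteq> e \<and>
     consecutive D i (Over c) (Over d) \<and>
     consecutive D j (Under c) (Over e) \<and>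
     consecutive D k (Under d) (Under e) \<and>
     j * csign D c = k * csign D d \<and> j * csign D e = i * csign D d \<and>
     (let \<pi> = transpose (Over c) (Over d) \<circ> transpose (Under c) (Over e)
              \<circ> transpose (Under d) (Under e)
      in D' = Diagram (points D) (\<pi> \<circ> nxt D \<circ> \<pi>) (csign D)))"

definition move :: "diagram \<Rightarrow> diagram \<Rightarrow> bool" where
  "move D D' \<longleftrightarrow> link_diagram D \<and> link_diagram D' \<and>
     (diagram_iso D D' \<or> add_mark D D' \<or>
      reidemeister1 D D' \<or> reidemeister2 D D' \<or> reidemeister3 D D')"

definition isotopic :: "diagram \<Rightarrow> diagram \<Rightarrow> bool" where
  "isotopic D D' \<longleftrightarrow> link_diagram D \<and> link_diagram D' \<and> (\<lambda>A B. move A B \<or> move B A)\<^sup>*\<^sup>* D D'"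

definition unknot_diagram :: diagram where
  "unknot_diagram = Diagram {Mark 0} id (\<lambda>_. 1)"

lemma link_diagram_unknot: "link_diagram unknot_diagram"
proof -
  let ?D = unknot_diagram
  have cr: "crossings ?D = {}" by (simp add: unknot_diagram_def crossings_def)
  have pts: "points ?D = {Mark 0}" by (simp add: unknot_diagram_def)
  have nx: "nxt ?D = id" by (simp add: unknot_diagram_def)
  have pv: "prv ?D (Mark 0) = Mark 0"
    unfolding prv_def pts nx by (rule inv_into_f_eq) auto
  let ?f = "\<lambda>h. rotate ?D (other_end ?D h)"
  have f: "?f (Out (Mark 0)) = Out (Mark 0)" "?f (In (Mark 0)) = In (Mark 0)"
    by (simp_all add: nx pv)
  have orb: "orbit ?f x = {x}" if "?f x = x" for x
  proof -
    have "y = x" if "y \<in> orbit ?f x" for y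
      using that by (induction) (simp_all add: \<open>?f x = x\<close>)
    moreover have "x \<in> orbit ?f x" by (metis orbit.base that)
    ultimately show ?thesis by blast
  qed
  have "faces ?D = {{Out (Mark 0)}, {In (Mark 0)}}"
    unfolding faces_def half_edges_def pts by (simp add: orb[OF f(1)] orb[OF f(2)] insert_commute)
  then have "card (faces ?D) = 2" by simp
  moreover have "card (graph_pieces ?D) = 1" by (simp add: graph_pieces_def pts)
  ultimately have "planar ?D" by (simp add: planar_def cr pts)
  moreover have "gauss_data ?D"
    unfolding gauss_data_def cr pts nx by (auto simp: bij_betw_def)
  ultimately show ?thesis by (simp add: link_diagram_def)
qed

lemma part_equivp_isotopic: "part_equivp isotopic"
proof (rule part_equivpI)
  show "\<exists>D. isotopic D D"
    using link_diagram_unknot by (auto simp: isotopic_def)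
  have "symp (\<lambda>A B. move A B \<or> move B A)" by (auto simp: symp_def)
  then have "symp (\<lambda>A B. move A B \<or> move B A)\<^sup>*\<^sup>*" by (rule symp_rtranclp)
  then show "symp isotopic" by (auto simp: symp_def isotopic_def)
  show "transp isotopic" by (auto simp: transp_def isotopic_def)
qed

quotient_type link = diagram / partial: isotopic
  by (rule part_equivp_isotopic)

definition diagram_of :: "diagram \<Rightarrow> link \<Rightarrow> bool" where
  "diagram_of D L \<longleftrightarrow> link_diagram D \<and> abs_link D = L"

definition is_knot :: "link \<Rightarrow> bool" where
  "is_knot L \<longleftrightarrow> (\<exists>D. diagram_of D L \<and> card (components D) = 1)"

definition alternating :: "link \<Rightarrow> bool" where
  "alternating L \<longleftrightarrow> (\<exists>D. diagram_of D L \<and> alternating_diagram D)"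

definition positive_link :: "link \<Rightarrow> bool" where
  "positive_link L \<longleftrightarrow> (\<exists>D. diagram_of D L \<and> positive_diagram D)"

definition negative_link :: "link \<Rightarrow> bool" where
  "negative_link L \<longleftrightarrow> (\<exists>D. diagram_of D L \<and> negative_diagram D)"

text \<open>
  The determinant of a knot, as a relation: a value computed from some diagram.  It is the same for
  all diagrams and all choices of the Alexander polynomial, as these only differ by units
  \<open>\<plusminus> t\<^sup>k\<close>.
\<close>

definition has_determinant :: "link \<Rightarrow> nat \<Rightarrow> bool" where
  "has_determinant K n \<longleftrightarrow>
     (\<exists>D \<Delta>. diagram_of D K \<and> alexander_polynomial D \<Delta> \<and> n = nat \<bar>poly \<Delta> (-1)\<bar>)"

text \<open>
  Two disjoint diagrams are cut open at the edges \<open>p\<close> and \<open>q\<close> and joined according to the orientations.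
  On the sphere every edge can be made adjacent to the outer face, so any two edges may be used.
\<close>

definition diagram_sum :: "diagram \<Rightarrow> point \<Rightarrow> diagram \<Rightarrow> point \<Rightarrow> diagram" where
  "diagram_sum D p E q = Diagram (points D \<union> points E)
     (\<lambda>v. if v = p then nxt E q else if v = q then nxt D p
          else if v \<in> points D then nxt D v else nxt E v)
     (\<lambda>c. if c \<in> crossings D then csign D c else csign E c)"

text \<open>
  \<open>connected_sum K L M\<close>: the link \<open>M\<close> is a connected sum of the knot \<open>K\<close> with the link \<open>L\<close>, along
  the component of \<open>L\<close> that contains the edge \<open>q\<close>.
\<close>

definition connected_sum :: "link \<Rightarrow> link \<Rightarrow> link \<Rightarrow> bool" where
  "connected_sum K L M \<longleftrightarrow> is_knot K \<and>
     (\<exists>D E p q. diagram_of D K \<and> diagram_of E L \<and> points D \<inter> points E = {} \<and>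
        p \<in> points D \<and> q \<in> points E \<and> diagram_of (diagram_sum D p E q) M)"

end

theory Submission
  imports Defs
begin

text \<open>
  In a bi-ordered quandle, \<open>x * y\<close> lies strictly between \<open>x\<close> and \<open>y\<close> unless \<open>x = y\<close>.  Hence, if all
  crossings of a knot diagram are positive, an edge that leaves a crossing with the largest colour
  also enters it with that colour, and every colouring of the knot by a bi-ordered quandle is
  constant.  On the other hand, a prime \<open>p\<close> dividing the determinant yields a nonconstant colouring
  by the dihedral quandle of order \<open>p\<close>.  It factors through the universal colouring by the link
  quandle, which thus cannot be bi-ordered.

  In a connected sum, the dihedral colouring extends by a constant to the other summand.  A colouring
  of the sum restricts to one of the knot cut open at an edge.  Since the diagram lies on the
  sphere, the two colours at the cut act alike from the right, hence they agree in a bi-ordered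
  quandle, and the restriction is an honest colouring of the knot, which is constant.
\<close>


section \<open>Quandles\<close>

text \<open>The diagrams that witness positivity, the determinant and the connected sum, and the
  diagram whose quandle is considered, are in general all different. Colourings therefore have to be
  carried along Reidemeister moves, and for two quandles at once: a dihedral colouring and its
  factorization through the link quandle must arrive together on the diagram where constancy is
  applied.

  Planarity is available only as a count of faces. Both places where the sphere matters, the
  redundancy of one row of the Alexander matrix and the closing of a cut colouring, are reduced to
  one statement about permutations attached to the edges: if their product is trivial around every
  vertex but one, it is trivial around the last one as well. Topologically, face labels have no
  monodromy on a simply connected surface; here complementary spanning trees of the graph and its
  dual take the place of simple connectedness. For the matrix the permutations are reflections of
  the integers modulo \<open>2 * p\<close>, for the cut they are right translations of the
  quandle.\<close>

context
  fixes X :: "('a, 'm) magma_scheme"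
  assumes X: "is_quandle X"
begin

lemma qop_closed: "x \<in> qcarrier X \<Longrightarrow> y \<in> qcarrier X \<Longrightarrow> qop X x y \<in> qcarrier X"
  using X by (simp add: is_quandle_def)

lemma qop_idem: "x \<in> qcarrier X \<Longrightarrow> qop X x x = x"
  using X by (simp add: is_quandle_def)

lemma qop_dist: "x \<in> qcarrier X \<Longrightarrow> y \<in> qcarrier X \<Longrightarrow> z \<in> qcarrier X \<Longrightarrow>
    qop X (qop X x y) z = qop X (qop X x z) (qop X y z)"
  using X unfolding is_quandle_def by blast

lemma qop_ex: "x \<in> qcarrier X \<Longrightarrow> y \<in> qcarrier X \<Longrightarrow> \<exists>z\<in>qcarrier X. x = qop X z y"
proof -
  assume xy: "x \<in> qcarrier X" "y \<in> qcarrier X"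
  have "\<forall>x\<in>qcarrier X. \<forall>y\<in>qcarrier X. \<exists>!z. z \<in> qcarrier X \<and> x = qop X z y"
    using X unfolding is_quandle_def by (elim conjE)
  from this[rule_format, OF xy] show ?thesis by blast
qed

lemma qop_cancel: "x \<in> qcarrier X \<Longrightarrow> x' \<in> qcarrier X \<Longrightarrow> y \<in> qcarrier X \<Longrightarrow>
    qop X x y = qop X x' y \<longleftrightarrow> x = x'"
  using X unfolding is_quandle_def by (metis (full_types))

end

definition hom :: "('a, 'm) magma_scheme \<Rightarrow> ('b, 'n) magma_scheme \<Rightarrow> ('a \<Rightarrow> 'b) \<Rightarrow> bool" where
  "hom Y X \<phi> \<longleftrightarrow> (\<forall>x\<in>qcarrier Y. \<phi> x \<in> qcarrier X) \<and>
     (\<forall>x\<in>qcarrier Y. \<forall>y\<in>qcarrier Y. \<phi> (qop Y x y) = qop X (\<phi> x) (\<phi> y))"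


section \<open>Colourings\<close>

text \<open>\<open>d\<close> is the colour of the outgoing under strand, \<open>a\<close> that of the incoming one, \<open>b\<close> lies over.\<close>

definition under_rule :: "('a, 'm) magma_scheme \<Rightarrow> int \<Rightarrow> 'a \<Rightarrow> 'a \<Rightarrow> 'a \<Rightarrow> bool" where
  "under_rule X s a b d \<longleftrightarrow> (if s = 1 then d = qop X a b else a = qop X d b)"

text \<open>The colour \<open>a\<close> with which \<open>w\<close> is reached is an argument of its
  own, so that the condition at \<open>w\<close> can also be stated for an edge that comes from
  elsewhere, such as the cut of a connected sum or a newly inserted passage.\<close>

definition passes ::
    "('a, 'm) magma_scheme \<Rightarrow> diagram \<Rightarrow> (point \<Rightarrow> 'a) \<Rightarrow> 'a \<Rightarrow> point \<Rightarrow> bool" where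
  "passes X D f a w \<longleftrightarrow> (case w of Under c \<Rightarrow> under_rule X (csign D c) a (f (Over c)) (f w) | _ \<Rightarrow> f w = a)"

definition coloring :: "('a, 'm) magma_scheme \<Rightarrow> diagram \<Rightarrow> (point \<Rightarrow> 'a) \<Rightarrow> bool" where
  "coloring X D f \<longleftrightarrow> (\<forall>v\<in>points D. f v \<in> qcarrier X \<and> passes X D f (f v) (nxt D v))"

lemma passes_simps [simp]:
  "passes X D f a (Under c) = under_rule X (csign D c) a (f (Over c)) (f (Under c))"
  "passes X D f a (Over c) \<longleftrightarrow> f (Over c) = a"
  "passes X D f a (Mark m) \<longleftrightarrow> f (Mark m) = a"
  by (simp_all add: passes_def)

text \<open>Negative crossings are also expressed through \<open>qop\<close>, so it is enough that a
  homomorphism respects this one operation.\<close>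

lemma under_rule_hom:
  assumes "hom Y X \<phi>" "a \<in> qcarrier Y" "b \<in> qcarrier Y" "d \<in> qcarrier Y" "under_rule Y s a b d"
  shows "under_rule X s (\<phi> a) (\<phi> b) (\<phi> d)"
  using assms by (auto simp: under_rule_def hom_def)

lemma under_rule_refl: "is_quandle X \<Longrightarrow> a \<in> qcarrier X \<Longrightarrow> under_rule X s a a a"
  by (simp add: under_rule_def qop_idem)

lemma under_rule_ex:
  assumes "is_quandle X" "a \<in> qcarrier X" "b \<in> qcarrier X"
  obtains d where "d \<in> qcarrier X" "under_rule X s a b d"
proof (cases "s = 1")
  case True
  then show thesis using that[of "qop X a b"] qop_closed[OF assms] by (simp add: under_rule_def)
next
  case False
  obtain d where "d \<in> qcarrier X" "a = qop X d b" using qop_ex[OF assms] by blast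
  then show thesis using that[of d] False by (auto simp: under_rule_def)
qed

lemma under_rule_sym: "s \<in> {1, -1} \<Longrightarrow> under_rule X (- s) a b d \<longleftrightarrow> under_rule X s d b a"
  by (auto simp: under_rule_def)

lemma under_rule_unique_in:
  assumes "is_quandle X" "a \<in> qcarrier X" "a' \<in> qcarrier X" "b \<in> qcarrier X" "d \<in> qcarrier X"
    "under_rule X s a b d" "under_rule X s a' b d"
  shows "a = a'"
  using assms qop_cancel[OF assms(1)] by (auto simp: under_rule_def split: if_splits)

lemma under_rule_unique_out:
  assumes "is_quandle X" "d \<in> qcarrier X" "d' \<in> qcarrier X" "b \<in> qcarrier X" "a \<in> qcarrier X"
    "under_rule X s a b d" "under_rule X s a b d'"
  shows "d = d'"
  using assms qop_cancel[OF assms(1)] by (auto simp: under_rule_def split: if_splits)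

lemma gauss_dataD:
  assumes "gauss_data D"
  shows "finite (points D)" "points D \<noteq> {}" "bij_betw (nxt D) (points D) (points D)"
    "v \<in> points D \<Longrightarrow> nxt D v \<in> points D"
    "v \<in> points D \<Longrightarrow> w \<in> points D \<Longrightarrow> nxt D v = nxt D w \<longleftrightarrow> v = w"
    "Under c \<in> points D \<longleftrightarrow> c \<in> crossings D" "Over c \<in> points D \<longleftrightarrow> c \<in> crossings D"
    "c \<in> crossings D \<Longrightarrow> csign D c = 1 \<or> csign D c = -1"
  using assms unfolding gauss_data_def crossings_def bij_betw_def inj_on_def by auto

lemma nxt_surj:
  assumes "gauss_data D" "w \<in> points D"
  obtains v where "v \<in> points D" "nxt D v = w"
  using gauss_dataD(3)[OF assms(1)] assms(2) unfolding bij_betw_def by (metis imageE)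

lemma passes_over_in:
  assumes "gauss_data D" "w \<in> points D" "w = Under c"
  shows "Over c \<in> points D"
  using assms gauss_dataD(6,7) by auto

lemma passes_cong:
  assumes "a = a'" "f w = f' w" "\<And>c. w = Under c \<Longrightarrow> csign D c = csign D' c \<and> f (Over c) = f' (Over c)"
  shows "passes X D f a w = passes X D' f' a' w"
  using assms by (cases w) auto

lemma coloring_cong:
  assumes D: "gauss_data D" and eq: "\<And>v. v \<in> points D \<Longrightarrow> f v = f' v"
  shows "coloring X D f = coloring X D f'"
proof -
  have "passes X D f (f v) (nxt D v) = passes X D f' (f' v) (nxt D v)" if v: "v \<in> points D" for v
  proof (rule passes_cong)
    have w: "nxt D v \<in> points D" using gauss_dataD(4)[OF D v] .
    show "f (nxt D v) = f' (nxt D v)" using eq w by blast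
    show "csign D c = csign D c \<and> f (Over c) = f' (Over c)" if "nxt D v = Under c" for c
      using eq passes_over_in[OF D w that] by blast
  qed (use eq v in blast)
  then show ?thesis unfolding coloring_def by (intro ball_cong) (simp_all add: eq)
qed

lemma coloring_hom:
  assumes "gauss_data D" "coloring Y D c" "hom Y X \<phi>"
  shows "coloring X D (\<lambda>v. \<phi> (c v))"
  unfolding coloring_def
proof (intro ballI conjI)
  fix v assume v: "v \<in> points D"
  then show "\<phi> (c v) \<in> qcarrier X" using assms by (auto simp: coloring_def hom_def)
  have w: "nxt D v \<in> points D" using gauss_dataD(4)[OF assms(1)] v by blast
  have p: "passes Y D c (c v) (nxt D v)" using assms(2) v by (simp add: coloring_def)
  have car: "c u \<in> qcarrier Y" if "u \<in> points D" for u using assms(2) that by (simp add: coloring_def)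
  show "passes X D (\<lambda>v. \<phi> (c v)) (\<phi> (c v)) (nxt D v)"
  proof (cases "nxt D v")
    case (Under k)
    then show ?thesis using p under_rule_hom[OF assms(3)] car v w passes_over_in[OF assms(1) w Under]
      by auto
  qed (use p in auto)
qed


section \<open>Transport of colourings\<close>

text \<open>
  Colourings of \<open>B\<close> correspond to colourings of \<open>A\<close>, naturally in the quandle.  This form of
  naturality implies that diagrams of the same link agree on whether all colourings are constant
  (take \<open>Y = X\<close> and a constant \<open>\<phi>\<close>), and that factorizations through the universal colouring
  carry over from \<open>A\<close> to \<open>B\<close>.
\<close>

definition lifts ::
    "('a, 'm) magma_scheme \<Rightarrow> ('b, 'n) magma_scheme \<Rightarrow> diagram \<Rightarrow> diagram \<Rightarrow> bool" where
  "lifts X Y A B \<longleftrightarrow> (\<forall>f. coloring X B f \<longrightarrow> (\<exists>f'. coloring X A f' \<and>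
     (\<forall>\<phi> c'. hom Y X \<phi> \<longrightarrow> coloring Y A c' \<longrightarrow> (\<forall>v\<in>points A. \<phi> (c' v) = f' v) \<longrightarrow>
        (\<exists>c. coloring Y B c \<and> (\<forall>v\<in>points B. \<phi> (c v) = f v)))))"

lemma lifts_refl: "lifts X Y A A"
  unfolding lifts_def by blast

lemma lifts_trans:
  assumes AB: "lifts X Y A B" and BC: "lifts X Y B C"
  shows "lifts X Y A C"
  unfolding lifts_def
proof (intro allI impI)
  fix f assume "coloring X C f"
  then obtain g where g: "coloring X B g" "\<And>\<phi> c'. hom Y X \<phi> \<Longrightarrow> coloring Y B c' \<Longrightarrow>
      (\<forall>v\<in>points B. \<phi> (c' v) = g v) \<Longrightarrow> \<exists>c. coloring Y C c \<and> (\<forall>v\<in>points C. \<phi> (c v) = f v)"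
    using BC unfolding lifts_def by blast
  obtain h where h: "coloring X A h" "\<And>\<phi> c'. hom Y X \<phi> \<Longrightarrow> coloring Y A c' \<Longrightarrow>
      (\<forall>v\<in>points A. \<phi> (c' v) = h v) \<Longrightarrow> \<exists>c. coloring Y B c \<and> (\<forall>v\<in>points B. \<phi> (c v) = g v)"
    using AB g(1) unfolding lifts_def by blast
  show "\<exists>f'. coloring X A f' \<and> (\<forall>\<phi> c'. hom Y X \<phi> \<longrightarrow> coloring Y A c' \<longrightarrow>
      (\<forall>v\<in>points A. \<phi> (c' v) = f' v) \<longrightarrow> (\<exists>c. coloring Y C c \<and> (\<forall>v\<in>points C. \<phi> (c v) = f v)))"
    using g h by blast
qed

text \<open>\<open>P\<close> is a set of edges of \<open>A\<close> that persist as edges \<open>h ` P\<close> of \<open>B\<close> and determine the colours of all others.\<close>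

lemma liftsI:
  fixes X :: "('a, 'm) magma_scheme" and Y :: "('b, 'n) magma_scheme"
  assumes B: "gauss_data B" and P: "P \<subseteq> points A"
    and down: "\<And>f. coloring X B f \<Longrightarrow> \<exists>f'. coloring X A f' \<and> (\<forall>v\<in>P. f' v = f (h v))"
    and up: "\<And>f. coloring Y A f \<Longrightarrow> \<exists>f'. coloring Y B f' \<and> (\<forall>v\<in>P. f' (h v) = f v)"
    and det: "\<And>f f'. coloring X B f \<Longrightarrow> coloring X B f' \<Longrightarrow> \<forall>v\<in>P. f (h v) = f' (h v) \<Longrightarrow>
      \<forall>v\<in>points B. f v = f' v"
  shows "lifts X Y A B"
  unfolding lifts_def
proof (intro allI impI)
  fix f assume f: "coloring X B f"
  then obtain f' where f': "coloring X A f'" "\<forall>v\<in>P. f' v = f (h v)" using down by blast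
  have "\<exists>c. coloring Y B c \<and> (\<forall>v\<in>points B. \<phi> (c v) = f v)"
    if \<phi>: "hom Y X \<phi>" and c': "coloring Y A c'" "\<forall>v\<in>points A. \<phi> (c' v) = f' v" for \<phi> c'
  proof -
    obtain c where c: "coloring Y B c" "\<forall>v\<in>P. c (h v) = c' v" using up[OF c'(1)] by blast
    have "\<forall>v\<in>points B. \<phi> (c v) = f v"
      by (rule det[OF coloring_hom[OF B c(1) \<phi>] f]) (use c f' c' P in auto)
    then show ?thesis using c by blast
  qed
  then show "\<exists>f'. coloring X A f' \<and> (\<forall>\<phi> c'. hom Y X \<phi> \<longrightarrow> coloring Y A c' \<longrightarrow>
      (\<forall>v\<in>points A. \<phi> (c' v) = f' v) \<longrightarrow> (\<exists>c. coloring Y B c \<and> (\<forall>v\<in>points B. \<phi> (c v) = f v)))"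
    using f' by blast
qed

lemma coloring_diagram_iso:
  assumes h: "bij_betw h (points D) (points D')" "\<forall>v\<in>points D. h (nxt D v) = nxt D' (h v)"
    "\<forall>c\<in>crossings D. h (Over c) = Over (g c) \<and> h (Under c) = Under (g c) \<and> csign D' (g c) = csign D c"
    "\<forall>m. Mark m \<in> points D \<longrightarrow> (\<exists>m'. h (Mark m) = Mark m')"
    and D: "gauss_data D"
  shows "coloring X D' f \<longleftrightarrow> coloring X D (f \<circ> h)"
proof -
  have "passes X D (f \<circ> h) (f (h v)) (nxt D v) \<longleftrightarrow> passes X D' f (f (h v)) (nxt D' (h v))"
    if v: "v \<in> points D" for v
  proof -
    have w: "nxt D v \<in> points D" using gauss_dataD(4)[OF D v] .
    have n: "nxt D' (h v) = h (nxt D v)" using h(2) v by simp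
    show ?thesis
    proof (cases "nxt D v")
      case (Over c)
      then show ?thesis using h(3) w gauss_dataD[OF D] unfolding n by auto
    next
      case (Under c)
      then show ?thesis using h(3) w gauss_dataD[OF D] unfolding n by auto
    next
      case (Mark m)
      then show ?thesis using h(4) w unfolding n by (metis comp_apply passes_simps(3))
    qed
  qed
  moreover have "points D' = h ` points D" using h(1) by (auto simp: bij_betw_def)
  ultimately show ?thesis unfolding coloring_def by auto
qed

lemma coloring_push_iso:
  assumes h: "bij_betw h (points D) (points D')" "\<forall>v\<in>points D. h (nxt D v) = nxt D' (h v)"
    "\<forall>c\<in>crossings D. h (Over c) = Over (g c) \<and> h (Under c) = Under (g c) \<and> csign D' (g c) = csign D c"
    "\<forall>m. Mark m \<in> points D \<longrightarrow> (\<exists>m'. h (Mark m) = Mark m')"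
    and D: "gauss_data D" and f: "coloring X D f"
  shows "\<exists>f'. coloring X D' f' \<and> (\<forall>v\<in>points D. f' (h v) = f v)"
proof (intro exI[of _ "f \<circ> inv_into (points D) h"] conjI)
  have kh: "inv_into (points D) h (h v) = v" if "v \<in> points D" for v
    using h(1) that unfolding bij_betw_def by auto
  show "coloring X D' (f \<circ> inv_into (points D) h)"
    unfolding coloring_diagram_iso[OF h D]
    by (rule coloring_cong[OF D, THEN iffD2, OF _ f]) (simp add: kh)
  show "\<forall>v\<in>points D. (f \<circ> inv_into (points D) h) (h v) = f v" by (simp add: kh)
qed

lemma lifts_diagram_iso:
  assumes iso: "diagram_iso D D'" and D: "gauss_data D" "gauss_data D'"
  shows "lifts X Y D D'" "lifts X Y D' D"
proof -
  obtain h g where h: "bij_betw h (points D) (points D')" "\<forall>v\<in>points D. h (nxt D v) = nxt D' (h v)"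
    "\<forall>c\<in>crossings D. h (Over c) = Over (g c) \<and> h (Under c) = Under (g c) \<and> csign D' (g c) = csign D c"
    "\<forall>m. Mark m \<in> points D \<longrightarrow> (\<exists>m'. h (Mark m) = Mark m')"
    using iso unfolding diagram_iso_def by blast
  note iff = coloring_diagram_iso[OF h D(1)] and up = coloring_push_iso[OF h D(1)]
  define k where "k = inv_into (points D) h"
  have kh: "k (h v) = v" if "v \<in> points D" for v
    using h(1) that unfolding k_def bij_betw_def by auto
  have im: "points D' = h ` points D" using h(1) by (auto simp: bij_betw_def)
  show "lifts X Y D D'"
  proof (rule liftsI[where P = "points D" and h = h])
    show "\<exists>f'. coloring X D f' \<and> (\<forall>v\<in>points D. f' v = f (h v))" if "coloring X D' f" for f
      using that unfolding iff by (intro exI[of _ "f \<circ> h"]) auto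
    show "\<exists>f'. coloring Y D' f' \<and> (\<forall>v\<in>points D. f' (h v) = f v)" if "coloring Y D f" for f
      by (rule up[OF that])
  qed (use D im in auto)
  show "lifts X Y D' D"
  proof (rule liftsI[where P = "points D'" and h = k])
    show "\<exists>f'. coloring X D' f' \<and> (\<forall>v\<in>points D'. f' v = f (k v))" if "coloring X D f" for f
      using up[OF that] unfolding im by (auto simp: kh)
    show "\<exists>f'. coloring Y D f' \<and> (\<forall>v\<in>points D'. f' (k v) = f v)" if "coloring Y D' f" for f
      using that unfolding iff im by (intro exI[of _ "f \<circ> h"]) (auto simp: kh)
  qed (use D im in \<open>auto simp: kh\<close>)
qed

text \<open>Restriction to the points of \<open>A\<close> is a bijection between colourings. This
  suits the moves that only insert points, and yields liftings in both directions.\<close>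

definition extends :: "('a, 'm) magma_scheme \<Rightarrow> diagram \<Rightarrow> diagram \<Rightarrow> bool" where
  "extends X A B \<longleftrightarrow> points A \<subseteq> points B \<and> (\<forall>f. coloring X B f \<longrightarrow> coloring X A f) \<and>
     (\<forall>f. coloring X A f \<longrightarrow> (\<exists>f'. coloring X B f' \<and> (\<forall>v\<in>points A. f' v = f v))) \<and>
     (\<forall>f f'. coloring X B f \<longrightarrow> coloring X B f' \<longrightarrow> (\<forall>v\<in>points A. f v = f' v) \<longrightarrow> (\<forall>v\<in>points B. f v = f' v))"

lemma lifts_extends:
  assumes "extends X A B" "extends Y A B" and AB: "gauss_data A" "gauss_data B"
  shows "lifts X Y A B" "lifts X Y B A"
proof -
  show "lifts X Y A B"
    by (rule liftsI[where P = "points A" and h = id])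
      (use assms in \<open>auto simp: extends_def\<close>)
  show "lifts X Y B A"
  proof (rule liftsI[where P = "points A" and h = id])
    show "\<exists>f'. coloring X B f' \<and> (\<forall>v\<in>points A. f' v = f (id v))" if "coloring X A f" for f
      using assms(1) that by (auto simp: extends_def)
    show "\<exists>f'. coloring Y A f' \<and> (\<forall>v\<in>points A. f' (id v) = f v)" if "coloring Y B f" for f
      using assms(2) that by (auto simp: extends_def)
  qed (use assms in \<open>auto simp: extends_def\<close>)
qed


section \<open>Reidemeister moves\<close>

lemma passes_agree:
  assumes "gauss_data A" "w \<in> points A" "\<And>v. v \<in> points A \<Longrightarrow> f' v = f v"
    "\<And>c. c \<in> crossings A \<Longrightarrow> csign B c = csign A c"
  shows "passes X B f' a w = passes X A f a w"
  using assms gauss_dataD(6,7)[OF assms(1)] by (intro passes_cong) auto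

lemma coloring_split:
  assumes "S \<subseteq> points D"
  shows "coloring X D f \<longleftrightarrow>
    (\<forall>v\<in>points D - S. f v \<in> qcarrier X \<and> passes X D f (f v) (nxt D v)) \<and>
    (\<forall>v\<in>S. f v \<in> qcarrier X \<and> passes X D f (f v) (nxt D v))"
  using assms unfolding coloring_def by blast

text \<open>\<open>N\<close> collects the conditions that a move imposes on the inserted points.
  Extending a colouring then means solving \<open>N\<close>, and uniqueness means that
  \<open>N\<close> determines the new colours.\<close>

lemma extendsI:
  assumes "points A \<subseteq> points B"
    and iff: "\<And>f. coloring X B f \<longleftrightarrow> coloring X A f \<and> N f"
    and A: "gauss_data A"
    and ex: "\<And>f. coloring X A f \<Longrightarrow> \<exists>f'. (\<forall>v\<in>points A. f' v = f v) \<and> N f'"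
    and det: "\<And>f f'. coloring X A f \<Longrightarrow> \<forall>v\<in>points A. f v = f' v \<Longrightarrow> N f \<Longrightarrow> N f' \<Longrightarrow>
      \<forall>v\<in>points B. f v = f' v"
  shows "extends X A B"
  unfolding extends_def
proof (intro conjI allI impI)
  show "\<exists>f'. coloring X B f' \<and> (\<forall>v\<in>points A. f' v = f v)" if f: "coloring X A f" for f
  proof -
    obtain f' where f': "\<forall>v\<in>points A. f' v = f v" "N f'" using ex[OF f] by blast
    then have "coloring X A f'" using f coloring_cong[OF A, of f' f] by blast
    then show ?thesis using f' iff by blast
  qed
qed (use assms in blast)+

section \<open>Marks and the first two Reidemeister moves\<close>

lemma extends_add_mark:
  assumes X: "is_quandle X" and AB: "add_mark A B" and A: "gauss_data A"
  shows "extends X A B"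
proof -
  obtain p m where p: "p \<in> points A" and m: "Mark m \<notin> points A"
    and B: "B = Diagram (insert (Mark m) (points A))
            ((nxt A)(p := Mark m, Mark m := nxt A p)) (csign A)"
    using AB unfolding add_mark_def by blast
  have pm: "p \<noteq> Mark m" using p m by blast
  have np: "nxt A v \<in> points A" if "v \<in> points A" for v using gauss_dataD(4)[OF A that] .
  have pass: "passes X B f a w = passes X A f a w" if "w \<in> points A" for f a w
    by (rule passes_agree[OF A that]) (auto simp: B)
  have nx: "nxt B v = nxt A v" if "v \<in> points A - {p}" for v
    using that m by (auto simp: B)
  show ?thesis
  proof (rule extendsI[where N = "\<lambda>f. f (Mark m) = f p"])
    fix f
    have d: "points B - {p, Mark m} = points A - {p}" using m by (auto simp: B)
    have "coloring X B f \<longleftrightarrow>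
      (\<forall>v\<in>points A - {p}. f v \<in> qcarrier X \<and> passes X B f (f v) (nxt B v)) \<and>
      (\<forall>v\<in>{p, Mark m}. f v \<in> qcarrier X \<and> passes X B f (f v) (nxt B v))"
      using coloring_split[of "{p, Mark m}" B X f] p unfolding d by (auto simp: B)
    also have "\<dots> \<longleftrightarrow> coloring X A f \<and> f (Mark m) = f p"
      using coloring_split[of "{p}" A X f] p pm np pass nx by (auto simp: B)
    finally show "coloring X B f \<longleftrightarrow> coloring X A f \<and> f (Mark m) = f p" .
  next
    fix f
    show "\<exists>f'. (\<forall>v\<in>points A. f' v = f v) \<and> f' (Mark m) = f' p"
      using m pm by (intro exI[of _ "f(Mark m := f p)"]) auto
  qed (use A p in \<open>auto simp: B\<close>)
qed

text \<open>A kink crosses a strand with itself, so idempotence applies. If the over passage comes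
  first, the over strand has the incoming colour and the outgoing one is forced; if it comes second,
  it has the outgoing colour and cancellation forces the incoming one.\<close>

lemma extends_reidemeister1:
  assumes X: "is_quandle X" and AB: "reidemeister1 A B" and A: "gauss_data A"
  shows "extends X A B"
proof -
  obtain p c u v s where p: "p \<in> points A" and c: "c \<notin> crossings A"
    and uv: "(u, v) = (Over c, Under c) \<or> (u, v) = (Under c, Over c)"
    and B: "B = Diagram (points A \<union> {u, v})
            ((nxt A)(p := u, u := v, v := nxt A p)) ((csign A)(c := s))"
    using AB unfolding reidemeister1_def by blast
  have new: "u \<notin> points A" "v \<notin> points A" "u \<noteq> v" using uv c gauss_dataD(6,7)[OF A] by auto
  then have ne: "p \<noteq> u" "p \<noteq> v" using p by auto
  have np: "nxt A v \<in> points A" if "v \<in> points A" for v using gauss_dataD(4)[OF A that] .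
  have pass: "passes X B f a w = passes X A f a w" if "w \<in> points A" for f a w
    by (rule passes_agree[OF A that]) (use c in \<open>auto simp: B\<close>)
  have nx: "nxt B w = nxt A w" if "w \<in> points A - {p}" for w
    using that new by (auto simp: B)
  have nx': "nxt B p = u" "nxt B u = v" "nxt B v = nxt A p" using ne new by (auto simp: B)
  have sc: "csign B c = s" by (simp add: B)
  let ?N = "\<lambda>f. f u = f p \<and> f v = f p"
  show ?thesis
  proof (rule extendsI[where N = ?N])
    fix f
    have kink: "passes X B f (f p) u \<and> passes X B f (f u) v \<longleftrightarrow> ?N f"
      if car: "f p \<in> qcarrier X" "f u \<in> qcarrier X" "f v \<in> qcarrier X"
    proof -
      have r: "under_rule X s a a a" if "a \<in> qcarrier X" for a using X that by (rule under_rule_refl)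
      from uv show ?thesis
      proof
        assume "(u, v) = (Over c, Under c)"
        then show ?thesis using car r under_rule_unique_out[OF X car(3) car(1) car(1) car(1)] sc by auto
      next
        assume "(u, v) = (Under c, Over c)"
        then show ?thesis using car r[OF car(2)] under_rule_unique_in[OF X car(1) car(2) car(2) car(2), of s] sc by auto
      qed
    qed
    have d: "points B - {p, u, v} = points A - {p}" using new by (auto simp: B)
    have "coloring X B f \<longleftrightarrow>
      (\<forall>w\<in>points A - {p}. f w \<in> qcarrier X \<and> passes X B f (f w) (nxt B w)) \<and>
      (\<forall>w\<in>{p, u, v}. f w \<in> qcarrier X \<and> passes X B f (f w) (nxt B w))"
      using coloring_split[of "{p, u, v}" B X f] p unfolding d by (auto simp: B)
    also have "\<dots> \<longleftrightarrow> (\<forall>w\<in>points A - {p}. f w \<in> qcarrier X \<and> passes X A f (f w) (nxt A w)) \<and>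
      f p \<in> qcarrier X \<and> passes X A f (f p) (nxt A p) \<and> ?N f"
      using kink np[OF p] np by (auto simp: nx nx' pass)
    also have "\<dots> \<longleftrightarrow> coloring X A f \<and> ?N f"
      using coloring_split[of "{p}" A X f] p by auto
    finally show "coloring X B f \<longleftrightarrow> coloring X A f \<and> ?N f" .
  next
    fix f
    show "\<exists>f'. (\<forall>v\<in>points A. f' v = f v) \<and> ?N f'"
      using new ne by (intro exI[of _ "f(u := f p, v := f p)"]) auto
  qed (use A p in \<open>auto simp: B\<close>)
qed

text \<open>The lower strand passes twice under the colour \<open>f p\<close> with opposite signs,
  so the second passage undoes the first. The only new colour is that of the lower side of the
  2-gon, and it is determined.\<close>

lemma extends_reidemeister2:
  assumes X: "is_quandle X" and AB: "reidemeister2 A B" and A: "gauss_data A"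
  shows "extends X A B"
proof -
  obtain p q c d u v s where p: "p \<in> points A" and q: "q \<in> points A" and pq: "p \<noteq> q"
    and cd: "c \<notin> crossings A" "d \<notin> crossings A" "c \<noteq> d" and s: "s \<in> {1, -1}"
    and uv: "(u, v) = (Under c, Under d) \<or> (u, v) = (Under d, Under c)"
    and B: "B = Diagram (points A \<union> {Over c, Over d, Under c, Under d})
            ((nxt A)(p := Over c, Over c := Over d, Over d := nxt A p,
                     q := u, u := v, v := nxt A q))
            ((csign A)(c := s, d := - s))"
    using AB unfolding reidemeister2_def by blast
  have new: "Over c \<notin> points A" "Over d \<notin> points A" "Under c \<notin> points A" "Under d \<notin> points A"
    using cd gauss_dataD(6,7)[OF A] by auto
  have uvnew: "u \<notin> points A" "v \<notin> points A" "u \<noteq> v" "u \<noteq> Over c" "u \<noteq> Over d" "v \<noteq> Over c" "v \<noteq> Over d"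
    using uv new cd by auto
  have ptsB: "points B = points A \<union> {Over c, Over d, u, v}" using uv by (auto simp: B)
  have ne: "p \<noteq> Over c" "p \<noteq> Over d" "p \<noteq> u" "p \<noteq> v" "q \<noteq> Over c" "q \<noteq> Over d" "q \<noteq> u" "q \<noteq> v"
    using p q new uvnew by auto
  have np: "nxt A v \<in> points A" if "v \<in> points A" for v using gauss_dataD(4)[OF A that] .
  have pass: "passes X B f a w = passes X A f a w" if "w \<in> points A" for f a w
    by (rule passes_agree[OF A that]) (use cd in \<open>auto simp: B\<close>)
  have nx: "nxt B w = nxt A w" if "w \<in> points A - {p, q}" for w
    using that new uvnew by (auto simp: B)
  have nx': "nxt B p = Over c" "nxt B (Over c) = Over d" "nxt B (Over d) = nxt A p"
    "nxt B q = u" "nxt B u = v" "nxt B v = nxt A q"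
    using ne new uvnew pq cd by (auto simp: B)
  \<comment> \<open>The sign of the crossing that the lower strand meets first.\<close>
  define t where "t = (if u = Under c then s else - s)"
  have sc: "csign B c = s" "csign B d = - s" using cd by (auto simp: B)
  let ?N = "\<lambda>f. f (Over c) = f p \<and> f (Over d) = f p \<and> f u \<in> qcarrier X \<and>
    under_rule X t (f q) (f p) (f u) \<and> f v = f q"
  let ?S = "{p, q, Over c, Over d, u, v}"
  show ?thesis
  proof (rule extendsI[where N = ?N])
    fix f
    have bigon: "passes X B f (f q) u \<and> passes X B f (f u) v \<longleftrightarrow>
        under_rule X t (f q) (f p) (f u) \<and> f v = f q"
      if car: "f p \<in> qcarrier X" "f q \<in> qcarrier X" "f u \<in> qcarrier X" "f v \<in> qcarrier X"
        and o: "f (Over c) = f p" "f (Over d) = f p"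
    proof -
      have "passes X B f (f q) u \<longleftrightarrow> under_rule X t (f q) (f p) (f u)"
        using uv sc o cd by (auto simp: t_def)
      moreover have "passes X B f (f u) v \<longleftrightarrow> under_rule X t (f v) (f p) (f u)"
        using uv sc o cd under_rule_sym[OF s, of X] under_rule_sym[of "- s" X] s by (auto simp: t_def)
      ultimately show ?thesis using under_rule_unique_in[OF X car(4,2,1,3)] by auto
    qed
    have d: "points B - ?S = points A - {p, q}" using new uvnew by (auto simp: ptsB)
    have "coloring X B f \<longleftrightarrow>
      (\<forall>w\<in>points A - {p, q}. f w \<in> qcarrier X \<and> passes X B f (f w) (nxt B w)) \<and>
      (\<forall>w\<in>?S. f w \<in> qcarrier X \<and> passes X B f (f w) (nxt B w))"
      using coloring_split[of ?S B X f] p q unfolding d by (auto simp: ptsB)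
    also have "(\<forall>w\<in>points A - {p, q}. f w \<in> qcarrier X \<and> passes X B f (f w) (nxt B w)) \<longleftrightarrow>
       (\<forall>w\<in>points A - {p, q}. f w \<in> qcarrier X \<and> passes X A f (f w) (nxt A w))"
      using np by (intro ball_cong) (auto simp: nx pass)
    also have "(\<forall>w\<in>?S. f w \<in> qcarrier X \<and> passes X B f (f w) (nxt B w)) \<longleftrightarrow>
       (\<forall>w\<in>{p, q}. f w \<in> qcarrier X \<and> passes X A f (f w) (nxt A w)) \<and> ?N f"
      using bigon by (auto simp: nx' pass np p q)
    finally show "coloring X B f \<longleftrightarrow> coloring X A f \<and> ?N f"
      using coloring_split[of "{p, q}" A X f] p q by auto
  next
    fix f assume "coloring X A f"
    then have "f p \<in> qcarrier X" "f q \<in> qcarrier X" using p q by (auto simp: coloring_def)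
    then obtain m where m: "m \<in> qcarrier X" "under_rule X t (f q) (f p) m"
      using under_rule_ex[OF X] by metis
    show "\<exists>f'. (\<forall>v\<in>points A. f' v = f v) \<and> ?N f'"
      using new uvnew ne m cd
      by (intro exI[of _ "f(Over c := f p, Over d := f p, u := m, v := f q)"]) auto
  next
    fix f f' assume f: "coloring X A f" "\<forall>v\<in>points A. f v = f' v" "?N f" "?N f'"
    then have "f p \<in> qcarrier X" "f q \<in> qcarrier X" using p q by (auto simp: coloring_def)
    then have "f u = f' u"
      using under_rule_unique_out[OF X, of "f u" "f' u" "f p" "f q" t] f p q by auto
    then show "\<forall>v\<in>points B. f v = f' v" using f p q by (auto simp: ptsB)
  qed (use A in \<open>auto simp: B\<close>)
qed

text \<open>Passing under \<open>t\<close> is a right translation or the inverse of one. By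
  self-distributivity it is an automorphism of the quandle, so it preserves the relation at any
  crossing. This is the algebra behind the third move.\<close>

lemma under_rule_automorphism:
  assumes X: "is_quandle X"
    and car: "a \<in> qcarrier X" "b \<in> qcarrier X" "d \<in> qcarrier X"
      "a' \<in> qcarrier X" "b' \<in> qcarrier X" "d' \<in> qcarrier X" "t \<in> qcarrier X"
    and "under_rule X s a b d"
    and t: "under_rule X \<epsilon> a t a'" "under_rule X \<epsilon> b t b'" "under_rule X \<epsilon> d t d'"
  shows "under_rule X s a' b' d'"
proof (cases "\<epsilon> = 1")
  case True
  then show ?thesis
    using assms qop_dist[OF X] by (auto simp: under_rule_def split: if_splits)
next
  case False
  then have e: "a = qop X a' t" "b = qop X b' t" "d = qop X d' t"
    using t by (auto simp: under_rule_def)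
  show ?thesis
  proof (cases "s = 1")
    case True
    then have "qop X d' t = qop X (qop X a' b') t"
      using assms(9) e qop_dist[OF X car(4,5,7)] by (simp add: under_rule_def)
    then show ?thesis
      using True car qop_cancel[OF X car(6) qop_closed[OF X car(4,5)] car(7)] by (simp add: under_rule_def)
  next
    case False
    then have "qop X a' t = qop X (qop X d' b') t"
      using assms(9) e qop_dist[OF X car(6,5,7)] by (simp add: under_rule_def)
    then show ?thesis
      using False car qop_cancel[OF X car(4) qop_closed[OF X car(6,5)] car(7)] by (simp add: under_rule_def)
  qed
qed

text \<open>The matrix of \<open>reidemeister3\<close> with its witnesses as parameters, so that the
  strands can be named and the move can be reversed.\<close>

definition triangle_move ::
    "diagram \<Rightarrow> diagram \<Rightarrow> nat \<Rightarrow> nat \<Rightarrow> nat \<Rightarrow> int \<Rightarrow> int \<Rightarrow> int \<Rightarrow> bool" where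
  "triangle_move A B c d e i j k \<longleftrightarrow>
     c \<in> crossings A \<and> d \<in> crossings A \<and> e \<in> crossings A \<and> c \<noteq> d \<and> d \<noteq> e \<and> c \<noteq> e \<and>
     consecutive A i (Over c) (Over d) \<and>
     consecutive A j (Under c) (Over e) \<and>
     consecutive A k (Under d) (Under e) \<and>
     j * csign A c = k * csign A d \<and> j * csign A e = i * csign A d \<and>
     (let \<pi> = transpose (Over c) (Over d) \<circ> transpose (Under c) (Over e)
              \<circ> transpose (Under d) (Under e)
      in B = Diagram (points A) (\<pi> \<circ> nxt A \<circ> \<pi>) (csign A))"

lemma reidemeister3_iff: "reidemeister3 A B \<longleftrightarrow> (\<exists>c d e i j k. triangle_move A B c d e i j k)"
  unfolding reidemeister3_def triangle_move_def by blast

definition swap3 :: "nat \<Rightarrow> nat \<Rightarrow> nat \<Rightarrow> point \<Rightarrow> point" where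
  "swap3 c d e = transpose (Over c) (Over d) \<circ> transpose (Under c) (Over e)
     \<circ> transpose (Under d) (Under e)"

lemma swap3_simps:
  assumes "c \<noteq> d" "d \<noteq> e" "c \<noteq> e"
  shows "swap3 c d e (Over c) = Over d" "swap3 c d e (Over d) = Over c"
    "swap3 c d e (Under c) = Over e" "swap3 c d e (Over e) = Under c"
    "swap3 c d e (Under d) = Under e" "swap3 c d e (Under e) = Under d"
    "swap3 c d e (Mark m) = Mark m"
    "w \<noteq> c \<Longrightarrow> w \<noteq> d \<Longrightarrow> w \<noteq> e \<Longrightarrow> swap3 c d e (Over w) = Over w"
    "w \<noteq> c \<Longrightarrow> w \<noteq> d \<Longrightarrow> w \<noteq> e \<Longrightarrow> swap3 c d e (Under w) = Under w"
    "swap3 c d e (swap3 c d e v) = v"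
proof -
  show *: "swap3 c d e (Over c) = Over d" "swap3 c d e (Over d) = Over c"
    "swap3 c d e (Under c) = Over e" "swap3 c d e (Over e) = Under c"
    "swap3 c d e (Under d) = Under e" "swap3 c d e (Under e) = Under d"
    "swap3 c d e (Mark m) = Mark m" for m
    using assms by (simp_all add: swap3_def transpose_def)
  show **: "w \<noteq> c \<Longrightarrow> w \<noteq> d \<Longrightarrow> w \<noteq> e \<Longrightarrow> swap3 c d e (Over w) = Over w"
    "w \<noteq> c \<Longrightarrow> w \<noteq> d \<Longrightarrow> w \<noteq> e \<Longrightarrow> swap3 c d e (Under w) = Under w" for w
    using assms by (simp_all add: swap3_def transpose_def)
  show "swap3 c d e (swap3 c d e v) = v"
  proof (cases v)
    case (Over w) then show ?thesis using * ** by (metis)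
  next
    case (Under w) then show ?thesis using * ** by (metis)
  qed (simp add: *)
qed

lemma triangle_move_simps:
  assumes "triangle_move A B c d e i j k"
  shows "points B = points A" "csign B = csign A" "nxt B = swap3 c d e \<circ> nxt A \<circ> swap3 c d e"
    "crossings B = crossings A"
  using assms by (simp_all add: triangle_move_def swap3_def crossings_def Let_def)

text \<open>Conjugation by the involution reverses the order of the two passages on each strand,
  which negates \<open>i\<close>, \<open>j\<close> and \<open>k\<close>. The equations between the
  signs are homogeneous in these, so they survive.\<close>

lemma triangle_move_sym:
  assumes "triangle_move A B c d e i j k"
  shows "triangle_move B A c d e (- i) (- j) (- k)"
proof -
  note s = triangle_move_simps[OF assms]
  have ne: "c \<noteq> d" "d \<noteq> e" "c \<noteq> e" using assms by (auto simp: triangle_move_def)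
  note sw = swap3_simps[OF ne]
  have "swap3 c d e \<circ> nxt B \<circ> swap3 c d e = nxt A" by (auto simp: s sw fun_eq_iff)
  then have "A = Diagram (points B) (swap3 c d e \<circ> nxt B \<circ> swap3 c d e) (csign B)"
    by (simp add: s)
  then show ?thesis
    using assms unfolding triangle_move_def swap3_def[symmetric] Let_def s(2,4)
    by (auto simp: consecutive_def s(3) sw)
qed

text \<open>The ends of the edge between \<open>u\<close> and \<open>v\<close>, if \<open>consecutive D e u v\<close>.\<close>

definition tail :: "int \<Rightarrow> point \<Rightarrow> point \<Rightarrow> point" where
  "tail e u v = (if e = 1 then u else v)"

definition tip :: "int \<Rightarrow> point \<Rightarrow> point \<Rightarrow> point" where
  "tip e u v = (if e = 1 then v else u)"

lemmas strand_defs = tail_def tip_def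

context
  fixes A B c d e i j k and X :: "('a, 'm) magma_scheme"
  assumes tm: "triangle_move A B c d e i j k" and A: "gauss_data A" and X: "is_quandle X"
begin

text \<open>The strands are numbered 1 (top), 2 (middle), 3 (bottom). As a point also names the edge
  that leaves it, \<open>first1\<close>, \<open>first2\<close> and \<open>first3\<close> are the
  sides of the triangle, and \<open>second1\<close>, \<open>second2\<close>, \<open>second3\<close>
  the edges by which the strands leave it.\<close>

abbreviation "first1 \<equiv> tail i (Over c) (Over d)"
abbreviation "second1 \<equiv> tip i (Over c) (Over d)"
abbreviation "first2 \<equiv> tail j (Under c) (Over e)"
abbreviation "second2 \<equiv> tip j (Under c) (Over e)"
abbreviation "first3 \<equiv> tail k (Under d) (Under e)"
abbreviation "second3 \<equiv> tip k (Under d) (Under e)"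

lemma ne: "c \<noteq> d" "d \<noteq> e" "c \<noteq> e" using tm by (auto simp: triangle_move_def)

lemmas sw = swap3_simps[OF ne]

lemma signs: "i = 1 \<or> i = -1" "j = 1 \<or> j = -1" "k = 1 \<or> k = -1"
  using tm by (auto simp: triangle_move_def consecutive_def)

lemma strands: "nxt A first1 = second1" "nxt A first2 = second2" "nxt A first3 = second3"
  using tm by (auto simp: triangle_move_def consecutive_def strand_defs)

lemma strand_points: "{first1, second1, first2, second2, first3, second3} \<subseteq> points A"
  using tm gauss_dataD(6,7)[OF A] by (auto simp: triangle_move_def strand_defs)

lemma strand_distinct: "distinct [first1, second1, first2, second2, first3, second3]"
  using ne by (auto simp: strand_defs)

lemma strand_swap:
  "swap3 c d e first1 = second1" "swap3 c d e second1 = first1"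
  "swap3 c d e first2 = second2" "swap3 c d e second2 = first2"
  "swap3 c d e first3 = second3" "swap3 c d e second3 = first3"
  by (auto simp: strand_defs sw)

lemma swap_fix: "v \<notin> {first1, second1, first2, second2, first3, second3} \<Longrightarrow> swap3 c d e v = v"
  by (cases v) (auto simp: strand_defs sw split: if_splits)

lemma swap_in: "v \<in> points A \<Longrightarrow> swap3 c d e v \<in> points A"
  using strand_points strand_swap swap_fix[of v] by (cases "v \<in> {first1, second1, first2, second2, first3, second3}") auto

text \<open>Each side is recovered from the edge by which its strand leaves the triangle, by
  equality at an over passage and by cancellation at an under passage. The strands are treated from
  top to bottom, as each needs the colours of those above it.\<close>

lemma triangle_determined:
  assumes f: "coloring X A f" and g: "coloring X A g"
    and eq: "\<forall>v\<in>points A - {first1, first2, first3}. f v = g v"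
  shows "\<forall>v\<in>points A. f v = g v"
proof -
  have pf: "passes X A f (f v) (nxt A v)" and pg: "passes X A g (g v) (nxt A v)"
    and cf: "f v \<in> qcarrier X" and cg: "g v \<in> qcarrier X" if "v \<in> points A" for v
    using f g that by (auto simp: coloring_def)
  have pts: "Over c \<in> points A" "Over d \<in> points A" "Over e \<in> points A"
    "Under c \<in> points A" "Under d \<in> points A" "Under e \<in> points A"
    using tm gauss_dataD(6,7)[OF A] by (auto simp: triangle_move_def)
  have s: "f second1 = g second1" "f second2 = g second2" "f second3 = g second3"
    using eq strand_points strand_distinct by auto
  have 1: "f first1 = g first1"
    using pf[of first1] pg[of first1] strand_points strands s
    by (auto simp: strand_defs split: if_splits)
  have o: "f (Over c) = g (Over c)" "f (Over d) = g (Over d)"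
    using 1 s(1) by (auto simp: strand_defs split: if_splits)
  have 2: "f first2 = g first2"
  proof (cases "j = 1")
    case True
    then show ?thesis
      using pf[of first2] pg[of first2] strand_points strands s by (auto simp: strand_defs)
  next
    case False
    then show ?thesis
      using pf[of first2] pg[of first2] strands s o pts cf cg
        under_rule_unique_in[OF X, of "f (Over e)" "g (Over e)" "f (Over c)" "f (Under c)" "csign A c"]
      by (auto simp: strand_defs)
  qed
  have o': "f (Over e) = g (Over e)"
    using 2 s(2) by (auto simp: strand_defs split: if_splits)
  have "f first3 = g first3"
  proof (cases "k = 1")
    case True
    then show ?thesis
      using pf[of first3] pg[of first3] strands s o' pts cf cg
        under_rule_unique_in[OF X, of "f (Under d)" "g (Under d)" "f (Over e)" "f (Under e)" "csign A e"]
      by (auto simp: strand_defs)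
  next
    case False
    then show ?thesis
      using pf[of first3] pg[of first3] strands s o pts cf cg
        under_rule_unique_in[OF X, of "f (Under e)" "g (Under e)" "f (Over d)" "f (Under d)" "csign A d"]
      by (auto simp: strand_defs)
  qed
  then show ?thesis using eq 1 2 by auto
qed

text \<open>All edges outside the triangle keep their colours; only the three new sides have to be
  coloured. For the bottom strand this amounts to passing under the top and the middle strand in the
  other order.\<close>

lemma triangle_transport:
  assumes f: "coloring X A f"
  shows "\<exists>f'. coloring X B f' \<and> (\<forall>v\<in>points A - {first1, first2, first3}. f' (swap3 c d e v) = f v)"
proof -
  have pf: "passes X A f (f v) (nxt A v)" and cf: "f v \<in> qcarrier X" if "v \<in> points A" for v
    using f that by (auto simp: coloring_def)
  have pts: "Over c \<in> points A" "Over d \<in> points A" "Over e \<in> points A"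
    "Under c \<in> points A" "Under d \<in> points A" "Under e \<in> points A"
    using tm gauss_dataD(6,7)[OF A] by (auto simp: triangle_move_def)
  let ?\<epsilon> = "csign A"
  have cc: "c \<in> crossings A" "d \<in> crossings A" "e \<in> crossings A" using tm by (auto simp: triangle_move_def)
  have sg: "?\<epsilon> c = 1 \<or> ?\<epsilon> c = -1" "?\<epsilon> d = 1 \<or> ?\<epsilon> d = -1" "?\<epsilon> e = 1 \<or> ?\<epsilon> e = -1"
    using gauss_dataD(8)[OF A] cc by blast+
  have rel: "j * ?\<epsilon> c = k * ?\<epsilon> d" using tm by (auto simp: triangle_move_def)
  obtain x1 x2 x3 where x: "x1 \<in> points A" "nxt A x1 = first1" "x2 \<in> points A" "nxt A x2 = first2"
      "x3 \<in> points A" "nxt A x3 = first3"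
    using nxt_surj[OF A] strand_points by (metis insert_subset)
  define t where "t = f first1"
  have t: "f (Over c) = t" "f (Over d) = t" "f x1 = t"
    using pf[of first1] pf[OF x(1)] strand_points strands x unfolding t_def
    by (auto simp: strand_defs split: if_splits)
  define m0 m2 b0 b2 where "m0 = f x2" and "m2 = f second2" and "b0 = f x3" and "b2 = f second3"
  \<comment> \<open>The colour of the middle strand where it runs over the bottom one, before
    (\<open>\<mu>\<close>) and after (\<open>\<mu>'\<close>) the move. \<open>Over e\<close> lies
    beyond the crossing with the top strand in \<open>A\<close> exactly if
    \<open>j = 1\<close>.\<close>
  define \<mu> \<mu>' where "\<mu> = (if j = 1 then m2 else m0)" and "\<mu>' = (if j = 1 then m0 else m2)"
  have car: "t \<in> qcarrier X" "m0 \<in> qcarrier X" "m2 \<in> qcarrier X" "b0 \<in> qcarrier X" "b2 \<in> qcarrier X"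
    "\<mu> \<in> qcarrier X" "\<mu>' \<in> qcarrier X"
    using cf x strand_points by (auto simp: t_def m0_def m2_def b0_def b2_def \<mu>_def \<mu>'_def)
  have mid: "under_rule X (?\<epsilon> c) m0 t m2" and \<mu>: "f (Over e) = \<mu>"
    using pf[of first2] pf[OF x(3)] strand_points strands x t
    by (auto simp: strand_defs m0_def m2_def \<mu>_def split: if_splits)
  \<comment> \<open>Here the first equation between the signs enters: it turns the crossing
    \<open>c\<close> into a passage under \<open>t\<close> with the sign of \<open>d\<close>. Thus
    the middle and the bottom strand are moved by the same automorphism.\<close>
  have \<mu>t: "if k = 1 then under_rule X (?\<epsilon> d) \<mu>' t \<mu> else under_rule X (?\<epsilon> d) \<mu> t \<mu>'"
    using mid rel signs sg under_rule_sym[of 1 X] under_rule_sym[of "-1" X] by (auto simp: \<mu>_def \<mu>'_def)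
  have bot: "if k = 1 then under_rule X (?\<epsilon> d) b0 t (f (Under d)) \<and> under_rule X (?\<epsilon> e) (f (Under d)) \<mu> b2
      else under_rule X (?\<epsilon> e) b0 \<mu> (f (Under e)) \<and> under_rule X (?\<epsilon> d) (f (Under e)) t b2"
    using pf[of first3] pf[OF x(5)] strand_points strands x t \<mu>
    by (auto simp: strand_defs b0_def b2_def split: if_splits)
  \<comment> \<open>\<open>n\<close> is the colour of the new side on the bottom strand. It is
    chosen to satisfy the first crossing met there, and what remains is to arrive at the old final
    colour \<open>b2\<close>.\<close>
  have "\<exists>n. n \<in> qcarrier X \<and> (if k = 1 then under_rule X (?\<epsilon> e) b0 \<mu>' n \<and> under_rule X (?\<epsilon> d) n t b2
      else under_rule X (?\<epsilon> d) b0 t n \<and> under_rule X (?\<epsilon> e) n \<mu>' b2)"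
  proof (cases "k = 1")
    case True
    obtain n where n: "n \<in> qcarrier X" "under_rule X (?\<epsilon> e) b0 \<mu>' n"
      using under_rule_ex[OF X car(4,7)] by blast
    obtain n' where n': "n' \<in> qcarrier X" "under_rule X (?\<epsilon> d) n t n'"
      using under_rule_ex[OF X n(1) car(1)] by blast
    \<comment> \<open>Passing under \<open>t\<close> carries \<open>b0\<close>,
      \<open>\<mu>'\<close>, \<open>n\<close> to \<open>f (Under d)\<close>, \<open>\<mu>\<close>,
      \<open>n'\<close>.\<close>
    have "under_rule X (?\<epsilon> e) (f (Under d)) \<mu> n'"
      by (rule under_rule_automorphism[OF X car(4,7) n(1) cf[OF pts(5)] car(6) n'(1) car(1) n(2), where \<epsilon> = "?\<epsilon> d"])
        (use True bot \<mu>t n' pts in auto)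
    then have "n' = b2"
      using under_rule_unique_out[OF X n'(1) car(5) car(6) cf[OF pts(5)]] bot True by auto
    then show ?thesis using n n' True by auto
  next
    case False
    obtain n where n: "n \<in> qcarrier X" "under_rule X (?\<epsilon> d) b0 t n"
      using under_rule_ex[OF X car(4,1)] by blast
    have "under_rule X (?\<epsilon> e) n \<mu>' b2"
      by (rule under_rule_automorphism[OF X car(4,6) cf[OF pts(6)] n(1) car(7,5,1), where \<epsilon> = "?\<epsilon> d"])
        (use False bot \<mu>t n pts in auto)
    then show ?thesis using n False by auto
  qed
  then obtain n where n: "n \<in> qcarrier X" and
    bot': "if k = 1 then under_rule X (?\<epsilon> e) b0 \<mu>' n \<and> under_rule X (?\<epsilon> d) n t b2
      else under_rule X (?\<epsilon> d) b0 t n \<and> under_rule X (?\<epsilon> e) n \<mu>' b2" by blast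
  \<comment> \<open>In \<open>B\<close> the passages \<open>second1\<close>, \<open>second2\<close>,
    \<open>second3\<close> come first on their strands, so these points name the new sides.\<close>
  define f' where "f' v = (if v = second1 then t else if v = second2 then \<mu>' else
    if v = second3 then n else f (swap3 c d e v))" for v
  have keep: "f' (swap3 c d e v) = f v" if "v \<notin> {first1, first2, first3}" for v
    using that strand_swap by (metis f'_def insertCI sw(10))
  have new: "f' second1 = t" "f' second2 = \<mu>'" "f' second3 = n"
    "f' first1 = t" "f' first2 = m2" "f' first3 = b2"
  proof -
    show "f' second1 = t" "f' second2 = \<mu>'" "f' second3 = n"
      using strand_distinct by (auto simp: f'_def)
    show "f' first2 = m2" "f' first3 = b2"
      using strand_distinct by (auto simp: f'_def strand_swap m2_def b2_def)
    have "f second1 = t" using t(1,2) by (simp add: strand_defs)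
    then show "f' first1 = t" using strand_distinct by (auto simp: f'_def strand_swap)
  qed
  have over: "f' (Over c) = t" "f' (Over d) = t" "f' (Over e) = \<mu>'"
    using new by (auto simp: strand_defs \<mu>'_def split: if_splits)
  have ok: "f' (swap3 c d e w) \<in> qcarrier X \<and>
      passes X B f' (f' (swap3 c d e w)) (nxt B (swap3 c d e w))" if w: "w \<in> points A" for w
  proof -
    have nB: "nxt B (swap3 c d e w) = swap3 c d e (nxt A w)"
      using triangle_move_simps(3)[OF tm] by (simp add: sw)
    have sB: "csign B = csign A" by (rule triangle_move_simps(2)[OF tm])
    consider "w = first1" | "w = first2" | "w = first3" | "w \<notin> {first1, first2, first3}" by blast
    then show ?thesis
    proof cases
      case 1
      then show ?thesis unfolding nB
        using strands new car by (auto simp: sw strand_defs split: if_splits)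
    next
      case 2
      then show ?thesis unfolding nB
        using strands new car over mid
        by (auto simp: sw strand_defs sB \<mu>'_def split: if_splits)
    next
      case 3
      then show ?thesis unfolding nB
        using strands new n over bot'
        by (auto simp: sw strand_defs sB split: if_splits)
    next
      case 4
      have car': "f' (swap3 c d e w) \<in> qcarrier X" and k: "f' (swap3 c d e w) = f w"
        using keep[OF 4] cf w by auto
      have inj: "nxt A w = nxt A v \<longleftrightarrow> w = v" if "v \<in> points A" for v
        using gauss_dataD(5)[OF A w that] .
      have ns: "nxt A w \<notin> {second1, second2, second3}"
        using 4 inj strand_points unfolding strands[symmetric] by auto
      consider "nxt A w = first1" | "nxt A w = first2" | "nxt A w = first3"
        | "nxt A w \<notin> {first1, second1, first2, second2, first3, second3}" using ns by blast
      then have "passes X B f' (f w) (swap3 c d e (nxt A w))"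
      proof cases
        case 1
        then have "w = x1" using inj x by metis
        then show ?thesis using 1 new t by (auto simp: sw strand_defs split: if_splits)
      next
        case 2
        then have "w = x2" using inj x by metis
        then show ?thesis using 2 new over mid
          by (auto simp: sw strand_defs sB \<mu>'_def m0_def split: if_splits)
      next
        case 3
        then have "w = x3" using inj x by metis
        then show ?thesis using 3 new over bot'
          by (auto simp: sw strand_defs sB b0_def split: if_splits)
      next
        case 4
        have sp: "v \<in> {first1, second1, first2, second2, first3, second3}"
          if "v \<in> {Over c, Over d, Over e, Under c, Under d, Under e}" for v
          using that by (auto simp: strand_defs)
        have fx: "f' v = f v" if "v \<notin> {Over c, Over d, Over e, Under c, Under d, Under e}" for v
        proof -
          have "v \<notin> {first1, second1, first2, second2, first3, second3}"
            using that by (auto simp: strand_defs split: if_splits)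
          then show ?thesis using swap_fix[of v] by (simp add: f'_def)
        qed
        have "passes X B f' (f w) (nxt A w) = passes X A f (f w) (nxt A w)"
        proof (rule passes_cong)
          show "f' (nxt A w) = f (nxt A w)" using fx sp 4 by blast
          show "csign B q = csign A q \<and> f' (Over q) = f (Over q)" if "nxt A w = Under q" for q
            using sp[of "Under q"] 4 that fx[of "Over q"] sB by auto
        qed simp
        then show ?thesis using pf[OF w] swap_fix[OF 4] by simp
      qed
      then show ?thesis using car' unfolding nB k by blast
    qed
  qed
  have "coloring X B f'"
    unfolding coloring_def triangle_move_simps(1)[OF tm]
  proof
    fix v assume "v \<in> points A"
    then show "f' v \<in> qcarrier X \<and> passes X B f' (f' v) (nxt B v)"
      using ok[OF swap_in[of v]] by (simp add: sw)
  qed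
  then show ?thesis using keep by blast
qed

end

text \<open>Every edge except the sides of the triangle persists, renamed by \<open>swap3\<close>.
  Pulling back and uniqueness on \<open>B\<close> are the transport and determination results for
  the reversed move.\<close>

lemma lifts_triangle_move:
  assumes tm: "triangle_move A B c d e i j k" and AB: "gauss_data A" "gauss_data B"
    and X: "is_quandle X" and Y: "is_quandle Y"
  shows "lifts X Y A B"
proof -
  note tm' = triangle_move_sym[OF tm] and sw = swap3_simps[OF ne[OF tm AB(1) X]]
  note s = signs[OF tm AB(1) X]
  let ?F = "{tail i (Over c) (Over d), tail j (Under c) (Over e), tail k (Under d) (Under e)}"
  let ?F' = "{tail (- i) (Over c) (Over d), tail (- j) (Under c) (Over e), tail (- k) (Under d) (Under e)}"
  have tip: "tail (- e) u v = tip e u v" if "e = 1 \<or> e = -1" for e u v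
    using that by (auto simp: strand_defs)
  have F': "?F' = swap3 c d e ` ?F" using s strand_swap[OF tm AB(1) X] by (simp add: tip)
  have pts: "points B = points A" by (rule triangle_move_simps(1)[OF tm])
  have im: "swap3 c d e v \<in> points A" if "v \<in> points A" for v using swap_in[OF tm AB(1) X that] .
  have "inj (swap3 c d e)" by (rule inj_on_inverseI[of _ "swap3 c d e"]) (rule sw(10))
  then have notin: "swap3 c d e v \<notin> ?F' \<longleftrightarrow> v \<notin> ?F" for v
    unfolding F' by (simp only: inj_image_mem_iff)
  show ?thesis
  proof (rule liftsI[where P = "points A - ?F" and h = "swap3 c d e"])
    fix f assume "coloring X B f"
    from triangle_transport[OF tm' AB(2) X this]
    obtain f' where f': "coloring X A f'" "\<forall>v\<in>points B - ?F'. f' (swap3 c d e v) = f v" by blast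
    have "f' v = f (swap3 c d e v)" if v: "v \<in> points A - ?F" for v
    proof -
      have "swap3 c d e v \<in> points B - ?F'" using v im notin pts by blast
      then show ?thesis using f'(2) sw(10) by metis
    qed
    then show "\<exists>f'. coloring X A f' \<and> (\<forall>v\<in>points A - ?F. f' v = f (swap3 c d e v))"
      using f'(1) by blast
  next
    fix f assume "coloring Y A f"
    from triangle_transport[OF tm AB(1) Y this]
    show "\<exists>f'. coloring Y B f' \<and> (\<forall>v\<in>points A - ?F. f' (swap3 c d e v) = f v)" .
  next
    fix f f' assume f: "coloring X B f" "coloring X B f'"
      and eq: "\<forall>v\<in>points A - ?F. f (swap3 c d e v) = f' (swap3 c d e v)"
    have "f v = f' v" if v: "v \<in> points B - ?F'" for v
    proof -
      have "swap3 c d e v \<in> points A - ?F" using v im notin[of "swap3 c d e v"] pts sw(10) by auto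
      then show ?thesis using eq sw(10) by metis
    qed
    then show "\<forall>v\<in>points B. f v = f' v"
      using triangle_determined[OF tm' AB(2) X f] by blast
  qed (use AB in auto)
qed

lemma lifts_move:
  assumes "move A B" and X: "is_quandle X" and Y: "is_quandle Y"
  shows "lifts X Y A B" "lifts X Y B A"
proof -
  have AB: "gauss_data A" "gauss_data B" using assms(1) by (auto simp: move_def link_diagram_def)
  consider "diagram_iso A B" | "extends X A B" "extends Y A B" | "reidemeister3 A B"
    using assms(1) extends_add_mark extends_reidemeister1 extends_reidemeister2 X Y AB
    unfolding move_def by metis
  then have "lifts X Y A B \<and> lifts X Y B A"
  proof cases
    case 1
    then show ?thesis using lifts_diagram_iso AB by blast
  next
    case 2
    then show ?thesis using lifts_extends AB by blast
  next
    case 3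
    then obtain c d e i j k where "triangle_move A B c d e i j k" unfolding reidemeister3_iff by blast
    then show ?thesis
      using lifts_triangle_move[OF _ AB X Y] lifts_triangle_move[OF triangle_move_sym AB(2,1) X Y] by blast
  qed
  then show "lifts X Y A B" "lifts X Y B A" by auto
qed

theorem lifts_isotopic:
  assumes "isotopic A B" and X: "is_quandle X" and Y: "is_quandle Y"
  shows "lifts X Y A B"
proof -
  have "(\<lambda>A B. move A B \<or> move B A)\<^sup>*\<^sup>* A B" using assms(1) by (simp add: isotopic_def)
  then show ?thesis
  proof induction
    case (step B C)
    then show ?case using lifts_move X Y lifts_trans by metis
  qed (rule lifts_refl)
qed


section \<open>Maps on the sphere\<close>

text \<open>A breadth-first tree: \<open>rank\<close> is the distance from \<open>w0\<close> and
  \<open>par w\<close> a dart towards a vertex one step nearer. The incidence \<open>vert\<close> is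
  arbitrary, so the lemma serves the graph as well as its dual.\<close>

lemma spanning_tree:
  fixes vert :: "'h \<Rightarrow> 'v"
  assumes inv: "\<And>h. h \<in> B \<Longrightarrow> \<alpha> h \<in> B \<and> \<alpha> (\<alpha> h) = h"
    and W: "vert ` B \<subseteq> W" "w0 \<in> W"
    and conn: "\<And>C. C \<subseteq> W \<Longrightarrow> w0 \<in> C \<Longrightarrow> (\<And>h. h \<in> B \<Longrightarrow> vert h \<in> C \<Longrightarrow> vert (\<alpha> h) \<in> C) \<Longrightarrow> C = W"
  shows "\<exists>(rank :: 'v \<Rightarrow> nat) par. \<forall>w\<in>W. w \<noteq> w0 \<longrightarrow>
    par w \<in> B \<and> vert (par w) = w \<and> rank (vert (\<alpha> (par w))) < rank w"
proof -
  define E where "E = {(vert h, vert (\<alpha> h)) | h. h \<in> B}"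
  define rank where "rank w = (LEAST n. (w0, w) \<in> E ^^ n)" for w
  have "{w \<in> W. \<exists>n. (w0, w) \<in> E ^^ n} = W"
  proof (rule conn)
    show "w0 \<in> {w \<in> W. \<exists>n. (w0, w) \<in> E ^^ n}"
      using W(2) by (auto intro: exI[of _ 0])
    fix h assume h: "h \<in> B" "vert h \<in> {w \<in> W. \<exists>n. (w0, w) \<in> E ^^ n}"
    then obtain n where "(w0, vert h) \<in> E ^^ n" by auto
    moreover have "(vert h, vert (\<alpha> h)) \<in> E" using h by (auto simp: E_def)
    ultimately have "(w0, vert (\<alpha> h)) \<in> E ^^ Suc n" by auto
    moreover have "vert (\<alpha> h) \<in> W" using inv h W by auto
    ultimately show "vert (\<alpha> h) \<in> {w \<in> W. \<exists>n. (w0, w) \<in> E ^^ n}" by blast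
  qed auto
  then have reach: "\<exists>n. (w0, w) \<in> E ^^ n" if "w \<in> W" for w using that by auto
  have "\<exists>k. k \<in> B \<and> vert k = w \<and> rank (vert (\<alpha> k)) < rank w" if w: "w \<in> W" "w \<noteq> w0" for w
  proof -
    have r: "(w0, w) \<in> E ^^ rank w"
      unfolding rank_def using reach[OF w(1)] by (rule LeastI_ex)
    then have "rank w \<noteq> 0" using w(2) by (metis relpow_0_E)
    then obtain m where m: "rank w = Suc m" using not0_implies_Suc by blast
    with r obtain u where u: "(w0, u) \<in> E ^^ m" "(u, w) \<in> E" by auto
    then obtain h where h: "h \<in> B" "u = vert h" "w = vert (\<alpha> h)" by (auto simp: E_def)
    have "rank u \<le> m" unfolding rank_def using u(1) by (rule Least_le)
    then show ?thesis using h inv[OF h(1)] m by (intro exI[of _ "\<alpha> h"]) auto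
  qed
  then show ?thesis by metis
qed

text \<open>A tree has one edge fewer than vertices, and each edge counts as two darts. No edge is
  chosen from both of its ends, because the rank drops along \<open>par\<close>.\<close>

lemma card_tree_darts:
  fixes rank :: "'v \<Rightarrow> nat"
  assumes fin: "finite W" and w0: "w0 \<in> W"
    and inv: "\<And>h. h \<in> B \<Longrightarrow> \<alpha> (\<alpha> h) = h"
    and par: "\<And>w. w \<in> W \<Longrightarrow> w \<noteq> w0 \<Longrightarrow> par w \<in> B \<and> vert (par w) = w \<and> rank (vert (\<alpha> (par w))) < rank w"
  shows "card (par ` (W - {w0}) \<union> \<alpha> ` par ` (W - {w0})) = 2 * (card W - 1)"
proof -
  let ?P = "par ` (W - {w0})"
  have "inj_on par (W - {w0})" using par by (intro inj_on_inverseI[of _ vert]) auto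
  then have c: "card ?P = card W - 1" using fin w0 by (simp add: card_image)
  have "inj_on \<alpha> ?P" using inv par by (intro inj_on_inverseI[of _ \<alpha>]) auto
  then have c': "card (\<alpha> ` ?P) = card W - 1" using c by (simp add: card_image)
  have "?P \<inter> \<alpha> ` ?P = {}"
  proof (rule ccontr)
    assume "?P \<inter> \<alpha> ` ?P \<noteq> {}"
    then obtain w u where wu: "w \<in> W" "w \<noteq> w0" "u \<in> W" "u \<noteq> w0" "par w = \<alpha> (par u)" by auto
    then have "\<alpha> (par w) = par u" using inv par by metis
    then have "rank u < rank w" "rank w < rank u" using wu par by metis+
    then show False by simp
  qed
  then show ?thesis using c c' fin by (subst card_Un_disjoint) auto
qed

text \<open>A map given by darts: \<open>\<alpha>\<close> reverses a dart, \<open>\<phi>\<close>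
  leads to the next dart along the boundary of the same face. The last assumption is
  \<open>V - E + F = 2\<close> doubled, with two darts to an edge.\<close>

locale spherical_map =
  fixes H :: "'h set" and \<alpha> \<phi> :: "'h \<Rightarrow> 'h" and vert :: "'h \<Rightarrow> 'v" and face :: "'h \<Rightarrow> 'f"
  assumes fin: "finite H" and ne: "H \<noteq> {}"
    and flip: "\<And>h. h \<in> H \<Longrightarrow> \<alpha> h \<in> H" "\<And>h. h \<in> H \<Longrightarrow> \<alpha> (\<alpha> h) = h"
    and turn: "bij_betw \<phi> H H"
    and vert_turn: "\<And>h. h \<in> H \<Longrightarrow> vert (\<phi> h) = vert (\<alpha> h)"
    and face_turn: "\<And>h. h \<in> H \<Longrightarrow> face (\<phi> h) = face h"
    and connected: "\<And>Z. Z \<subseteq> H \<Longrightarrow> Z \<noteq> {} \<Longrightarrow> (\<And>h. h \<in> Z \<Longrightarrow> \<alpha> h \<in> Z \<and> \<phi> h \<in> Z) \<Longrightarrow> Z = H"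
    and euler: "2 * card (vert ` H) + 2 * card (face ` H) = card H + 4"
begin

lemma turn_in: "h \<in> H \<Longrightarrow> \<phi> h \<in> H"
  using turn by (auto simp: bij_betw_def)

lemma vert_connected:
  assumes "C \<subseteq> vert ` H" "C \<noteq> {}" "\<And>h. h \<in> H \<Longrightarrow> vert h \<in> C \<Longrightarrow> vert (\<alpha> h) \<in> C"
  shows "C = vert ` H"
proof -
  have "{h \<in> H. vert h \<in> C} = H"
    by (rule connected) (use assms in \<open>auto simp: flip turn_in vert_turn\<close>)
  then show ?thesis using assms(1) by blast
qed

lemma face_connected:
  assumes "C \<subseteq> face ` H" "C \<noteq> {}" "\<And>h. h \<in> H \<Longrightarrow> face h \<in> C \<Longrightarrow> face (\<alpha> h) \<in> C"
  shows "C = face ` H"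
proof -
  have "{h \<in> H. face h \<in> C} = H"
    by (rule connected) (use assms in \<open>auto simp: flip turn_in face_turn\<close>)
  then show ?thesis using assms(1) by blast
qed

text \<open>Walking around a face, one enters a set of vertices as often as one leaves it.\<close>

lemma face_boundary_cut:
  assumes k: "k \<in> H" and "(vert k \<in> C) \<noteq> (vert (\<alpha> k) \<in> C)"
  obtains h where "h \<in> H" "face h = face k" "h \<noteq> k" "(vert h \<in> C) \<noteq> (vert (\<alpha> h) \<in> C)"
proof (rule ccontr)
  assume no: "\<not> thesis"
  define N where "N = {h \<in> H. face h = face k}"
  define ind :: "'h \<Rightarrow> int" where "ind h = of_bool (vert h \<in> C)" for h
  have finN: "finite N" and kN: "k \<in> N" using fin k by (auto simp: N_def)
  have "\<phi> ` N \<subseteq> N" by (auto simp: N_def turn_in face_turn)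
  moreover have inj: "inj_on \<phi> N" using turn by (auto simp: N_def bij_betw_def inj_on_def)
  ultimately have "\<phi> ` N = N" using finN by (simp add: endo_inj_surj)
  then have "(\<Sum>h\<in>N. ind (\<phi> h)) = sum ind N"
    using inj sum.reindex[of \<phi> N ind] by simp
  then have "(\<Sum>h\<in>N. ind (\<phi> h) - ind h) = 0" by (simp add: sum_subtractf)
  moreover have "(\<Sum>h\<in>N. ind (\<phi> h) - ind h) = ind (\<phi> k) - ind k + (\<Sum>h\<in>N - {k}. ind (\<phi> h) - ind h)"
    using finN kN by (simp add: sum.remove)
  moreover have "(\<Sum>h\<in>N - {k}. ind (\<phi> h) - ind h) = 0"
  proof (rule sum.neutral, rule ballI)
    fix h assume "h \<in> N - {k}"
    then have "(vert h \<in> C) = (vert (\<alpha> h) \<in> C)" using no that by (auto simp: N_def)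
    then show "ind (\<phi> h) - ind h = 0" using \<open>h \<in> N - {k}\<close> by (auto simp: ind_def N_def vert_turn)
  qed
  ultimately show False using assms by (auto simp: ind_def vert_turn split: if_splits)
qed

text \<open>
  A spanning tree of the dual graph determines the labels of the faces.  By Euler's formula, the
  remaining edges form a spanning tree of the graph, from which leaves can be peeled off.
\<close>

theorem potential_exists:
  fixes g :: "'h \<Rightarrow> 'r \<Rightarrow> 'r"
  assumes g: "\<And>h x. h \<in> H \<Longrightarrow> x \<in> R \<Longrightarrow> g h x \<in> R \<and> g (\<alpha> h) (g h x) = x"
    and v0: "v0 \<in> vert ` H" and h0: "h0 \<in> H" and x0: "x0 \<in> R"
    and vertex: "\<And>r h. h \<in> H \<Longrightarrow> vert h \<noteq> v0 \<Longrightarrow>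
      (\<And>k. k \<in> H \<Longrightarrow> r k \<in> R \<and> r (\<phi> k) = r k) \<Longrightarrow>
      (\<And>k. k \<in> H \<Longrightarrow> vert k = vert h \<Longrightarrow> k \<noteq> h \<Longrightarrow> r (\<alpha> k) = g k (r k)) \<Longrightarrow> r (\<alpha> h) = g h (r h)"
  obtains r where "r h0 = x0" "\<And>h. h \<in> H \<Longrightarrow> r h \<in> R \<and> r (\<phi> h) = r h \<and> r (\<alpha> h) = g h (r h)"
proof -
  let ?V = "vert ` H" and ?F = "face ` H" and ?f0 = "face h0"
  have f0: "?f0 \<in> ?F" using h0 by auto
  have "\<exists>(frank :: 'f \<Rightarrow> nat) fpar. \<forall>w\<in>?F. w \<noteq> ?f0 \<longrightarrow>
      fpar w \<in> H \<and> face (fpar w) = w \<and> frank (face (\<alpha> (fpar w))) < frank w"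
  proof (rule spanning_tree)
    fix C assume "C \<subseteq> ?F" "?f0 \<in> C" "\<And>h. h \<in> H \<Longrightarrow> face h \<in> C \<Longrightarrow> face (\<alpha> h) \<in> C"
    then show "C = ?F" by (intro face_connected) auto
  qed (use flip f0 in auto)
  then obtain frank :: "'f \<Rightarrow> nat" and fpar where
    fpar: "\<And>w. w \<in> ?F \<Longrightarrow> w \<noteq> ?f0 \<Longrightarrow>
      fpar w \<in> H \<and> face (fpar w) = w \<and> frank (face (\<alpha> (fpar w))) < frank w"
    by blast
  define T where "T = fpar ` (?F - {?f0}) \<union> \<alpha> ` fpar ` (?F - {?f0})"
  define B where "B = H - T"
  have T: "T \<subseteq> H" using fpar flip by (auto simp: T_def)
  have cT: "card T = 2 * (card ?F - 1)"
    unfolding T_def by (rule card_tree_darts[where B = H and vert = face and rank = frank])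
      (use fin f0 flip fpar in auto)
  have cF: "card ?F \<ge> 1" "card ?V \<ge> 1"
    using fin ne by (simp_all add: Suc_leI card_gt_0_iff)
  have cB: "card B = 2 * (card ?V - 1)"
    using cT T cF euler fin unfolding B_def by (subst card_Diff_subset) (auto intro: finite_subset)
  have Tflip: "\<alpha> h \<in> T" if "h \<in> T" for h
    using that fpar flip(2) by (auto simp: T_def)
  have Bflip: "\<alpha> h \<in> B" if "h \<in> B" for h
    using that Tflip[of "\<alpha> h"] flip by (auto simp: B_def)
  \<comment> \<open>Were \<open>C\<close> a proper subset closed under the remaining edges, all
    darts across its boundary would belong to the dual tree. In a face of largest rank among those
    containing such a dart, only the dart towards the parent face can be one, but the boundary of a
    face crosses that of \<open>C\<close> more than once.\<close>
  have Bconn: "C = ?V" if C: "C \<subseteq> ?V" "v0 \<in> C" and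
    cl: "\<And>h. h \<in> B \<Longrightarrow> vert h \<in> C \<Longrightarrow> vert (\<alpha> h) \<in> C" for C
  proof (rule ccontr)
    assume "C \<noteq> ?V"
    define X where "X = {h \<in> H. (vert h \<in> C) \<noteq> (vert (\<alpha> h) \<in> C)}"
    have "X \<noteq> {}"
      using vert_connected[of C] C \<open>C \<noteq> ?V\<close> unfolding X_def by blast
    have XT: "h \<in> T" if "h \<in> X" for h
    proof (rule ccontr)
      assume "h \<notin> T"
      then have "h \<in> B" "h \<in> H" using that by (auto simp: X_def B_def)
      then show False using that cl[of h] cl[of "\<alpha> h"] Bflip[of h] flip[of h] by (auto simp: X_def)
    qed
    have Xflip: "\<alpha> h \<in> X" if "h \<in> X" for h
      using that flip[of h] unfolding X_def by auto
    have "finite X" using fin by (auto simp: X_def)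
    let ?m = "Max ((\<lambda>h. frank (face h)) ` X)"
    have "?m \<in> (\<lambda>h. frank (face h)) ` X" using \<open>finite X\<close> \<open>X \<noteq> {}\<close> by (intro Max_in) auto
    then obtain k where k: "k \<in> X" "frank (face k) = ?m" by auto
    have max: "frank (face h) \<le> frank (face k)" if "h \<in> X" for h
      using that \<open>finite X\<close> unfolding k(2) by (intro Max_ge) auto
    have "h = fpar (face k)" if h: "h \<in> X" "face h = face k" for h
    proof -
      from XT[OF h(1)] consider f where "f \<in> ?F" "f \<noteq> ?f0" "h = fpar f"
        | f where "f \<in> ?F" "f \<noteq> ?f0" "h = \<alpha> (fpar f)" by (auto simp: T_def)
      then show ?thesis
      proof cases
        case 1 then show ?thesis using fpar h by metis
      next
        case 2
        then have "fpar f \<in> X" using Xflip[OF h(1)] fpar flip by metis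
        then have "frank f \<le> frank (face k)" using max fpar 2 by metis
        then show ?thesis using fpar 2 h by (metis not_less)
      qed
    qed
    moreover obtain h where "h \<in> H" "face h = face k" "h \<noteq> k" "(vert h \<in> C) \<noteq> (vert (\<alpha> h) \<in> C)"
      by (rule face_boundary_cut[of k C]) (use k in \<open>auto simp: X_def\<close>)
    moreover from this have "h \<in> X" by (simp add: X_def)
    ultimately show False using k(1) by metis
  qed
  have "\<exists>(rank :: 'v \<Rightarrow> nat) par. \<forall>w\<in>?V. w \<noteq> v0 \<longrightarrow>
      par w \<in> B \<and> vert (par w) = w \<and> rank (vert (\<alpha> (par w))) < rank w"
    by (rule spanning_tree[OF _ _ v0 Bconn]) (use flip Bflip in \<open>auto simp: B_def\<close>)
  then obtain rank :: "'v \<Rightarrow> nat" and par where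
    par: "\<And>w. w \<in> ?V \<Longrightarrow> w \<noteq> v0 \<Longrightarrow>
      par w \<in> B \<and> vert (par w) = w \<and> rank (vert (\<alpha> (par w))) < rank w"
    by blast
  let ?T' = "par ` (?V - {v0}) \<union> \<alpha> ` par ` (?V - {v0})"
  \<comment> \<open>By Euler's formula \<open>B\<close> has just as many darts as a spanning tree of
    the graph, so nothing else is left in it.\<close>
  have "?T' = B"
  proof (rule card_subset_eq)
    show "finite B" using fin by (simp add: B_def)
    show "?T' \<subseteq> B" using par Bflip by auto
    show "card ?T' = card B"
      unfolding cB by (rule card_tree_darts[where B = B and vert = vert and rank = rank])
        (use fin v0 par flip B_def in auto)
  qed
  then have Bcases: "\<exists>w\<in>?V - {v0}. h = par w \<or> h = \<alpha> (par w)" if "h \<in> B" for h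
    using that by blast
  \<comment> \<open>The label of a face is computed from that of its parent across the tree edge, by
    recursion on the rank.\<close>
  define \<rho> where "\<rho> = wfrec (measure frank)
    (\<lambda>\<rho> f. if f = ?f0 then x0 else g (\<alpha> (fpar f)) (\<rho> (face (\<alpha> (fpar f)))))"
  have \<rho>0: "\<rho> ?f0 = x0" unfolding \<rho>_def by (subst wfrec) auto
  have \<rho>: "\<rho> f = g (\<alpha> (fpar f)) (\<rho> (face (\<alpha> (fpar f))))" if "f \<in> ?F" "f \<noteq> ?f0" for f
    using that fpar[OF that] unfolding \<rho>_def by (subst wfrec) (auto simp: cut_apply)
  have \<rho>R: "\<rho> f \<in> R" if "f \<in> ?F" for f
    using that
  proof (induction "frank f" arbitrary: f rule: less_induct)
    case less
    show ?case
    proof (cases "f = ?f0")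
      case False
      then show ?thesis using less fpar[of f] g flip \<rho>[of f] by auto
    qed (simp add: \<rho>0 x0)
  qed
  define r where "r h = \<rho> (face h)" for h
  have r: "r h \<in> R \<and> r (\<phi> h) = r h" if "h \<in> H" for h
    using that by (simp add: r_def \<rho>R face_turn)
  have sym: "r (\<alpha> (\<alpha> h)) = g (\<alpha> h) (r (\<alpha> h))" if "h \<in> H" "r (\<alpha> h) = g h (r h)" for h
    using that g[of h "r h"] r[of h] flip by metis
  have goodT: "r (\<alpha> h) = g h (r h)" if "h \<in> T" for h
  proof -
    obtain f where f: "f \<in> ?F" "f \<noteq> ?f0" "h = fpar f \<or> h = \<alpha> (fpar f)"
      using \<open>h \<in> T\<close> by (auto simp: T_def)
    let ?k = "\<alpha> (fpar f)"
    have "r (\<alpha> ?k) = g ?k (r ?k)"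
      using \<rho>[OF f(1,2)] fpar[OF f(1,2)] flip by (simp add: r_def)
    then show ?thesis using f sym[of ?k] fpar[OF f(1,2)] flip by auto
  qed
  \<comment> \<open>Induction from the vertices of largest rank down. At \<open>w\<close>, every
    dart except the one to the parent either crosses the dual tree or leads to a child, so
    \<open>vertex\<close> settles the remaining one. The root has no parent edge, hence the
    exception at \<open>v0\<close>.\<close>
  have goodpar: "r (\<alpha> (par w)) = g (par w) (r (par w))" if "w \<in> ?V" "w \<noteq> v0" for w
    using that
  proof (induction "Max (rank ` ?V) - rank w" arbitrary: w rule: less_induct)
    case less
    note pw = par[OF less(2,3)]
    have pH: "par w \<in> H" using pw by (simp add: B_def)
    show ?case
    proof (rule vertex)
      fix k assume k: "k \<in> H" "vert k = vert (par w)" "k \<noteq> par w"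
      show "r (\<alpha> k) = g k (r k)"
      proof (cases "k \<in> T")
        case False
        then obtain u where u: "u \<in> ?V" "u \<noteq> v0" "k = par u \<or> k = \<alpha> (par u)"
          using Bcases[of k] k by (auto simp: B_def)
        have ku: "k = \<alpha> (par u)" using u k pw par[OF u(1,2)] by metis
        have "rank w < rank u" using par[OF u(1,2)] k pw ku by auto
        moreover have "rank u \<le> Max (rank ` ?V)" using u fin by auto
        ultimately have "r (\<alpha> (par u)) = g (par u) (r (par u))"
          by (intro less(1)) (use u in auto)
        then show ?thesis using ku sym par[OF u(1,2)] by (simp add: B_def)
      qed (rule goodT)
    qed (use pw pH less r in auto)
  qed
  have "r (\<alpha> h) = g h (r h)" if hH: "h \<in> H" for h
  proof (cases "h \<in> T")
    case False
    then obtain u where u: "u \<in> ?V" "u \<noteq> v0" "h = par u \<or> h = \<alpha> (par u)"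
      using Bcases[of h] hH by (auto simp: B_def)
    then show ?thesis using goodpar[OF u(1,2)] sym par[OF u(1,2)] by (auto simp: B_def)
  qed (rule goodT)
  then show thesis using that[of r] r \<rho>0 by (simp add: r_def)
qed

end


section \<open>Flat labellings of planar knot diagrams\<close>

text \<open>The diagram has a single component: for a permutation of a finite set, the forward
  closed sets are the unions of cycles. This form is the one that propagation of colours along the
  knot calls for.\<close>

definition circular :: "diagram \<Rightarrow> bool" where
  "circular D \<longleftrightarrow> (\<forall>Z\<subseteq>points D. Z \<noteq> {} \<longrightarrow> (\<forall>v\<in>Z. nxt D v \<in> Z) \<longrightarrow> Z = points D)"

lemma prv_simps:
  assumes "gauss_data D"
  shows "v \<in> points D \<Longrightarrow> prv D (nxt D v) = v" "v \<in> points D \<Longrightarrow> nxt D (prv D v) = v"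
    "v \<in> points D \<Longrightarrow> prv D v \<in> points D"
  using gauss_dataD(3)[OF assms] unfolding prv_def bij_betw_def
  by (auto simp: f_inv_into_f inv_into_into)

fun vertex_of :: "point \<Rightarrow> point" where
  "vertex_of (Over c) = Over c"
| "vertex_of (Under c) = Over c"
| "vertex_of (Mark m) = Mark m"

fun base_point :: "half_edge \<Rightarrow> point" where
  "base_point (Out v) = v"
| "base_point (In v) = v"

lemma half_edges_simps [simp]:
  "Out v \<in> half_edges D \<longleftrightarrow> v \<in> points D" "In v \<in> half_edges D \<longleftrightarrow> v \<in> points D"
  by (auto simp: half_edges_def)

lemma graph_pieces_circular:
  assumes "circular D" "gauss_data D"
  shows "card (graph_pieces D) = 1"
proof -
  define A where "A = {(v, nxt D v) |v. v \<in> points D} \<union> {(Over c, Under c) |c. c \<in> crossings D}"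
  have A: "A \<subseteq> points D \<times> points D"
    using gauss_dataD[OF assms(2)] by (auto simp: A_def)
  have "(A \<union> A\<inverse>)\<^sup>* `` {v} = points D" if v: "v \<in> points D" for v
  proof -
    let ?Z = "(A \<union> A\<inverse>)\<^sup>* `` {v}"
    have sub: "?Z \<subseteq> points D"
    proof
      fix w assume "w \<in> ?Z"
      then have "(v, w) \<in> (A \<union> A\<inverse>)\<^sup>*" by auto
      then show "w \<in> points D" by induction (use v A in auto)
    qed
    moreover have "nxt D w \<in> ?Z" if "w \<in> ?Z" for w
    proof -
      have "(w, nxt D w) \<in> A \<union> A\<inverse>" using that sub by (auto simp: A_def)
      then show ?thesis using that by (auto intro: rtrancl_into_rtrancl)
    qed
    ultimately show ?thesis using assms(1) unfolding circular_def by blast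
  qed
  then have "graph_pieces D = {points D}"
    using gauss_dataD(2)[OF assms(2)] unfolding graph_pieces_def A_def[symmetric] Let_def by auto
  then show ?thesis by simp
qed

section \<open>The combinatorial map of a knot diagram\<close>

lemma rotate_in:
  assumes "gauss_data D" "h \<in> half_edges D"
  shows "rotate D h \<in> half_edges D"
  using assms(2) gauss_dataD(6,7)[OF assms(1)] by (cases "(D, h)" rule: rotate.cases) auto

lemma inj_rotate: "inj_on (rotate D) S"
proof (rule inj_onI)
  fix h k assume "rotate D h = rotate D k"
  then show "h = k"
    by (cases "(D, h)" rule: rotate.cases; cases "(D, k)" rule: rotate.cases) (auto split: if_splits)
qed

lemma vertex_rotate: "vertex_of (base_point (rotate D h)) = vertex_of (base_point h)"
  by (cases "(D, h)" rule: rotate.cases) auto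

lemma other_end_simps:
  assumes "gauss_data D" "h \<in> half_edges D"
  shows "other_end D h \<in> half_edges D" "other_end D (other_end D h) = h"
  using assms(2) prv_simps[OF assms(1)] gauss_dataD(4)[OF assms(1)] by (cases h; auto)+

lemma orbit_step_eq:
  assumes "finite S" "bij_betw f S S" "x \<in> S"
  shows "orbit f (f x) = orbit f x"
proof
  show "orbit f (f x) \<subseteq> orbit f x"
  proof
    fix y assume "y \<in> orbit f (f x)"
    then show "y \<in> orbit f x" by induction (auto intro: orbit.intros)
  qed
  have sub: "orbit f (f x) \<subseteq> S"
  proof
    fix y assume "y \<in> orbit f (f x)"
    then show "y \<in> S" by induction (use assms in \<open>auto simp: bij_betw_def\<close>)
  qed
  have "f ` orbit f (f x) \<subseteq> orbit f (f x)" by (auto intro: orbit.step)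
  moreover have "inj_on f (orbit f (f x))"
    using assms(2) sub by (auto simp: bij_betw_def intro: inj_on_subset)
  ultimately have "f ` orbit f (f x) = orbit f (f x)"
    using sub assms(1) by (meson endo_inj_surj finite_subset)
  moreover have "f (f x) \<in> orbit f (f x)" by (rule orbit.base)
  ultimately obtain y where y: "y \<in> orbit f (f x)" "f y = f (f x)" by (metis imageE)
  have "y \<in> S" "f x \<in> S" using y sub assms by (auto simp: bij_betw_def)
  then have "y = f x" using y(2) assms(2) by (auto simp: bij_betw_def inj_on_def)
  then have fx: "f x \<in> orbit f (f x)" using y by simp
  show "orbit f x \<subseteq> orbit f (f x)"
  proof
    fix y assume "y \<in> orbit f x"
    then show "y \<in> orbit f (f x)" by induction (use fx in \<open>auto intro: orbit.step\<close>)
  qed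
qed

text \<open>With a single component the graph is connected, and planarity becomes Euler's formula
  for the sphere. Going to the other end and then turning counterclockwise keeps the face on the
  right of the half-edge.\<close>

lemma spherical_map_diagram:
  assumes D: "gauss_data D" and pl: "planar D" and circ: "circular D"
  shows "spherical_map (half_edges D) (other_end D) (\<lambda>h. rotate D (other_end D h))
    (\<lambda>h. vertex_of (base_point h)) (orbit (\<lambda>h. rotate D (other_end D h)))"
proof -
  let ?H = "half_edges D" and ?\<phi> = "\<lambda>h. rotate D (other_end D h)"
  note g = gauss_dataD[OF D] and oe = other_end_simps[OF D]
  have fin: "finite ?H" using g(1) by (simp add: half_edges_def)
  have inj: "inj_on (other_end D) ?H" using oe(2) by (intro inj_on_inverseI)
  have "inj_on ?\<phi> ?H"
    using comp_inj_on[OF inj inj_rotate] by (simp add: comp_def)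
  moreover have "?\<phi> ` ?H \<subseteq> ?H" using rotate_in[OF D] oe(1) by auto
  ultimately have turn: "bij_betw ?\<phi> ?H ?H" using fin by (simp add: bij_betw_def endo_inj_surj)
  have conn: "Z = ?H" if Z: "Z \<subseteq> ?H" "Z \<noteq> {}" and cl: "\<And>h. h \<in> Z \<Longrightarrow> other_end D h \<in> Z \<and> ?\<phi> h \<in> Z" for Z
  proof -
    have rot: "rotate D h \<in> Z" if "h \<in> Z" for h
      using cl[of "other_end D h"] cl[OF that] oe(2)[of h] that Z by auto
    \<comment> \<open>A strand leaves a crossing opposite to where it enters, two turns further on;
      at a mark one turn suffices.\<close>
    have turn_out: "Out v \<in> Z" if "In v \<in> Z" for v
      using rot[OF that] rot[OF rot[OF that]] by (cases v) (auto split: if_splits)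
    let ?P = "{v. Out v \<in> Z}"
    have "?P = points D"
    proof -
      have "?P \<subseteq> points D" using Z(1) by auto
      moreover have "nxt D v \<in> ?P" if "v \<in> ?P" for v
        using that cl[of "Out v"] turn_out by auto
      moreover have "?P \<noteq> {}"
      proof -
        obtain h where "h \<in> Z" using Z(2) by blast
        then show ?thesis using turn_out by (cases h) auto
      qed
      ultimately show ?thesis using circ unfolding circular_def by blast
    qed
    then have o: "Out v \<in> Z" if "v \<in> points D" for v using that by blast
    have "In v \<in> Z" if "v \<in> points D" for v
      using cl[OF o[OF prv_simps(3)[OF D that]]] prv_simps(2)[OF D that] by auto
    then show ?thesis using o Z(1) by (auto simp: half_edges_def)
  qed
  have V: "(\<lambda>h. vertex_of (base_point h)) ` ?H = points D - Under ` crossings D"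
  proof -
    have "(\<lambda>h. vertex_of (base_point h)) ` ?H = vertex_of ` points D"
      by (auto simp: half_edges_def image_Un image_image)
    also have "\<dots> = points D - Under ` crossings D"
    proof (intro equalityI subsetI)
      fix w assume "w \<in> vertex_of ` points D"
      then obtain v where "v \<in> points D" "w = vertex_of v" by blast
      then show "w \<in> points D - Under ` crossings D" using g(6,7) by (cases v) auto
    next
      fix w assume "w \<in> points D - Under ` crossings D"
      then have "w \<in> points D" "vertex_of w = w" using g(6) by (cases w; auto)+
      then show "w \<in> vertex_of ` points D" by (metis imageI)
    qed
    finally show ?thesis .
  qed
  have sub: "Under ` crossings D \<subseteq> points D" using g(6) by auto
  have cV: "card (points D - Under ` crossings D) + card (crossings D) = card (points D)"
  proof -
    have "card (Under ` crossings D) = card (crossings D)" by (simp add: card_image inj_on_def)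
    moreover have "card (Under ` crossings D) \<le> card (points D)" using sub g(1) by (rule card_mono[rotated])
    ultimately show ?thesis using sub g(1) by (simp add: card_Diff_subset finite_subset)
  qed
  have cH: "card ?H = 2 * card (points D)"
  proof -
    have "card ?H = card (Out ` points D) + card (In ` points D)"
      unfolding half_edges_def by (rule card_Un_disjoint) (use g(1) in auto)
    then show ?thesis by (simp add: card_image inj_on_def)
  qed
  have euler: "2 * card ((\<lambda>h. vertex_of (base_point h)) ` ?H) + 2 * card (orbit ?\<phi> ` ?H) = card ?H + 4"
    using pl graph_pieces_circular[OF circ D] cV cH unfolding V planar_def faces_def by simp
  show ?thesis
  proof (unfold_locales; (rule fin conn turn euler oe; assumption?)?)
    show "?H \<noteq> {}" using g(2) by (auto simp: half_edges_def)
    show "orbit ?\<phi> (?\<phi> h) = orbit ?\<phi> h" if "h \<in> ?H" for h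
      by (rule orbit_step_eq[OF fin turn that])
  qed (auto simp: vertex_rotate)
qed

text \<open>
  A labelling of the edges by permutations of \<open>R\<close> is flat at a point if the product of the labels
  around the vertex of that point, taken with signs, is trivial.
\<close>

definition crossing_flat :: "diagram \<Rightarrow> 'r set \<Rightarrow> (point \<Rightarrow> 'r \<Rightarrow> 'r) \<Rightarrow> nat \<Rightarrow> bool" where
  "crossing_flat D R act c \<longleftrightarrow> (if csign D c = 1
     then \<forall>x\<in>R. act (Under c) (act (Over c) x) = act (prv D (Over c)) (act (prv D (Under c)) x)
     else \<forall>x\<in>R. act (Over c) (act (Under c) x) = act (prv D (Under c)) (act (prv D (Over c)) x))"

definition flat :: "diagram \<Rightarrow> 'r set \<Rightarrow> (point \<Rightarrow> 'r \<Rightarrow> 'r) \<Rightarrow> point \<Rightarrow> bool" where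
  "flat D R act w \<longleftrightarrow> (case w of Over c \<Rightarrow> crossing_flat D R act c | Under c \<Rightarrow> crossing_flat D R act c
     | Mark m \<Rightarrow> \<forall>x\<in>R. act (Mark m) x = act (prv D (Mark m)) x)"

lemma flat_simps [simp]:
  "flat D R act (Over c) = crossing_flat D R act c"
  "flat D R act (Under c) = crossing_flat D R act c"
  "flat D R act (Mark m) \<longleftrightarrow> (\<forall>x\<in>R. act (Mark m) x = act (prv D (Mark m)) x)"
  by (simp_all add: flat_def)

text \<open>
  By \<open>spherical_map.potential_exists\<close>, the faces can be labelled by elements of \<open>R\<close> such that every
  edge acts as the passage from the face on its right to the one on its left.
\<close>

theorem flat_at_last_vertex:
  assumes D: "gauss_data D" and pl: "planar D" and circ: "circular D"
    and act: "\<And>v. v \<in> points D \<Longrightarrow> bij_betw (act v) R R"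
    and v0: "v0 \<in> points D"
    and flat: "\<And>w. w \<in> points D \<Longrightarrow> vertex_of w \<noteq> vertex_of v0 \<Longrightarrow> flat D R act w"
  shows "flat D R act v0"
proof -
  let ?H = "half_edges D" and ?\<phi> = "\<lambda>h. rotate D (other_end D h)"
  let ?vert = "\<lambda>h. vertex_of (base_point h)"
  note oe = other_end_simps[OF D] and pv = prv_simps[OF D] and gd = gauss_dataD[OF D]
  interpret spherical_map ?H "other_end D" ?\<phi> ?vert "orbit ?\<phi>"
    by (rule spherical_map_diagram[OF D pl circ])
  \<comment> \<open>An edge crossed in the opposite direction acts by the inverse
    permutation.\<close>
  define g where "g h = (case h of Out v \<Rightarrow> act v | In w \<Rightarrow> inv_into R (act (prv D w)))" for h
  have actR: "act v x \<in> R" and inv: "inv_into R (act v) (act v x) = x"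
    and inv': "act v (inv_into R (act v) x) = x" and invR: "inv_into R (act v) x \<in> R"
    if "v \<in> points D" "x \<in> R" for v x
    using act[OF that(1)] that(2) unfolding bij_betw_def
    by (auto simp: f_inv_into_f inv_into_into)
  have act_inj: "act v x = act v y \<longleftrightarrow> x = y" if "v \<in> points D" "x \<in> R" "y \<in> R" for v x y
    using inv that by metis
  have g: "g h x \<in> R \<and> g (other_end D h) (g h x) = x" if "h \<in> ?H" "x \<in> R" for h x
    using that actR invR inv inv' pv by (cases h) (auto simp: g_def)
  define labels where "labels r \<longleftrightarrow> (\<forall>k\<in>?H. r k \<in> R \<and> r (?\<phi> k) = r k)" for r
  define good where "good r k \<longleftrightarrow> r (other_end D k) = g k (r k)" for r k
  have lR: "r (Out v) \<in> R" "r (In v) \<in> R" if "labels r" "v \<in> points D" for r v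
    using that by (auto simp: labels_def)
  have corner: "r (other_end D k) = r (rotate D k)" if "labels r" "k \<in> ?H" for r k
    using that oe[of k] unfolding labels_def by metis
  have good_out: "good r (Out v) \<longleftrightarrow> r (rotate D (Out v)) = act v (r (Out v))"
    if "labels r" "v \<in> points D" for r v
    using corner[OF that(1), of "Out v"] that(2) by (simp add: good_def g_def del: other_end.simps)
  have good_in: "good r (In v) \<longleftrightarrow> act (prv D v) (r (rotate D (In v))) = r (In v)"
    if "labels r" "v \<in> points D" for r v
  proof -
    have "r (rotate D (In v)) \<in> R" using that rotate_in[OF D, of "In v"] by (simp add: labels_def)
    then show ?thesis
      using corner[OF that(1), of "In v"] that lR[OF that] pv(3)[OF that(2)]
        inv[of "prv D v" "r (rotate D (In v))"] inv'[of "prv D v" "r (In v)"]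
      by (auto simp: good_def g_def simp del: other_end.simps rotate.simps)
  qed
  \<comment> \<open>Four faces meet at a crossing, and each half-edge relates two neighbouring ones.
    The four conditions compare two ways from one face to the opposite one.\<close>
  have good_crossing:
    "csign D c = 1 \<Longrightarrow> good r (Out (Over c)) \<longleftrightarrow> r (Out (Under c)) = act (Over c) (r (Out (Over c)))"
    "csign D c = 1 \<Longrightarrow> good r (Out (Under c)) \<longleftrightarrow> r (In (Over c)) = act (Under c) (r (Out (Under c)))"
    "csign D c = 1 \<Longrightarrow> good r (In (Over c)) \<longleftrightarrow> r (In (Over c)) = act (prv D (Over c)) (r (In (Under c)))"
    "csign D c = 1 \<Longrightarrow> good r (In (Under c)) \<longleftrightarrow> r (In (Under c)) = act (prv D (Under c)) (r (Out (Over c)))"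
    "csign D c \<noteq> 1 \<Longrightarrow> good r (Out (Over c)) \<longleftrightarrow> r (In (Under c)) = act (Over c) (r (Out (Over c)))"
    "csign D c \<noteq> 1 \<Longrightarrow> good r (Out (Under c)) \<longleftrightarrow> r (Out (Over c)) = act (Under c) (r (Out (Under c)))"
    "csign D c \<noteq> 1 \<Longrightarrow> good r (In (Over c)) \<longleftrightarrow> r (In (Over c)) = act (prv D (Over c)) (r (Out (Under c)))"
    "csign D c \<noteq> 1 \<Longrightarrow> good r (In (Under c)) \<longleftrightarrow> r (In (Under c)) = act (prv D (Under c)) (r (In (Over c)))"
    if "labels r" "Over c \<in> points D" "Under c \<in> points D" for r c
    using good_out[OF that(1,2)] good_out[OF that(1,3)] good_in[OF that(1,2)] good_in[OF that(1,3)]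
    by auto
  have good_mark:
    "good r (Out (Mark m)) \<longleftrightarrow> r (In (Mark m)) = act (Mark m) (r (Out (Mark m)))"
    "good r (In (Mark m)) \<longleftrightarrow> r (In (Mark m)) = act (prv D (Mark m)) (r (Out (Mark m)))"
    if "labels r" "Mark m \<in> points D" for r m
    using good_out[OF that] good_in[OF that] by auto
  \<comment> \<open>Under flatness the two ways round the vertex agree, so all conditions but one
    imply the last; the labels act injectively, so it does not matter which one is missing.\<close>
  have vertex: "good r h" if h: "h \<in> ?H" and ne: "?vert h \<noteq> vertex_of v0" and r: "labels r"
    and others: "\<And>k. k \<in> ?H \<Longrightarrow> ?vert k = ?vert h \<Longrightarrow> k \<noteq> h \<Longrightarrow> good r k" for r h
  proof -
    have fl: "flat D R act (base_point h)" using flat ne h by (cases h) auto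
    consider m where "?vert h = Mark m" "base_point h = Mark m"
      | c where "?vert h = Over c" "base_point h = Over c \<or> base_point h = Under c"
      by (cases "base_point h") auto
    then show ?thesis
    proof cases
      case 1
      then have m: "Mark m \<in> points D" using h by (cases h) auto
      have "h = Out (Mark m) \<or> h = In (Mark m)" using 1 by (cases h) auto
      then show ?thesis
        using others[of "Out (Mark m)"] others[of "In (Mark m)"] m 1 fl lR[OF r m] good_mark[OF r m]
        by auto
    next
      case 2
      then have pts: "Over c \<in> points D" "Under c \<in> points D" using h gd(6,7) by (cases h; auto)+
      have pp: "prv D (Over c) \<in> points D" "prv D (Under c) \<in> points D" using pv(3) pts by auto
      note gc = good_crossing[OF r pts] and lr = lR[OF r pts(1)] lR[OF r pts(2)]
      have fl': "crossing_flat D R act c" using 2 fl by auto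
      have ot: "k \<noteq> h \<Longrightarrow> good r k"
        if "k \<in> {Out (Over c), Out (Under c), In (Over c), In (Under c)}" for k
        using others[of k] that 2 pts by auto
      have hc: "h \<in> {Out (Over c), Out (Under c), In (Over c), In (Under c)}" using 2 by (cases h) auto
      show ?thesis
      proof (cases "csign D c = 1")
        case True
        have f: "act (Under c) (act (Over c) (r (Out (Over c)))) =
            act (prv D (Over c)) (act (prv D (Under c)) (r (Out (Over c))))"
          using fl' True lr by (simp add: crossing_flat_def)
        have i: "act (Under c) (act (Over c) (r (Out (Over c)))) = act (Under c) (r (Out (Under c)))
            \<longleftrightarrow> act (Over c) (r (Out (Over c))) = r (Out (Under c))"
          "act (prv D (Over c)) (act (prv D (Under c)) (r (Out (Over c)))) = act (prv D (Over c)) (r (In (Under c)))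
            \<longleftrightarrow> act (prv D (Under c)) (r (Out (Over c))) = r (In (Under c))"
          using act_inj actR lr pts pp by auto
        from hc ot[of "Out (Over c)"] ot[of "Out (Under c)"] ot[of "In (Over c)"] ot[of "In (Under c)"]
        show ?thesis unfolding insert_iff empty_iff
          by (elim disjE; clarsimp simp: gc(1-4)[OF True]) (use f i in metis)+
      next
        case False
        have f: "act (Over c) (act (Under c) (r (Out (Under c)))) =
            act (prv D (Under c)) (act (prv D (Over c)) (r (Out (Under c))))"
          using fl' False lr by (simp add: crossing_flat_def)
        have i: "act (Over c) (act (Under c) (r (Out (Under c)))) = act (Over c) (r (Out (Over c)))
            \<longleftrightarrow> act (Under c) (r (Out (Under c))) = r (Out (Over c))"
          "act (prv D (Under c)) (act (prv D (Over c)) (r (Out (Under c)))) = act (prv D (Under c)) (r (In (Over c)))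
            \<longleftrightarrow> act (prv D (Over c)) (r (Out (Under c))) = r (In (Over c))"
          using act_inj actR lr pts pp by auto
        from hc ot[of "Out (Over c)"] ot[of "Out (Under c)"] ot[of "In (Over c)"] ot[of "In (Under c)"]
        show ?thesis unfolding insert_iff empty_iff
          by (elim disjE; clarsimp simp: gc(5-8)[OF False]) (use f i in metis)+
      qed
    qed
  qed
  have potential: "\<exists>r. labels r \<and> r h0 = x \<and> (\<forall>h\<in>?H. good r h)" if x: "x \<in> R" and h0: "h0 \<in> ?H" for x h0
  proof (rule potential_exists[where g = g and R = R and ?v0.0 = "vertex_of v0" and ?h0.0 = h0 and ?x0.0 = x])
    show "vertex_of v0 \<in> ?vert ` ?H" using v0 by (auto intro!: image_eqI[of _ _ "Out v0"])
    show "r (other_end D h) = g h (r h)"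
      if "h \<in> ?H" "?vert h \<noteq> vertex_of v0" "\<And>k. k \<in> ?H \<Longrightarrow> r k \<in> R \<and> r (?\<phi> k) = r k"
        "\<And>k. k \<in> ?H \<Longrightarrow> ?vert k = ?vert h \<Longrightarrow> k \<noteq> h \<Longrightarrow> r (other_end D k) = g k (r k)" for r h
      using vertex[of h r] that unfolding labels_def good_def by blast
    fix r assume "r h0 = x"
      "\<And>h. h \<in> ?H \<Longrightarrow> r h \<in> R \<and> r (?\<phi> h) = r h \<and> r (other_end D h) = g h (r h)"
    then show ?thesis unfolding labels_def good_def by blast
  qed (use g x h0 in auto)
  \<comment> \<open>Conversely, a potential with an arbitrary value \<open>x\<close> at one face can
    be followed both ways round the crossing. This gives flatness everywhere, also at
    \<open>v0\<close>.\<close>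
  have fl_crossing: "crossing_flat D R act c" if pts: "Over c \<in> points D" "Under c \<in> points D" for c
  proof (cases "csign D c = 1")
    case True
    have "act (Under c) (act (Over c) x) = act (prv D (Over c)) (act (prv D (Under c)) x)" if xR: "x \<in> R" for x
    proof -
      obtain r where r: "labels r" "r (Out (Over c)) = x" "\<forall>h\<in>?H. good r h"
        using potential[OF xR, of "Out (Over c)"] pts by auto
      show ?thesis
        using r(3)[rule_format, of "Out (Over c)"] r(3)[rule_format, of "Out (Under c)"]
          r(3)[rule_format, of "In (Over c)"] r(3)[rule_format, of "In (Under c)"] pts r(2)
          good_crossing(1-4)[OF r(1) pts True] by auto
    qed
    then show ?thesis using True by (simp add: crossing_flat_def)
  next
    case False
    have "act (Over c) (act (Under c) x) = act (prv D (Under c)) (act (prv D (Over c)) x)" if xR: "x \<in> R" for x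
    proof -
      obtain r where r: "labels r" "r (Out (Under c)) = x" "\<forall>h\<in>?H. good r h"
        using potential[OF xR, of "Out (Under c)"] pts by auto
      show ?thesis
        using r(3)[rule_format, of "Out (Over c)"] r(3)[rule_format, of "Out (Under c)"]
          r(3)[rule_format, of "In (Over c)"] r(3)[rule_format, of "In (Under c)"] pts r(2)
          good_crossing(5-8)[OF r(1) pts False] by auto
    qed
    then show ?thesis using False by (simp add: crossing_flat_def)
  qed
  show ?thesis
  proof (cases v0)
    case (Mark m)
    have m: "Mark m \<in> points D" using v0 Mark by simp
    have "act (Mark m) x = act (prv D (Mark m)) x" if xR: "x \<in> R" for x
    proof -
      obtain r where r: "labels r" "r (Out (Mark m)) = x" "\<forall>h\<in>?H. good r h"
        using potential[OF xR, of "Out (Mark m)"] m by auto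
      show ?thesis
        using r(3)[rule_format, of "Out (Mark m)"] r(3)[rule_format, of "In (Mark m)"] m r(2)
          good_mark[OF r(1) m] by auto
    qed
    then show ?thesis using Mark by simp
  next
    case (Over c)
    then show ?thesis using fl_crossing[of c] v0 gd(6,7) by auto
  next
    case (Under c)
    then show ?thesis using fl_crossing[of c] v0 gd(6,7) by auto
  qed
qed


section \<open>Fox colourings\<close>

definition dihedral :: "nat \<Rightarrow> int magma" where
  "dihedral p = \<lparr> qcarrier = {0..<int p}, qop = (\<lambda>x y. (2 * y - x) mod int p) \<rparr>"

lemma dihedral_simps [simp]:
  "qcarrier (dihedral p) = {0..<int p}" "qop (dihedral p) x y = (2 * y - x) mod int p"
  by (simp_all add: dihedral_def)

text \<open>Reflections are involutions, so a dihedral colouring satisfies the same condition at a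
  positive and at a negative crossing.\<close>

lemma mod_reflect: "x = (b - y) mod m \<longleftrightarrow> y = (b - x) mod m" if "x \<in> {0..<m}" "y \<in> {0..<m}" for m :: int
proof -
  have "x = (b - y) mod m \<longleftrightarrow> x mod m = (b - y) mod m" using that by simp
  also have "\<dots> \<longleftrightarrow> m dvd x - (b - y)" by (rule mod_eq_dvd_iff)
  also have "\<dots> \<longleftrightarrow> m dvd y - (b - x)" by (simp add: algebra_simps)
  also have "\<dots> \<longleftrightarrow> y mod m = (b - x) mod m" by (rule mod_eq_dvd_iff[symmetric])
  finally show ?thesis using that by simp
qed

lemma is_quandle_dihedral:
  assumes "p > 0"
  shows "is_quandle (dihedral p)"
proof -
  let ?p = "int p"
  have ex1: "\<exists>!z. z \<in> {0..<?p} \<and> x = (2 * y - z) mod ?p" if "x \<in> {0..<?p}" for x y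
  proof (rule ex1I[of _ "(2 * y - x) mod ?p"])
    show "(2 * y - x) mod ?p \<in> {0..<?p} \<and> x = (2 * y - (2 * y - x) mod ?p) mod ?p"
      using assms that by (simp add: mod_diff_right_eq)
  qed (use that mod_reflect[of x ?p] in auto)
  have dist: "(2 * z - (2 * y - x) mod ?p) mod ?p =
      (2 * ((2 * z - y) mod ?p) - (2 * z - x) mod ?p) mod ?p" for x y z
  proof -
    have "(2 * ((2 * z - y) mod ?p) - (2 * z - x) mod ?p) mod ?p = (2 * (2 * z - y) - (2 * z - x)) mod ?p"
      by (rule mod_diff_cong) (simp_all add: mod_mult_right_eq)
    also have "\<dots> = (2 * z - (2 * y - x)) mod ?p" by (simp add: algebra_simps)
    finally show ?thesis by (simp add: mod_diff_right_eq)
  qed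
  show ?thesis
    unfolding is_quandle_def dihedral_simps
    by (intro conjI ballI ex1 dist) (use assms in auto)
qed

text \<open>A column of the adjugate serves as the kernel vector modulo \<open>p\<close>. If
  \<open>p\<close> divided all entries of the adjugate, then
  \<open>det A * det (adj_mat A) = det A ^ m\<close> would make \<open>p ^ (m + 1)\<close> divide
  \<open>p ^ m\<close>.\<close>

lemma det_prime_kernel:
  fixes A :: "int mat"
  assumes A: "A \<in> carrier_mat m m" and det: "\<bar>det A\<bar> = int p" and p: "prime p"
  obtains x where "\<exists>j<m. \<not> int p dvd x j" "\<And>i. i < m \<Longrightarrow> int p dvd (\<Sum>j<m. A $$ (i, j) * x j)"
proof -
  let ?B = "adj_mat A" and ?p = "int p"
  note adj = adj_mat[OF A]
  have pd: "?p dvd det A" using det by (metis dvd_abs_iff dvd_refl)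
  have "\<exists>k<m. \<exists>j<m. \<not> ?p dvd ?B $$ (j, k)"
  proof (rule ccontr)
    assume no: "\<not> ?thesis"
    define C where "C = map_mat (\<lambda>a. a div ?p) ?B"
    have C: "C \<in> carrier_mat m m" using adj(1) by (simp add: C_def)
    have "?B = ?p \<cdot>\<^sub>m C"
      by (rule eq_matI) (use adj(1) no in \<open>auto simp: C_def\<close>)
    then have "det ?B = ?p ^ m * det C" using C by simp
    moreover have "det A * det ?B = det A ^ m"
      using det_mult[OF A adj(1)] adj(2) by simp
    ultimately have "\<bar>det A * (?p ^ m * det C)\<bar> = \<bar>det A ^ m\<bar>" by simp
    then have "?p * ?p ^ m * \<bar>det C\<bar> = ?p ^ m" using det by (simp add: abs_mult power_abs)
    moreover have "?p > 0" using prime_gt_0_nat[OF p] by simp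
    ultimately have "?p * \<bar>det C\<bar> = 1" by simp
    then have "?p = 1" using zmult_eq_1_iff[of ?p "\<bar>det C\<bar>"] by auto
    then show False using prime_gt_1_nat[OF p] by simp
  qed
  then obtain k j where k: "k < m" "j < m" "\<not> ?p dvd ?B $$ (j, k)" by blast
  have "?p dvd (\<Sum>l<m. A $$ (i, l) * ?B $$ (l, k))" if i: "i < m" for i
  proof -
    have "(A * ?B) $$ (i, k) = (\<Sum>l<m. A $$ (i, l) * ?B $$ (l, k))"
      using A adj(1) i k by (simp add: scalar_prod_def atLeast0LessThan)
    moreover have "(A * ?B) $$ (i, k) = det A * (if i = k then 1 else 0)"
      using i k by (simp add: adj(2))
    ultimately show ?thesis using pd by (metis dvd_mult2)
  qed
  then show thesis using that[of "\<lambda>l. ?B $$ (l, k)"] k by blast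
qed

section \<open>Arcs and the Alexander matrix at -1\<close>

lemma arc_of_eq:
  assumes "(u, v) \<in> {(u, nxt D u) |u. u \<in> points D \<and> (\<forall>c. nxt D u \<noteq> Under c)}"
  shows "arc_of D u = arc_of D v"
proof -
  let ?A = "{(u, nxt D u) |u. u \<in> points D \<and> (\<forall>c. nxt D u \<noteq> Under c)}"
  let ?E = "(?A \<union> ?A\<inverse>)\<^sup>*"
  have "(u, v) \<in> ?E" "(v, u) \<in> ?E" using assms by blast+
  then have "?E `` {u} = ?E `` {v}" by (auto intro: rtrancl_trans)
  then show ?thesis by (simp add: arc_of_def Let_def)
qed

lemma arc_of_nxt:
  "v \<in> points D \<Longrightarrow> \<forall>c. nxt D v \<noteq> Under c \<Longrightarrow> arc_of D (nxt D v) = arc_of D v"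
  by (rule arc_of_eq[symmetric]) auto

lemma mem_arc_of: "v \<in> arc_of D v"
  by (simp add: arc_of_def Let_def)

text \<open>An arc contains only one point of the form \<open>Under c\<close>, the one where it starts.\<close>

lemma inj_outgoing_arc:
  assumes D: "gauss_data D"
  shows "inj_on (outgoing_arc D) (crossings D)"
proof (rule inj_onI)
  fix c d assume c: "c \<in> crossings D" and d: "d \<in> crossings D"
    and eq: "outgoing_arc D c = outgoing_arc D d"
  let ?A = "{(u, nxt D u) |u. u \<in> points D \<and> (\<forall>c. nxt D u \<noteq> Under c)}"
  \<comment> \<open>The stretch from \<open>Under c\<close> up to the next under passage. It is
    closed under the steps that generate arcs, in both directions, and so contains the arc of
    \<open>Under c\<close>.\<close>
  define S where "S = {w \<in> points D. \<exists>i. w = (nxt D ^^ i) (Under c) \<and>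
    (\<forall>j\<in>{1..i}. \<forall>e. (nxt D ^^ j) (Under c) \<noteq> Under e)}"
  have iter: "(nxt D ^^ i) (Under c) \<in> points D" for i
    by (induction i) (use c gauss_dataD(4,6)[OF D] in auto)
  have only: "w = Under c" if w: "w \<in> S" "w = Under e" for w e
  proof -
    obtain i where i: "w = (nxt D ^^ i) (Under c)" "\<forall>j\<in>{1..i}. \<forall>e. (nxt D ^^ j) (Under c) \<noteq> Under e"
      using w unfolding S_def by blast
    then have "i = 0" using w(2) by (metis One_nat_def Suc_leI atLeastAtMost_iff gr0I le_refl)
    then show ?thesis using i by simp
  qed
  have step: "b \<in> S" if a: "a \<in> S" and ab: "(a, b) \<in> ?A \<union> ?A\<inverse>" for a b
  proof -
    obtain i where i: "a = (nxt D ^^ i) (Under c)" "\<forall>j\<in>{1..i}. \<forall>e. (nxt D ^^ j) (Under c) \<noteq> Under e"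
      using a unfolding S_def by blast
    from ab consider "(a, b) \<in> ?A" | "(b, a) \<in> ?A" by blast
    then show ?thesis
    proof cases
      case 1
      then have "b = (nxt D ^^ Suc i) (Under c)" "\<forall>e. b \<noteq> Under e" using i(1) by auto
      then have "\<forall>j\<in>{1..Suc i}. \<forall>e. (nxt D ^^ j) (Under c) \<noteq> Under e"
        using i(2) by (auto simp: le_Suc_eq)
      then show ?thesis using \<open>b = _\<close> iter unfolding S_def by blast
    next
      case 2
      then have b: "b \<in> points D" "nxt D b = a" "\<forall>e. a \<noteq> Under e" by auto
      then have "i \<noteq> 0" using i(1) by (metis funpow_0)
      then obtain k where k: "i = Suc k" using not0_implies_Suc by blast
      then have "nxt D b = nxt D ((nxt D ^^ k) (Under c))" using b i by simp
      then have "b = (nxt D ^^ k) (Under c)" using gauss_dataD(5)[OF D b(1) iter] by blast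
      then show ?thesis using i(2) k b(1) unfolding S_def by auto
    qed
  qed
  have "Under c \<in> S" using iter[of 0] by (auto simp: S_def intro: exI[of _ 0])
  have "w \<in> S" if "w \<in> outgoing_arc D c" for w
  proof -
    have "(Under c, w) \<in> (?A \<union> ?A\<inverse>)\<^sup>*" using that by (simp add: outgoing_arc_def arc_of_def Let_def)
    then show ?thesis by induction (use \<open>Under c \<in> S\<close> step in blast)+
  qed
  moreover have "Under d \<in> outgoing_arc D d" unfolding outgoing_arc_def by (rule mem_arc_of)
  then have "Under d \<in> outgoing_arc D c" by (simp only: eq)
  ultimately show "c = d" using only by blast
qed

text \<open>Ensures that there is an arc beyond the columns kept in the Alexander matrix. It
  receives the colour 0, against which another arc shows that the colouring is not constant.\<close>

lemma card_crossings_le_arcs: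
  assumes D: "gauss_data D"
  shows "card (crossings D) \<le> card (arcs D)"
proof (rule card_inj_on_le[OF inj_outgoing_arc[OF D]])
  show "outgoing_arc D ` crossings D \<subseteq> arcs D"
    using gauss_dataD(6)[OF D] by (auto simp: outgoing_arc_def arcs_def)
  show "finite (arcs D)" using gauss_dataD(1)[OF D] by (simp add: arcs_def)
qed

text \<open>
  The relation at the last crossing follows from those at the other ones: the reflections
  \<open>r \<mapsto> 2 f(v) - r\<close> of the integers modulo \<open>2p\<close> are flat there, and one can divide by 2.
\<close>

lemma fox_coloring_last_crossing:
  fixes f :: "point \<Rightarrow> int"
  assumes D: "gauss_data D" "planar D" "circular D" and p: "p > 0"
    and arc: "\<And>v. v \<in> points D \<Longrightarrow> \<forall>c. nxt D v \<noteq> Under c \<Longrightarrow> f (nxt D v) = f v"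
    and c0: "c0 \<in> crossings D"
    and fox: "\<And>c. c \<in> crossings D \<Longrightarrow> c \<noteq> c0 \<Longrightarrow> p dvd 2 * f (Over c) - f (prv D (Under c)) - f (Under c)"
  shows "p dvd 2 * f (Over c0) - f (prv D (Under c0)) - f (Under c0)"
proof -
  let ?R = "{0..<2 * p}"
  define act where "act v r = (2 * f v - r) mod (2 * p)" for v r
  note gd = gauss_dataD[OF D(1)] and pv = prv_simps[OF D(1)]
  have over: "f (prv D (Over c)) = f (Over c)" if "c \<in> crossings D" for c
    using arc[of "prv D (Over c)"] pv(2,3)[of "Over c"] that gd(7) by auto
  have act2: "act v (act w r) = (2 * f v - 2 * f w + r) mod (2 * p)" for v w r
    by (simp add: act_def mod_diff_right_eq algebra_simps)
  have iff: "crossing_flat D ?R act c \<longleftrightarrow> p dvd 2 * f (Over c) - f (prv D (Under c)) - f (Under c)"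
    if c: "c \<in> crossings D" for c
  proof -
    let ?y = "f (Over c)" and ?x = "f (prv D (Under c))" and ?z = "f (Under c)"
    have *: "(a + r) mod (2 * p) = (b + r) mod (2 * p) \<longleftrightarrow> 2 * p dvd a - b" for a b r
      by (simp add: mod_eq_dvd_iff)
    have ne: "0 \<in> ?R" using p by simp
    \<comment> \<open>Both sides of flatness are translations by twice a difference of colours. With
      the modulus \<open>2 * p\<close> the factor 2 cancels, whatever the parity of
      \<open>p\<close>.\<close>
    have "crossing_flat D ?R act c \<longleftrightarrow> 2 * p dvd 2 * (2 * ?y - ?x - ?z)"
    proof (cases "csign D c = 1")
      case True
      have "crossing_flat D ?R act c \<longleftrightarrow> 2 * p dvd (2 * ?z - 2 * ?y) - (2 * ?y - 2 * ?x)"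
        using True ne by (auto simp: crossing_flat_def act2 over[OF c] *)
      also have "(2 * ?z - 2 * ?y) - (2 * ?y - 2 * ?x) = - (2 * (2 * ?y - ?x - ?z))" by simp
      finally show ?thesis by (simp only: dvd_minus_iff)
    next
      case False
      have "crossing_flat D ?R act c \<longleftrightarrow> 2 * p dvd (2 * ?y - 2 * ?z) - (2 * ?x - 2 * ?y)"
        using False ne by (auto simp: crossing_flat_def act2 over[OF c] *)
      also have "(2 * ?y - 2 * ?z) - (2 * ?x - 2 * ?y) = 2 * (2 * ?y - ?x - ?z)" by simp
      finally show ?thesis .
    qed
    moreover have "2 * p dvd 2 * q \<longleftrightarrow> p dvd q" for q :: int by simp
    ultimately show ?thesis by (simp only:)
  qed
  have "flat D ?R act (Over c0)"
  proof (rule flat_at_last_vertex[OF D])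
    fix v
    have "act v (act v r) = r" if "r \<in> ?R" for r using that by (simp add: act2)
    moreover have "act v r \<in> ?R" for r using p by (simp add: act_def)
    ultimately show "bij_betw (act v) ?R ?R"
      by (intro bij_betw_byWitness[where f' = "act v"]) auto
  next
    show "Over c0 \<in> points D" using c0 gd(7) by simp
    fix w assume w: "w \<in> points D" "vertex_of w \<noteq> vertex_of (Over c0)"
    show "flat D ?R act w"
    proof (cases w)
      case (Mark m)
      then have "f (Mark m) = f (prv D (Mark m))"
        using arc[of "prv D (Mark m)"] pv(2,3)[of "Mark m"] w by auto
      then show ?thesis using Mark by (simp add: act_def)
    next
      case (Over c)
      then show ?thesis using w gd(7) iff fox by auto
    next
      case (Under c)
      then show ?thesis using w gd(6) iff fox by auto
    qed
  qed
  then show ?thesis using iff[OF c0] by simp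
qed

text \<open>At -1 the rows of positive and negative crossings take the same form, the Fox relation
  \<open>2 y - x - z\<close>.\<close>

lemma alexander_entry_minus_one:
  "poly (alexander_entry D c a) (-1) = (if a = over_arc D c then 2 else 0)
     - (if a = incoming_arc D c then 1 else 0) - (if a = outgoing_arc D c then 1 else 0)"
  by (simp add: alexander_entry_def poly_monom)

text \<open>A kernel vector modulo \<open>p\<close> of the reduced matrix colours the arcs subject
  to all crossings but the one whose row was deleted; planarity supplies that one.\<close>

theorem fox_coloring_exists:
  assumes D: "gauss_data D" "planar D" "circular D"
    and \<Delta>: "alexander_polynomial D \<Delta>" and p: "prime p" "\<bar>poly \<Delta> (-1)\<bar> = int p"
  obtains f v w where "coloring (dihedral p) D f" "v \<in> points D" "w \<in> points D" "f v \<noteq> f w"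
proof -
  note gd = gauss_dataD[OF D(1)] and pv = prv_simps[OF D(1)]
  let ?p = "int p"
  have p0: "?p > 0" using p(1) prime_gt_0_nat by simp
  obtain cs as where cs: "distinct cs" "set cs = crossings D" and as: "distinct as" "set as = arcs D"
    and det: "\<Delta> = det (mat (card (crossings D) - 1) (card (crossings D) - 1)
      (\<lambda>(i, j). alexander_entry D (cs ! i) (as ! j)))"
    using \<Delta> unfolding alexander_polynomial_def Let_def by blast
  define m where "m = card (crossings D) - 1"
  let ?M = "mat m m (\<lambda>(i, j). alexander_entry D (cs ! i) (as ! j))"
  interpret ev: comm_ring_hom "\<lambda>q :: int poly. poly q (-1)"
    by unfold_locales auto
  let ?A = "map_mat (\<lambda>q. poly q (-1)) ?M"
  have dA: "\<bar>det ?A\<bar> = ?p" using p(2) det by (simp add: m_def)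
  have Ac: "?A \<in> carrier_mat m m" by simp
  obtain x where x: "\<exists>j<m. \<not> ?p dvd x j"
    "\<And>i. i < m \<Longrightarrow> ?p dvd (\<Sum>j<m. ?A $$ (i, j) * x j)"
    using det_prime_kernel[OF Ac dA p(1)] by blast
  have n: "length cs = card (crossings D)" using cs distinct_card by fastforce
  have m: "m < length cs" using x(1) n by (auto simp: m_def)
  have la: "m < length as"
    using card_crossings_le_arcs[OF D(1)] as distinct_card[OF as(1)] m n by simp
  \<comment> \<open>Arcs without a column get 0, so the sums over the \<open>m\<close> columns are
    the complete crossing relations.\<close>
  define val where "val a = (\<Sum>j<m. if as ! j = a then x j else 0)" for a
  have val: "val (as ! j) = (if j < m then x j else 0)" if "j \<le> m" for j
  proof -
    have "val (as ! j) = (\<Sum>l<m. if l = j then x l else 0)"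
      unfolding val_def using as(1) la that by (intro sum.cong) (auto simp: nth_eq_iff_index_eq)
    then show ?thesis by simp
  qed
  define f where "f v = val (arc_of D v) mod ?p" for v
  have arc: "f (nxt D v) = f v" if "v \<in> points D" "\<forall>c. nxt D v \<noteq> Under c" for v
    using arc_of_nxt[OF that] by (simp add: f_def)
  have fox': "?p dvd 2 * f (Over (cs ! i)) - f (prv D (Under (cs ! i))) - f (Under (cs ! i))" if i: "i < m" for i
  proof -
    let ?c = "cs ! i"
    have "(\<Sum>j<m. ?A $$ (i, j) * x j) =
      2 * val (over_arc D ?c) - val (incoming_arc D ?c) - val (outgoing_arc D ?c)"
      using i unfolding val_def sum_distrib_left sum_subtractf[symmetric]
      by (intro sum.cong) (auto simp: alexander_entry_minus_one)
    then have "?p dvd 2 * val (over_arc D ?c) - val (incoming_arc D ?c) - val (outgoing_arc D ?c)"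
      using x(2)[OF i] by simp
    moreover have "(2 * f (Over ?c) - f (prv D (Under ?c)) - f (Under ?c)) mod ?p =
      (2 * val (over_arc D ?c) - val (incoming_arc D ?c) - val (outgoing_arc D ?c)) mod ?p"
      unfolding f_def over_arc_def incoming_arc_def outgoing_arc_def
      by (intro mod_diff_cong) (simp_all add: mod_mult_right_eq)
    ultimately show ?thesis by (simp only: dvd_eq_mod_eq_0)
  qed
  have c0: "cs ! m \<in> crossings D" using nth_mem[OF m] unfolding cs(2) .
  have fox'': "?p dvd 2 * f (Over c) - f (prv D (Under c)) - f (Under c)"
    if c: "c \<in> crossings D" "c \<noteq> cs ! m" for c
  proof -
    obtain i where "i < length cs" "c = cs ! i" using c cs by (metis in_set_conv_nth)
    moreover from this have "i < m" using c n by (cases "i = m") (auto simp: m_def)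
    ultimately show ?thesis using fox' by blast
  qed
  have fox: "?p dvd 2 * f (Over c) - f (prv D (Under c)) - f (Under c)" if "c \<in> crossings D" for c
    using fox_coloring_last_crossing[OF D p0 arc c0 fox''] fox'' that by blast
  have fR: "f v \<in> {0..<?p}" for v using p0 by (simp add: f_def)
  have "coloring (dihedral p) D f"
    unfolding coloring_def
  proof (intro ballI conjI)
    fix v assume v: "v \<in> points D"
    show "f v \<in> qcarrier (dihedral p)" using fR by simp
    show "passes (dihedral p) D f (f v) (nxt D v)"
    proof (cases "nxt D v")
      case (Under c)
      have c: "c \<in> crossings D" using gd(4)[OF v] gd(6) Under by simp
      have "prv D (Under c) = v" using pv(1)[OF v] Under by simp
      then have "?p dvd f (Under c) - (2 * f (Over c) - f v)"
        using fox[OF c] by (metis diff_diff_eq2 dvd_minus_iff minus_diff_eq)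
      then have "f (Under c) mod ?p = (2 * f (Over c) - f v) mod ?p" by (simp add: mod_eq_dvd_iff)
      then have "f (Under c) = (2 * f (Over c) - f v) mod ?p" using fR[of "Under c"] by simp
      then show ?thesis
        using mod_reflect[OF fR[of "Under c"] fR[of v], of "2 * f (Over c)"] Under
        by (simp add: under_rule_def)
    qed (use arc[OF v] in auto)
  qed
  moreover obtain j where j: "j < m" "\<not> ?p dvd x j" using x(1) by blast
  moreover obtain v where "v \<in> points D" "as ! j = arc_of D v"
    using as j la by (metis arcs_def imageE nth_mem order.strict_trans)
  moreover obtain w where "w \<in> points D" "as ! m = arc_of D w"
    using as la by (metis arcs_def imageE nth_mem)
  moreover have "f v \<noteq> f w"
    using val[of j] val[of m] j calculation by (auto simp: f_def)
  ultimately show thesis using that by blast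
qed


section \<open>The universal colouring\<close>

text \<open>The record stores one operation only, so \<open>InvOp\<close> is evaluated as the unique
  solution \<open>z\<close> of \<open>x = z * y\<close>.\<close>

fun qeval :: "('a, 'm) magma_scheme \<Rightarrow> ('g \<Rightarrow> 'a) \<Rightarrow> 'g qterm \<Rightarrow> 'a" where
  "qeval X g (Gen a) = g a"
| "qeval X g (Op s t) = qop X (qeval X g s) (qeval X g t)"
| "qeval X g (InvOp s t) = (THE z. z \<in> qcarrier X \<and> qeval X g s = qop X z (qeval X g t))"

lemma qdiv_eqI:
  assumes X: "is_quandle X" and "z \<in> qcarrier X" "y \<in> qcarrier X"
  shows "(THE z'. z' \<in> qcarrier X \<and> qop X z y = qop X z' y) = z"
  by (rule the_equality) (use assms qop_cancel[OF X] in auto)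

lemma qdiv_props:
  assumes X: "is_quandle X" and xy: "x \<in> qcarrier X" "y \<in> qcarrier X"
  shows "(THE z. z \<in> qcarrier X \<and> x = qop X z y) \<in> qcarrier X"
    "qop X (THE z. z \<in> qcarrier X \<and> x = qop X z y) y = x"
proof -
  obtain z where z: "z \<in> qcarrier X" "x = qop X z y" using qop_ex[OF X xy] by blast
  have "(THE z. z \<in> qcarrier X \<and> x = qop X z y) = z"
    unfolding z(2) by (rule qdiv_eqI[OF X z(1) xy(2)])
  then show "(THE z. z \<in> qcarrier X \<and> x = qop X z y) \<in> qcarrier X"
    "qop X (THE z. z \<in> qcarrier X \<and> x = qop X z y) y = x"
    using z by auto
qed

lemma qeval_closed:
  assumes X: "is_quandle X" and "g ` G \<subseteq> qcarrier X" "t \<in> qterms G"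
  shows "qeval X g t \<in> qcarrier X"
  using assms(3) by (induction t) (use assms(2) qop_closed[OF X] qdiv_props[OF X] in auto)

lemma qcong_qeval:
  assumes X: "is_quandle X" and g: "g ` G \<subseteq> qcarrier X"
    and R: "\<And>s t. (s, t) \<in> R \<Longrightarrow> s \<in> qterms G \<Longrightarrow> t \<in> qterms G \<Longrightarrow> qeval X g s = qeval X g t"
    and st: "qcong G R s t"
  shows "qeval X g s = qeval X g t"
  using st
proof induction
  case (qc_rel s t)
  then show ?case using R by blast
next
  case (qc_idem t)
  then show ?case using qop_idem[OF X] qeval_closed[OF X g] by simp
next
  case (qc_right s t)
  then show ?case using qdiv_props[OF X] qeval_closed[OF X g] by simp
next
  case (qc_left s t)
  then show ?case using qdiv_eqI[OF X] qeval_closed[OF X g] by simp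
next
  case (qc_dist s t u)
  have "qop X (qop X (qeval X g s) (qeval X g t)) (qeval X g u) =
      qop X (qop X (qeval X g s) (qeval X g u)) (qop X (qeval X g t) (qeval X g u))"
    by (rule qop_dist[OF X]) (use qc_dist qeval_closed[OF X g] in auto)
  then show ?case by (simp only: qeval.simps)
qed auto

definition qclass :: "'g set \<Rightarrow> ('g qterm \<times> 'g qterm) set \<Rightarrow> 'g qterm \<Rightarrow> 'g qterm set" where
  "qclass G R s = {(s, t). qcong G R s t} `` {s}"

lemma qclass_eq_iff:
  assumes "s \<in> qterms G" "t \<in> qterms G"
  shows "qclass G R s = qclass G R t \<longleftrightarrow> qcong G R s t"
  using eq_equiv_class_iff[OF equiv_qcong assms, of R] by (simp add: qclass_def)

lemma qcarrier_presented_quandle: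
  "qcarrier (presented_quandle G R) = qclass G R ` qterms G"
  by (auto simp: presented_quandle_def quotient_def qclass_def)

lemma qop_presented_quandle:
  assumes "s \<in> qterms G" "t \<in> qterms G"
  shows "qop (presented_quandle G R) (qclass G R s) (qclass G R t) = qclass G R (Op s t)"
  using assms by (auto simp: presented_quandle_def qclass_def intro: qc_refl) (meson qc_op qc_trans)

lemma presented_quandle_hom:
  assumes X: "is_quandle X" and g: "g ` G \<subseteq> qcarrier X"
    and R: "\<And>s t. (s, t) \<in> R \<Longrightarrow> s \<in> qterms G \<Longrightarrow> t \<in> qterms G \<Longrightarrow> qeval X g s = qeval X g t"
  obtains \<phi> where "hom (presented_quandle G R) X \<phi>" "\<And>a. a \<in> G \<Longrightarrow> \<phi> (qclass G R (Gen a)) = g a"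
proof
  define \<phi> where "\<phi> C = qeval X g (SOME t. t \<in> C)" for C
  have \<phi>: "\<phi> (qclass G R s) = qeval X g s" if "s \<in> qterms G" for s
  proof -
    have "s \<in> qclass G R s" using that by (simp add: qclass_def qc_refl)
    then have "(SOME t. t \<in> qclass G R s) \<in> qclass G R s" by (rule someI)
    then have "qcong G R s (SOME t. t \<in> qclass G R s)" by (simp add: qclass_def)
    then show ?thesis unfolding \<phi>_def using qcong_qeval[OF X g R] by metis
  qed
  show "hom (presented_quandle G R) X \<phi>"
    unfolding hom_def qcarrier_presented_quandle
    using \<phi> qeval_closed[OF X g] by (auto simp: qop_presented_quandle)
  show "\<phi> (qclass G R (Gen a)) = g a" if "a \<in> G" for a using \<phi>[of "Gen a"] that by simp
qed

definition universal_coloring :: "diagram \<Rightarrow> point \<Rightarrow> point set qterm set" where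
  "universal_coloring D v = qclass (arcs D) (crossing_relation D ` crossings D) (Gen (arc_of D v))"

lemma crossing_arcs:
  assumes D: "gauss_data D" and c: "c \<in> crossings D"
  shows "incoming_arc D c \<in> arcs D" "over_arc D c \<in> arcs D" "outgoing_arc D c \<in> arcs D"
  using gauss_dataD(6,7)[OF D] prv_simps(3)[OF D] c
  by (auto simp: arcs_def incoming_arc_def over_arc_def outgoing_arc_def)

lemma coloring_universal:
  assumes D: "gauss_data D"
  shows "coloring (link_quandle D) D (universal_coloring D)"
  unfolding coloring_def
proof (intro ballI conjI)
  let ?G = "arcs D" and ?R = "crossing_relation D ` crossings D"
  fix v assume v: "v \<in> points D"
  have mem: "arc_of D w \<in> ?G" if "w \<in> points D" for w using that by (simp add: arcs_def)
  show "universal_coloring D v \<in> qcarrier (link_quandle D)"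
    using mem[OF v] by (simp add: link_quandle_def qcarrier_presented_quandle universal_coloring_def)
  show "passes (link_quandle D) D (universal_coloring D) (universal_coloring D v) (nxt D v)"
  proof (cases "nxt D v")
    case (Under c)
    have c: "c \<in> crossings D" using gauss_dataD(4)[OF D v] gauss_dataD(6)[OF D] Under by simp
    let ?x = "Gen (incoming_arc D c)" and ?y = "Gen (over_arc D c)" and ?z = "Gen (outgoing_arc D c)"
    have x: "incoming_arc D c = arc_of D v" using prv_simps(1)[OF D v] Under by (simp add: incoming_arc_def)
    note arcs = crossing_arcs[OF D c]
    have q: "?x \<in> qterms ?G" "?y \<in> qterms ?G" "?z \<in> qterms ?G" using arcs by simp_all
    have r: "qcong ?G ?R ?z (if csign D c = 1 then Op ?x ?y else InvOp ?x ?y)"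
    proof (rule qc_rel)
      show "(?z, if csign D c = 1 then Op ?x ?y else InvOp ?x ?y) \<in> ?R"
        using c by (auto simp: crossing_relation_def Let_def intro!: rev_image_eqI[OF c])
    qed (use q in auto)
    have "under_rule (link_quandle D) (csign D c) (qclass ?G ?R ?x) (qclass ?G ?R ?y) (qclass ?G ?R ?z)"
    proof (cases "csign D c = 1")
      case True
      then show ?thesis using r q
        by (simp add: under_rule_def link_quandle_def qop_presented_quandle qclass_eq_iff)
    next
      case False
      then have "qcong ?G ?R ?z (InvOp ?x ?y)" using r by simp
      then have "qcong ?G ?R (Op ?z ?y) (Op (InvOp ?x ?y) ?y)"
        by (rule qc_op) (rule qc_refl[OF q(2)])
      then have "qcong ?G ?R ?x (Op ?z ?y)" using q by (meson qc_right qc_sym qc_trans)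
      then show ?thesis using False q
        by (simp add: under_rule_def link_quandle_def qop_presented_quandle qclass_eq_iff)
    qed
    then show ?thesis
      unfolding Under passes_simps universal_coloring_def x over_arc_def outgoing_arc_def .
  qed (use arc_of_nxt[OF v] in \<open>auto simp: universal_coloring_def\<close>)
qed

lemma coloring_arc:
  assumes "coloring X D f" "arc_of D v = arc_of D w"
  shows "f v = f w"
proof -
  define A where "A = {(u, nxt D u) |u. u \<in> points D \<and> (\<forall>c. nxt D u \<noteq> Under c)}"
  have arc_step: "f a = f b" if "(a, b) \<in> A" for a b
  proof -
    have b: "a \<in> points D" "b = nxt D a" "\<forall>c. b \<noteq> Under c" using that by (auto simp: A_def)
    then have "passes X D f (f a) b" using assms(1) by (auto simp: coloring_def)
    then show ?thesis using b(3) by (cases b) auto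
  qed
  have "w \<in> arc_of D v" unfolding assms(2) by (rule mem_arc_of)
  then have "(v, w) \<in> (A \<union> A\<inverse>)\<^sup>*" by (simp add: arc_of_def Let_def A_def)
  then show ?thesis
  proof induction
    case (step y z)
    have "f y = f z" using step(2) arc_step[of y z] arc_step[of z y] by auto
    then show ?case using step(3) by simp
  qed simp
qed

text \<open>Colours are constant along arcs and hence descend to the generators. The rules at the
  under passages are then the defining relations, so evaluation of terms induces the
  homomorphism.\<close>

theorem universal_coloring_factor:
  assumes D: "gauss_data D" and X: "is_quandle X" and f: "coloring X D f"
  obtains \<phi> where "hom (link_quandle D) X \<phi>" "\<And>v. v \<in> points D \<Longrightarrow> \<phi> (universal_coloring D v) = f v"
proof -
  let ?G = "arcs D" and ?R = "crossing_relation D ` crossings D"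
  define g where "g a = f (SOME v. v \<in> points D \<and> arc_of D v = a)" for a
  have g: "g (arc_of D v) = f v" if "v \<in> points D" for v
  proof -
    have "arc_of D (SOME w. w \<in> points D \<and> arc_of D w = arc_of D v) = arc_of D v"
      using someI[of "\<lambda>w. w \<in> points D \<and> arc_of D w = arc_of D v" v] that by blast
    then show ?thesis unfolding g_def by (rule coloring_arc[OF f])
  qed
  have fX: "f v \<in> qcarrier X" if "v \<in> points D" for v using f that by (simp add: coloring_def)
  have gG: "g ` ?G \<subseteq> qcarrier X" using g fX by (auto simp: arcs_def)
  obtain \<phi> where \<phi>: "hom (presented_quandle ?G ?R) X \<phi>" "\<And>a. a \<in> ?G \<Longrightarrow> \<phi> (qclass ?G ?R (Gen a)) = g a"
  proof (rule presented_quandle_hom[OF X gG])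
    fix s t assume "(s, t) \<in> ?R"
    then obtain c where c: "c \<in> crossings D" "(s, t) = crossing_relation D c" by auto
    define u where "u = prv D (Under c)"
    have pts: "u \<in> points D" "nxt D u = Under c" "Under c \<in> points D" "Over c \<in> points D"
      using gauss_dataD(6,7)[OF D] prv_simps[OF D] c by (auto simp: u_def)
    have "passes X D f (f u) (nxt D u)" using f pts(1) unfolding coloring_def by blast
    then have rule: "under_rule X (csign D c) (f u) (f (Over c)) (f (Under c))" using pts by simp
    have e: "g (incoming_arc D c) = f u" "g (over_arc D c) = f (Over c)" "g (outgoing_arc D c) = f (Under c)"
      using g pts by (auto simp: incoming_arc_def over_arc_def outgoing_arc_def u_def)
    have "qeval X g s = f (Under c)" using c(2) e by (simp add: crossing_relation_def Let_def)
    moreover have "qeval X g t = f (Under c)"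
    proof (cases "csign D c = 1")
      case True
      then show ?thesis using c(2) e rule by (simp add: crossing_relation_def Let_def under_rule_def)
    next
      case False
      then show ?thesis using c(2) e rule qdiv_eqI[OF X fX[OF pts(3)] fX[OF pts(4)]]
        by (simp add: crossing_relation_def Let_def under_rule_def)
    qed
    ultimately show "qeval X g s = qeval X g t" by simp
  qed blast
  have "\<phi> (universal_coloring D v) = f v" if "v \<in> points D" for v
    using \<phi>(2)[of "arc_of D v"] g[OF that] that by (simp add: universal_coloring_def arcs_def)
  then show thesis using that \<phi>(1) by (simp add: link_quandle_def)
qed


section \<open>Bi-ordered quandles\<close>

text \<open>Left multiplication by \<open>r\<close> is strictly increasing, hence injective. So a
  single value of a right translation already determines the element that acts.\<close>

lemma bi_ordered_faithful:
  assumes Y: "bi_orderable Y" and "r \<in> qcarrier Y" "a \<in> qcarrier Y" "b \<in> qcarrier Y"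
    and eq: "qop Y r a = qop Y r b" and Q: "is_quandle Y"
  shows "a = b"
proof (rule ccontr)
  obtain lt where lt: "\<forall>x\<in>qcarrier Y. \<not> lt x x"
    "\<forall>x\<in>qcarrier Y. \<forall>y\<in>qcarrier Y. x \<noteq> y \<longrightarrow> lt x y \<or> lt y x"
    "\<forall>x\<in>qcarrier Y. \<forall>y\<in>qcarrier Y. \<forall>z\<in>qcarrier Y. lt x y \<longrightarrow> lt (qop Y x z) (qop Y y z) \<and> lt (qop Y z x) (qop Y z y)"
    using Y unfolding bi_orderable_def by blast
  assume "a \<noteq> b"
  then have "lt (qop Y r a) (qop Y r b) \<or> lt (qop Y r b) (qop Y r a)" using lt(2,3) assms(2-4) by blast
  then show False using eq lt(1) qop_closed[OF Q assms(2,3)] by auto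
qed

text \<open>For \<open>x < y\<close>, multiplying by \<open>y\<close> from the right gives
  \<open>x * y < y * y = y\<close>; for \<open>y < x\<close>, multiplying by \<open>x\<close> from
  the left gives \<open>x * y < x * x = x\<close>. So a product of distinct elements is never the
  largest element of \<open>S\<close>.\<close>

lemma bi_ordered_finite_max:
  assumes Y: "bi_orderable Y" and Q: "is_quandle Y" and S: "finite S" "S \<noteq> {}" "S \<subseteq> qcarrier Y"
  obtains m where "m \<in> S" "\<And>x y. x \<in> S \<Longrightarrow> y \<in> S \<Longrightarrow> qop Y x y = m \<Longrightarrow> x = m"
proof -
  obtain lt where irr: "\<forall>x\<in>qcarrier Y. \<not> lt x x"
    and tr: "\<forall>x\<in>qcarrier Y. \<forall>y\<in>qcarrier Y. \<forall>z\<in>qcarrier Y. lt x y \<longrightarrow> lt y z \<longrightarrow> lt x z"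
    and tot: "\<forall>x\<in>qcarrier Y. \<forall>y\<in>qcarrier Y. x \<noteq> y \<longrightarrow> lt x y \<or> lt y x"
    and mono: "\<forall>x\<in>qcarrier Y. \<forall>y\<in>qcarrier Y. \<forall>z\<in>qcarrier Y.
        lt x y \<longrightarrow> lt (qop Y x z) (qop Y y z) \<and> lt (qop Y z x) (qop Y z y)"
    using Y unfolding bi_orderable_def by blast
  have "\<exists>m\<in>S. \<forall>x\<in>S. x \<noteq> m \<longrightarrow> lt x m" using S
  proof (induction S rule: finite_ne_induct)
    case (insert a F)
    then obtain m where m: "m \<in> F" "\<forall>x\<in>F. x \<noteq> m \<longrightarrow> lt x m" by auto
    have car: "a \<in> qcarrier Y" "m \<in> qcarrier Y" "F \<subseteq> qcarrier Y" using insert m by auto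
    show ?case
    proof (cases "lt m a")
      case True
      then have "\<forall>x\<in>insert a F. x \<noteq> a \<longrightarrow> lt x a" using m tr car by (metis insert_iff subsetD)
      then show ?thesis by blast
    next
      case False
      then have "a \<noteq> m \<longrightarrow> lt a m" using tot car by blast
      then show ?thesis using m by blast
    qed
  qed simp
  then obtain m where m: "m \<in> S" "\<forall>x\<in>S. x \<noteq> m \<longrightarrow> lt x m" by blast
  have "x = m" if xy: "x \<in> S" "y \<in> S" "qop Y x y = m" for x y
  proof (rule ccontr)
    assume "x \<noteq> m"
    then have ne: "x \<noteq> y" using xy qop_idem[OF Q, of x] S by auto
    have car: "x \<in> qcarrier Y" "y \<in> qcarrier Y" "m \<in> qcarrier Y" using xy m S by auto
    from ne tot car consider "lt x y" | "lt y x" by blast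
    then show False
    proof cases
      case 1
      then have "lt (qop Y x y) (qop Y y y)" using mono car by blast
      then have "lt m y" using xy qop_idem[OF Q] car by simp
      then show False using m(2) xy(2) tr irr car by metis
    next
      case 2
      then have "lt (qop Y x y) (qop Y x x)" using mono car by blast
      then have "lt m x" using xy qop_idem[OF Q] car by simp
      then show False using m(2) xy(1) tr irr car by metis
    qed
  qed
  then show thesis using that m(1) by blast
qed

text \<open>The largest colour propagates along the knot: backwards if the crossings are positive, forwards if they are negative.\<close>

lemma bi_ordered_coloring_constant:
  assumes Y: "bi_orderable Y" and Q: "is_quandle Y" and D: "gauss_data D" and circ: "circular D"
    and pn: "positive_diagram D \<or> negative_diagram D" and c: "coloring Y D c"
  obtains m where "\<And>v. v \<in> points D \<Longrightarrow> c v = m"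
proof -
  note gd = gauss_dataD[OF D]
  have car: "c v \<in> qcarrier Y" and pass: "passes Y D c (c v) (nxt D v)" if "v \<in> points D" for v
    using c that unfolding coloring_def by blast+
  have S: "finite (c ` points D)" "c ` points D \<noteq> {}" "c ` points D \<subseteq> qcarrier Y"
    using gd(1,2) car by auto
  obtain m where m: "m \<in> c ` points D"
    "\<And>x y. x \<in> c ` points D \<Longrightarrow> y \<in> c ` points D \<Longrightarrow> qop Y x y = m \<Longrightarrow> x = m"
    by (rule bi_ordered_finite_max[OF Y Q S]) blast
  have step: "(positive_diagram D \<and> c (nxt D v) = m \<longrightarrow> c v = m) \<and>
      (negative_diagram D \<and> c v = m \<longrightarrow> c (nxt D v) = m)" if v: "v \<in> points D" for v
  proof (cases "nxt D v")
    case (Under k)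
    have pts: "Under k \<in> points D" "Over k \<in> points D" and k: "k \<in> crossings D"
      using gd(4)[OF v] gd(6,7) Under by auto
    show ?thesis
      using pass[OF v] m(2)[of "c v" "c (Over k)"] m(2)[of "c (Under k)" "c (Over k)"] v pts k Under
      by (auto simp: under_rule_def positive_diagram_def negative_diagram_def)
  qed (use pass[OF v] in auto)
  let ?Z = "{v \<in> points D. c v = m}"
  have "?Z = points D" using pn
  proof
    assume pos: "positive_diagram D"
    show ?thesis
    proof (rule ccontr)
      assume ne: "?Z \<noteq> points D"
      \<comment> \<open>Backward propagation of the largest colour is forward closure of the
        complement, to which circularity applies.\<close>
      have "\<forall>v\<in>points D - ?Z. nxt D v \<in> points D - ?Z" using step pos gd(4) by blast
      moreover have "points D - ?Z \<noteq> {}" using ne by blast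
      ultimately have "points D - ?Z = points D" using circ unfolding circular_def by blast
      then show False using m(1) by blast
    qed
  next
    assume neg: "negative_diagram D"
    have "\<forall>v\<in>?Z. nxt D v \<in> ?Z" using step neg gd(4) by blast
    moreover have "?Z \<noteq> {}" "?Z \<subseteq> points D" using m(1) by auto
    ultimately show ?thesis using circ unfolding circular_def by blast
  qed
  then show thesis using that by blast
qed


section \<open>Connected sums\<close>

text \<open>The crossing relation makes the right translations by the two under colours conjugate
  through that of the over colour. This is self-distributivity, and around the crossing it reads as
  flatness.\<close>

lemma crossing_flat_right_translations:
  assumes Q: "is_quandle Y"
    and car: "f (Over k) \<in> qcarrier Y" "f (Under k) \<in> qcarrier Y" "f (prv D (Under k)) \<in> qcarrier Y"
    and rule: "under_rule Y (csign D k) (f (prv D (Under k))) (f (Over k)) (f (Under k))"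
    and over: "f (prv D (Over k)) = f (Over k)"
  shows "crossing_flat D (qcarrier Y) (\<lambda>v x. qop Y x (f v)) k"
  using rule qop_dist[OF Q _ car(3,1)] qop_dist[OF Q _ car(2,1)]
  unfolding crossing_flat_def under_rule_def over by (simp split: if_splits)

text \<open>
  A colouring of a knot diagram cut open at the edge \<open>p\<close>: by faithfulness and planarity, the colour
  \<open>e\<close> at the end of the edge is the one at its beginning.
\<close>

lemma cut_coloring_closes:
  assumes Y: "bi_orderable Y" and Q: "is_quandle Y"
    and D: "gauss_data D" "planar D" "circular D"
    and p: "p \<in> points D" and e: "e \<in> qcarrier Y"
    and car: "\<And>v. v \<in> points D \<Longrightarrow> c v \<in> qcarrier Y"
    and pass: "\<And>v. v \<in> points D \<Longrightarrow> v \<noteq> p \<Longrightarrow> passes Y D c (c v) (nxt D v)"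
    and cut: "passes Y D c e (nxt D p)"
  shows "c p = e"
proof -
  note gd = gauss_dataD[OF D(1)] and pv = prv_simps[OF D(1)]
  note dist = qop_dist[OF Q] and cancel = qop_cancel[OF Q] and closed = qop_closed[OF Q]
  let ?act = "\<lambda>v x. qop Y x (c v)" and ?R = "qcarrier Y"
  have over: "c (prv D (Over k)) = c (Over k)" if "k \<in> crossings D" "nxt D p \<noteq> Over k" for k
  proof -
    have "prv D (Over k) \<noteq> p" using pv(2)[of "Over k"] gd(7)[of k] that by auto
    then show ?thesis using pass[of "prv D (Over k)"] pv(2,3)[of "Over k"] gd(7)[of k] that by auto
  qed
  have under: "under_rule Y (csign D k) (c (prv D (Under k))) (c (Over k)) (c (Under k))"
    if "k \<in> crossings D" "nxt D p \<noteq> Under k" for k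
  proof -
    have "prv D (Under k) \<noteq> p" using pv(2)[of "Under k"] gd(6)[of k] that by auto
    then show ?thesis using pass[of "prv D (Under k)"] pv(2,3)[of "Under k"] gd(6)[of k] that by auto
  qed
  have np: "nxt D p \<in> points D" using gd(4)[OF p] .
  \<comment> \<open>The edge \<open>p\<close> acts by its initial colour \<open>c p\<close>, so only
    the vertex at its end is affected by the cut. The others are flat by the colouring rules, and
    the sphere then forces flatness at this one.\<close>
  have flat: "flat D ?R ?act (nxt D p)"
  proof (rule flat_at_last_vertex[OF D _ np])
    fix v assume v: "v \<in> points D"
    show "bij_betw (?act v) ?R ?R"
      unfolding bij_betw_def
    proof
      show "inj_on (?act v) ?R" using cancel car[OF v] by (simp add: inj_on_def)
      show "?act v ` ?R = ?R" using closed qop_ex[OF Q] car[OF v] by (auto simp: image_iff)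
    qed
  next
    fix w assume w: "w \<in> points D" "vertex_of w \<noteq> vertex_of (nxt D p)"
    have cr: "crossing_flat D ?R ?act k" if k: "k \<in> crossings D" "vertex_of (nxt D p) \<noteq> Over k" for k
    proof -
      have "nxt D p \<noteq> Over k" "nxt D p \<noteq> Under k" using k by auto
      then show ?thesis
        by (intro crossing_flat_right_translations[OF Q] over under k(1))
          (use k(1) car gd(6,7) pv(3) in auto)
    qed
    show "flat D ?R ?act w"
    proof (cases w)
      case (Mark m)
      then have "nxt D p \<noteq> Mark m" using w by auto
      then have "prv D (Mark m) \<noteq> p" using pv(2)[of "Mark m"] w Mark by auto
      then have "c (Mark m) = c (prv D (Mark m))"
        using pass[of "prv D (Mark m)"] pv(2,3)[of "Mark m"] w Mark by auto
      then show ?thesis using Mark by simp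
    next
      case (Over k)
      then show ?thesis using cr[of k] w gd(7) by auto
    next
      case (Under k)
      then show ?thesis using cr[of k] w gd(6) by auto
    qed
  qed
  have prv_p: "prv D (nxt D p) = p" using pv(1)[OF p] .
  note faithful = bi_ordered_faithful[OF Y _ _ _ _ Q]
  obtain x where x: "x \<in> ?R" using e by blast
  show ?thesis
  \<comment> \<open>Flatness involves \<open>c p\<close>, the cut condition involves
    \<open>e\<close>. In each case a comparison yields an element on which the right translations by
    \<open>c p\<close> and \<open>e\<close> agree.\<close>
  proof (cases "nxt D p")
    case (Mark m)
    have "qop Y x (c p) = qop Y x e"
      using flat cut x prv_p unfolding Mark by simp
    then show ?thesis using faithful x car[OF p] e by blast
  next
    case (Over k)
    have k: "k \<in> crossings D" and pts: "Over k \<in> points D" "Under k \<in> points D" "prv D (Under k) \<in> points D"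
      using np gd(6,7) pv(3) Over by auto
    let ?x = "c (prv D (Under k))" and ?z = "c (Under k)"
    have y: "c (Over k) = e" using cut Over by simp
    have rule: "under_rule Y (csign D k) ?x e ?z" using under[OF k] Over y by simp
    have fl: "crossing_flat D ?R ?act k" using flat Over by simp
    have pO: "prv D (Over k) = p" using prv_p Over by simp
    show ?thesis
    proof (cases "csign D k = 1")
      case True
      have "qop Y (qop Y x ?x) (c p) = qop Y (qop Y x e) ?z"
        using fl x True unfolding crossing_flat_def y pO by simp
      also have "\<dots> = qop Y (qop Y x ?x) e"
        using rule True dist[OF x car[OF pts(3)] e] by (simp add: under_rule_def)
      finally show ?thesis by (rule faithful[rotated -1]) (use closed x car pts p e in auto)
    next
      case False
      have "qop Y (qop Y x (c p)) ?x = qop Y (qop Y x ?z) e"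
        using fl x False unfolding crossing_flat_def y pO by simp
      also have "\<dots> = qop Y (qop Y x e) ?x"
        using rule False dist[OF x car[OF pts(2)] e] by (simp add: under_rule_def)
      finally have "qop Y x (c p) = qop Y x e"
        using cancel closed x car[OF p] car[OF pts(3)] e by simp
      then show ?thesis using faithful x car[OF p] e by blast
    qed
  next
    case (Under k)
    have k: "k \<in> crossings D" and pts: "Over k \<in> points D" "Under k \<in> points D"
      using np gd(6,7) Under by auto
    let ?y = "c (Over k)" and ?z = "c (Under k)"
    have rule: "under_rule Y (csign D k) e ?y ?z" using cut Under by simp
    have fl: "crossing_flat D ?R ?act k" using flat Under by simp
    have pU: "prv D (Under k) = p" using prv_p Under by simp
    have pO: "c (prv D (Over k)) = ?y" using over[OF k] Under by simp
    show ?thesis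
    proof (cases "csign D k = 1")
      case True
      have "qop Y (qop Y x (c p)) ?y = qop Y (qop Y x ?y) ?z"
        using fl x True unfolding crossing_flat_def pU pO by simp
      also have "\<dots> = qop Y (qop Y x e) ?y"
        using rule True dist[OF x e car[OF pts(1)]] by (simp add: under_rule_def)
      finally have "qop Y x (c p) = qop Y x e"
        using cancel closed x car[OF p] car[OF pts(1)] e by simp
      then show ?thesis using faithful x car[OF p] e by blast
    next
      case False
      have "qop Y (qop Y x ?y) (c p) = qop Y (qop Y x ?z) ?y"
        using fl x False unfolding crossing_flat_def pU pO by simp
      also have "\<dots> = qop Y (qop Y x ?y) e"
        using rule False dist[OF x car[OF pts(2)] car[OF pts(1)]] by (simp add: under_rule_def)
      finally show ?thesis by (rule faithful[rotated -1]) (use closed x car pts p e in auto)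
    qed
  qed
qed

section \<open>Colourings of a diagram sum\<close>

context
  fixes D E :: diagram and p q :: point
  assumes D: "gauss_data D" and E: "gauss_data E" and disj: "points D \<inter> points E = {}"
    and p: "p \<in> points D" and q: "q \<in> points E"
begin

lemma points_diagram_sum: "points (diagram_sum D p E q) = points D \<union> points E"
  by (simp add: diagram_sum_def)

lemma nxt_diagram_sum:
  "nxt (diagram_sum D p E q) p = nxt E q" "nxt (diagram_sum D p E q) q = nxt D p"
  "v \<in> points D - {p} \<Longrightarrow> nxt (diagram_sum D p E q) v = nxt D v"
  "v \<in> points E - {q} \<Longrightarrow> nxt (diagram_sum D p E q) v = nxt E v"
  using disj p q by (auto simp: diagram_sum_def)

lemma passes_diagram_sum:
  assumes "w \<in> points D" "\<And>v. v \<in> points D \<Longrightarrow> f' v = f v"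
  shows "passes X (diagram_sum D p E q) f' a w = passes X D f a w"
  by (rule passes_agree[OF D assms]) (auto simp: diagram_sum_def)

text \<open>In the sum, the edge \<open>p\<close> leads into \<open>E\<close> and the edge
  \<open>q\<close> returns from it. Seen from \<open>D\<close>, this is a colouring cut open at
  \<open>p\<close> that leaves with \<open>c p\<close> and comes back with
  \<open>c q\<close>.\<close>

lemma coloring_diagram_sum_restrict:
  assumes Y: "bi_orderable Y" and Q: "is_quandle Y" and pl: "planar D" "circular D"
    and c: "coloring Y (diagram_sum D p E q) c"
  shows "coloring Y D c"
proof -
  have car: "c v \<in> qcarrier Y" if "v \<in> points D \<union> points E" for v
    using c that unfolding coloring_def points_diagram_sum by blast
  have passS: "passes Y (diagram_sum D p E q) c (c v) (nxt (diagram_sum D p E q) v)"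
    if "v \<in> points D \<union> points E" for v
    using c that unfolding coloring_def points_diagram_sum by blast
  have pass: "passes Y D c (c v) (nxt D v)" if "v \<in> points D" "v \<noteq> p" for v
    using passS[of v] that nxt_diagram_sum(3)[of v] passes_diagram_sum[of "nxt D v" c c Y]
      gauss_dataD(4)[OF D, of v] by auto
  have "passes Y D c (c q) (nxt D p)"
    using passS[of q] q nxt_diagram_sum(2) passes_diagram_sum[of "nxt D p" c c Y] gauss_dataD(4)[OF D p]
    by auto
  then have "c p = c q" and "passes Y D c (c q) (nxt D p)"
    using cut_coloring_closes[OF Y Q D pl p, of "c q" c] car pass q by auto
  then have "passes Y D c (c v) (nxt D v)" if "v \<in> points D" for v
    using pass[OF that] by (cases "v = p") simp_all
  then show ?thesis unfolding coloring_def using car by blast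
qed

text \<open>By idempotence the constant colour \<open>f p\<close> satisfies every rule inside
  \<open>E\<close>, and it matches \<open>f\<close> at both joints.\<close>

lemma coloring_diagram_sum_extend:
  assumes X: "is_quandle X" and f: "coloring X D f"
  shows "coloring X (diagram_sum D p E q) (\<lambda>v. if v \<in> points D then f v else f p)"
    (is "coloring X ?S ?f")
proof -
  have car: "f v \<in> qcarrier X" and pass: "passes X D f (f v) (nxt D v)" if "v \<in> points D" for v
    using f that unfolding coloring_def by blast+
  have fE: "?f v = f p" if "v \<in> points E" for v using that disj by auto
  have passE: "passes X ?S ?f (f p) w" if w: "w \<in> points E" for w
    using under_rule_refl[OF X car[OF p]] fE w passes_over_in[OF E w] by (cases w) auto
  have passD: "passes X ?S ?f a w = passes X D f a w" if "w \<in> points D" for a w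
    by (rule passes_diagram_sum[OF that]) simp
  have nD: "nxt D v \<in> points D" if "v \<in> points D" for v using gauss_dataD(4)[OF D that] .
  have nE: "nxt E v \<in> points E" if "v \<in> points E" for v using gauss_dataD(4)[OF E that] .
  have "passes X ?S ?f (?f v) (nxt ?S v)" if v: "v \<in> points D \<union> points E" for v
  proof -
    consider "v = p" | "v = q" | "v \<in> points D - {p}" | "v \<in> points E - {q}" using v by blast
    then show ?thesis
    proof cases
      case 1
      then show ?thesis using passE[OF nE[OF q]] nxt_diagram_sum(1) p by simp
    next
      case 2
      then show ?thesis using passD[OF nD[OF p]] nxt_diagram_sum(2) pass[OF p] fE[OF q] by (simp only: refl)
    next
      case 3
      then show ?thesis using passD[OF nD[of v]] nxt_diagram_sum(3)[OF 3] pass[of v] by simp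
    next
      case 4
      then show ?thesis using passE[OF nE[of v]] nxt_diagram_sum(4)[OF 4] fE[of v] by simp
    qed
  qed
  then show ?thesis unfolding coloring_def points_diagram_sum using car p by auto
qed

end


section \<open>Knots\<close>

lemma isotopic_diagrams:
  assumes "diagram_of A L" "diagram_of B L"
  shows "isotopic A B"
proof -
  have "isotopic A A" "isotopic B B"
    using assms by (auto simp: diagram_of_def isotopic_def)
  then show ?thesis
    using assms unfolding diagram_of_def by (metis Quotient_rel[OF Quotient_link])
qed

lemma diagram_ofD:
  assumes "diagram_of D L"
  shows "gauss_data D" "planar D"
  using assms by (auto simp: diagram_of_def link_diagram_def)

lemma constant_colorings_isotopic:
  assumes iso: "isotopic A B" and X: "is_quandle X" and A: "gauss_data A"
    and const: "\<And>f. coloring X A f \<Longrightarrow> \<exists>x. \<forall>v\<in>points A. f v = x"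
    and f: "coloring X B f"
  shows "\<exists>x. \<forall>v\<in>points B. f v = x"
proof -
  from lifts_isotopic[OF iso X X] f obtain f' where f': "coloring X A f'"
    and lift: "\<And>\<phi> c'. hom X X \<phi> \<Longrightarrow> coloring X A c' \<Longrightarrow> \<forall>v\<in>points A. \<phi> (c' v) = f' v \<Longrightarrow>
        \<exists>c. coloring X B c \<and> (\<forall>v\<in>points B. \<phi> (c v) = f v)"
    unfolding lifts_def by blast
  obtain x where x: "\<forall>v\<in>points A. f' v = x" using const[OF f'] by blast
  obtain a where a: "a \<in> points A" using gauss_dataD(2)[OF A] by blast
  have "x \<in> qcarrier X" using f' x a unfolding coloring_def by metis
  then have "hom X X (\<lambda>_. x)" by (simp add: hom_def qop_idem[OF X])
  from lift[OF this f'] x have "\<forall>v\<in>points B. x = f v" by auto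
  then show ?thesis by metis
qed

text \<open>Its colourings are the two-valued functions that are constant on each component.
  Invariance of colourings thus shows that having one component does not depend on the diagram of a
  knot.\<close>

definition trivial_quandle :: "bool magma" where
  "trivial_quandle = \<lparr> qcarrier = UNIV, qop = (\<lambda>x y. x) \<rparr>"

lemma is_quandle_trivial: "is_quandle trivial_quandle"
  by (simp add: is_quandle_def trivial_quandle_def)

lemma coloring_trivial_iff: "coloring trivial_quandle D f \<longleftrightarrow> (\<forall>v\<in>points D. f (nxt D v) = f v)"
proof -
  have "passes trivial_quandle D f a w \<longleftrightarrow> f w = a" for a w
    by (cases w) (auto simp: under_rule_def trivial_quandle_def)
  then show ?thesis by (simp add: coloring_def trivial_quandle_def)
qed

lemma circular_iff_colorings_constant:
  assumes D: "gauss_data D"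
  shows "circular D \<longleftrightarrow> (\<forall>f. coloring trivial_quandle D f \<longrightarrow> (\<exists>x. \<forall>v\<in>points D. f v = x))"
proof
  assume circ: "circular D"
  show "\<forall>f. coloring trivial_quandle D f \<longrightarrow> (\<exists>x. \<forall>v\<in>points D. f v = x)"
  proof (intro allI impI)
    fix f assume f: "coloring trivial_quandle D f"
    let ?Z = "{v \<in> points D. f v}"
    have "\<forall>v\<in>?Z. nxt D v \<in> ?Z"
    proof
      fix v assume "v \<in> ?Z"
      then show "nxt D v \<in> ?Z"
        using f gauss_dataD(4)[OF D, of v] unfolding coloring_trivial_iff by simp
    qed
    moreover have "?Z \<subseteq> points D" by auto
    ultimately have "?Z = {} \<or> ?Z = points D" using circ unfolding circular_def by meson
    then show "\<exists>x. \<forall>v\<in>points D. f v = x"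
    proof
      assume "?Z = {}" then show ?thesis by (intro exI[of _ False]) auto
    next
      assume "?Z = points D" then show ?thesis by (intro exI[of _ True]) auto
    qed
  qed
next
  assume const: "\<forall>f. coloring trivial_quandle D f \<longrightarrow> (\<exists>x. \<forall>v\<in>points D. f v = x)"
  show "circular D"
    unfolding circular_def
  proof (intro allI impI)
    fix Z assume Z: "Z \<subseteq> points D" "Z \<noteq> {}" "\<forall>v\<in>Z. nxt D v \<in> Z"
    \<comment> \<open>On a finite set, an injective map that sends \<open>Z\<close> into itself
      permutes \<open>Z\<close>. So membership in \<open>Z\<close> does not change along
      \<open>nxt\<close>, which makes it a colouring.\<close>
    have inj: "inj_on (nxt D) Z"
      using gauss_dataD(3)[OF D] Z(1) by (auto simp: bij_betw_def intro: inj_on_subset)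
    have "nxt D ` Z = Z"
      using Z(1,3) inj gauss_dataD(1)[OF D] by (intro endo_inj_surj) (auto intro: finite_subset)
    have "nxt D v \<in> Z \<longleftrightarrow> v \<in> Z" if v: "v \<in> points D" for v
    proof
      assume "nxt D v \<in> Z"
      then obtain u where u: "u \<in> Z" "nxt D v = nxt D u" using \<open>nxt D ` Z = Z\<close> by (metis imageE)
      then have "v = u" using gauss_dataD(5)[OF D v] Z(1) by blast
      then show "v \<in> Z" using u(1) by simp
    qed (use Z(3) in blast)
    then have "coloring trivial_quandle D (\<lambda>v. v \<in> Z)" by (simp add: coloring_trivial_iff)
    then obtain x where "\<forall>v\<in>points D. (v \<in> Z) = x" using const by blast
    then show "Z = points D" using Z(1,2) by blast
  qed
qed

lemma circular_isotopic:
  assumes iso: "isotopic A B" and AB: "gauss_data A" "gauss_data B" and "circular A"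
  shows "circular B"
  using assms(4) constant_colorings_isotopic[OF iso is_quandle_trivial AB(1)]
  unfolding circular_iff_colorings_constant[OF AB(1)] circular_iff_colorings_constant[OF AB(2)]
  by blast

lemma circular_one_component:
  assumes D: "gauss_data D" and one: "card (components D) = 1"
  shows "circular D"
  unfolding circular_def
proof (intro allI impI)
  fix Z assume Z: "Z \<subseteq> points D" "Z \<noteq> {}" "\<forall>v\<in>Z. nxt D v \<in> Z"
  obtain w where w: "w \<in> Z" using Z(2) by blast
  have sub: "orbit (nxt D) w \<subseteq> Z"
  proof
    fix v assume "v \<in> orbit (nxt D) w"
    then show "v \<in> Z" by induction (use w Z(3) in auto)
  qed
  obtain C where C: "components D = {C}" using one card_1_singletonE by blast
  have "orbit (nxt D) v = C" if "v \<in> points D" for v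
    using C that unfolding components_def by blast
  then have "nxt D v \<in> orbit (nxt D) w" if "v \<in> points D" for v
    using that w Z(1) orbit.base[of "nxt D" v] by blast
  then have "nxt D ` points D \<subseteq> Z" using sub by blast
  then show "Z = points D" using gauss_dataD(3)[OF D] Z(1) by (auto simp: bij_betw_def)
qed

lemma circular_knot_diagram:
  assumes "is_knot K" "diagram_of D K"
  shows "circular D"
proof -
  obtain D0 where "diagram_of D0 K" "card (components D0) = 1"
    using assms(1) unfolding is_knot_def by blast
  then show ?thesis
    using circular_isotopic[OF isotopic_diagrams] circular_one_component diagram_ofD(1) assms(2) by blast
qed

text \<open>The largest-colour argument runs on a positive or negative diagram of \<open>K\<close>;
  its conclusion is carried over to \<open>D\<close>.\<close>

lemma bi_ordered_knot_coloring_constant: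
  assumes K: "is_knot K" "positive_link K \<or> negative_link K" and D: "diagram_of D K"
    and Y: "bi_orderable Y" "is_quandle Y" and c: "coloring Y D c"
  obtains m where "\<And>v. v \<in> points D \<Longrightarrow> c v = m"
proof -
  obtain P where P: "diagram_of P K" "positive_diagram P \<or> negative_diagram P"
    using K(2) unfolding positive_link_def negative_link_def by blast
  have "\<exists>x. \<forall>v\<in>points P. f v = x" if "coloring Y P f" for f
    using bi_ordered_coloring_constant[OF Y diagram_ofD(1)[OF P(1)] circular_knot_diagram[OF K(1) P(1)] P(2) that]
    by metis
  then have "\<exists>x. \<forall>v\<in>points D. c v = x"
    using constant_colorings_isotopic[OF isotopic_diagrams[OF P(1) D] Y(2) diagram_ofD(1)[OF P(1)] _ c]
    by blast
  then show thesis using that by blast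
qed

text \<open>The determinant may be computed from another diagram \<open>A\<close>. If all dihedral
  colourings of \<open>D\<close> were constant, so would be those of \<open>A\<close>.\<close>

lemma knot_fox_coloring:
  assumes K: "is_knot K" "has_determinant K n" "prime n" and D: "diagram_of D K"
  obtains f v w where "coloring (dihedral n) D f" "v \<in> points D" "w \<in> points D" "f v \<noteq> f w"
proof -
  obtain A \<Delta> where A: "diagram_of A K" "alexander_polynomial A \<Delta>" "n = nat \<bar>poly \<Delta> (-1)\<bar>"
    using K(2) unfolding has_determinant_def by blast
  have "\<bar>poly \<Delta> (-1)\<bar> = int n" using A(3) by simp
  then obtain f v w where f: "coloring (dihedral n) A f" "v \<in> points A" "w \<in> points A" "f v \<noteq> f w"
    using fox_coloring_exists[OF diagram_ofD[OF A(1)] circular_knot_diagram[OF K(1) A(1)] A(2) K(3)]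
    by blast
  have "\<exists>g. coloring (dihedral n) D g \<and> \<not> (\<exists>x. \<forall>v\<in>points D. g v = x)"
  proof (rule ccontr)
    assume "\<not> ?thesis"
    then have "\<exists>x. \<forall>v\<in>points A. f v = x"
      using constant_colorings_isotopic[OF isotopic_diagrams[OF D A(1)]
          is_quandle_dihedral[OF prime_gt_0_nat[OF K(3)]] diagram_ofD(1)[OF D] _ f(1)] by blast
    then show False using f by metis
  qed
  then show thesis using that gauss_dataD(2)[OF diagram_ofD(1)[OF D]] by (metis ex_in_conv)
qed

theorem corollary6p8:
  fixes K :: link and n :: nat
  assumes "is_knot K"
    and "alternating K"
    and "positive_link K \<or> negative_link K"
    and "has_determinant K n" and "prime n"
  shows "(\<forall>L M. connected_sum K L M \<longrightarrow>
            (\<forall>D. diagram_of D M \<longrightarrow> \<not> bi_orderable (link_quandle D))) \<and>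
         (\<forall>D. diagram_of D K \<longrightarrow> \<not> bi_orderable (link_quandle D))"
proof (intro conjI allI impI notI)
  have X: "is_quandle (dihedral n)" using assms(5) by (intro is_quandle_dihedral prime_gt_0_nat)
  {
    fix D assume D: "diagram_of D K" and Y: "bi_orderable (link_quandle D)"
    have g: "gauss_data D" and Q: "is_quandle (link_quandle D)"
      using D is_quandle_link_quandle by (auto simp: diagram_of_def link_diagram_def)
    obtain f v w where f: "coloring (dihedral n) D f" "v \<in> points D" "w \<in> points D" "f v \<noteq> f w"
      using knot_fox_coloring[OF assms(1,4,5) D] by blast
    obtain \<phi> where "\<And>v. v \<in> points D \<Longrightarrow> \<phi> (universal_coloring D v) = f v"
      using universal_coloring_factor[OF g X f(1)] by blast
    moreover obtain m where "\<And>v. v \<in> points D \<Longrightarrow> universal_coloring D v = m"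
      using bi_ordered_knot_coloring_constant[OF assms(1,3) D Y Q coloring_universal[OF g]] by blast
    ultimately show False using f by metis
  next
    fix L M D' assume sum: "connected_sum K L M" and D': "diagram_of D' M"
      and Y: "bi_orderable (link_quandle D')"
    let ?Y = "link_quandle D'"
    have g: "gauss_data D'" and Q: "is_quandle ?Y"
      using D' is_quandle_link_quandle by (auto simp: diagram_of_def link_diagram_def)
    obtain D E p q where D: "diagram_of D K" and E: "diagram_of E L" and disj: "points D \<inter> points E = {}"
      and p: "p \<in> points D" and q: "q \<in> points E" and S: "diagram_of (diagram_sum D p E q) M"
      using sum unfolding connected_sum_def by blast
    let ?S = "diagram_sum D p E q"
    note gD = diagram_ofD[OF D] and gE = diagram_ofD(1)[OF E]
    obtain f v w where f: "coloring (dihedral n) D f" "v \<in> points D" "w \<in> points D" "f v \<noteq> f w"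
      using knot_fox_coloring[OF assms(1,4,5) D] by blast
    let ?f = "\<lambda>v. if v \<in> points D then f v else f p"
    have "coloring (dihedral n) ?S ?f"
      by (rule coloring_diagram_sum_extend[OF gD(1) gE disj p q X f(1)])
    \<comment> \<open>\<open>f'\<close> lives on the given diagram \<open>D'\<close> of
      \<open>M\<close>, where it factors through the universal colouring. \<open>lift\<close> brings
      this factorization to the sum diagram, as a colouring of \<open>?S\<close> by the quandle of
      \<open>D'\<close> that \<open>\<phi>\<close> maps to \<open>?f\<close>.\<close>
    with lifts_isotopic[OF isotopic_diagrams[OF D' S] X Q] obtain f' where
      f': "coloring (dihedral n) D' f'" and lift: "\<And>\<phi> c'. hom ?Y (dihedral n) \<phi> \<Longrightarrow> coloring ?Y D' c' \<Longrightarrow>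
        \<forall>v\<in>points D'. \<phi> (c' v) = f' v \<Longrightarrow> \<exists>c. coloring ?Y ?S c \<and> (\<forall>v\<in>points ?S. \<phi> (c v) = ?f v)"
      unfolding lifts_def by blast
    obtain \<phi> where \<phi>: "hom ?Y (dihedral n) \<phi>" "\<And>v. v \<in> points D' \<Longrightarrow> \<phi> (universal_coloring D' v) = f' v"
      by (rule universal_coloring_factor[OF g X f']) blast
    obtain c where c: "coloring ?Y ?S c" "\<forall>v\<in>points ?S. \<phi> (c v) = ?f v"
      using lift[OF \<phi>(1) coloring_universal[OF g]] \<phi>(2) by blast
    have "coloring ?Y D c"
      by (rule coloring_diagram_sum_restrict[OF gD(1) gE disj p q Y Q gD(2)
            circular_knot_diagram[OF assms(1) D] c(1)])
    then obtain m where m: "\<And>v. v \<in> points D \<Longrightarrow> c v = m"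
      using bi_ordered_knot_coloring_constant[OF assms(1,3) D Y Q] by blast
    have "f u = \<phi> m" if "u \<in> points D" for u
      using c(2) m[OF that] that points_diagram_sum[OF gD(1) gE disj p q] by auto
    then show False using f by metis
  }
qed

end
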